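(* Let Assumptions 1 and 2 and the feasibility assumption (all stated in the context) hold. Let $\theta>0$, $\tau_t=1/t^{\theta}$, $\Psi_t=\sum_{k=1}^t\tau_k$, let $\kappa\in(0,1)$ be a constant, and let $\{x_{i,t}\}$ be the sequences generated by Algorithm 1 (described in the context) with event-triggering thresholds $\tau_t$ and $$\alpha_t=\sqrt{\frac{\Psi_t}{t}},\quad \beta_t=\frac{1}{t^{\kappa}},\quad \gamma_t=\frac{1}{t^{1-\kappa}},\quad \xi_t=\frac{1}{t+1},\quad \delta_t=\frac{r(\mathbb{X})}{t+1},\qquad \forall t\in\mathbb{N}_+.$$ Then for any $T\in\mathbb{N}_+$ (with $T\ge2$ when $\theta=1$) and any comparator sequence $y_{[T]}=(y_1,\dots,y_T)\in\mathcal{X}_T$, $$\mathbf{E}[\mathrm{Net\text{-}Reg}(\{x_{i,t}\},y_{[T]})]=\begin{cases}\mathcal{O}\big(T^{\max\{\kappa,1-\theta/2\}}+T^{\theta/2}P_T\big), & 0<\theta<1,\\ \mathcal{O}\big(T^{\kappa}+\sqrt{T\log(T)}+\sqrt{\tfrac{T}{\log(T)}}\,P_T\big), & \theta=1,\\ \mathcal{O}\big(T^{\max\{\kappa,1/2\}}+\sqrt{T}\,P_T\big), & \theta>1,\end{cases}$$ $$\mathbf{E}[\mathrm{Net\text{-}CCV}(\{x_{i,t}\})]=\begin{cases}\mathcal{O}\big(T^{\max\{1-\kappa/2,\,1-\theta/4\}}\big), & 0<\theta<1,\\ \mathcal{O}\big(T^{1-\kappa/2}+T^{3/4}\log(T)^{1/4}\big),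 & \theta=1,\\ \mathcal{O}\big(T^{\max\{1-\kappa/2,\,3/4\}}\big), & \theta>1,\end{cases}$$ where $P_T=\sum_{t=1}^{T-1}\|y_{t+1}-y_t\|$ is the path-length of $y_{[T]}$.
   Context: Setting. There are $n$ agents, $i\in[n]=\{1,\dots,n\}$, and a set $\mathbb{X}\subseteq\mathbb{R}^p$. For each $t\in\mathbb{N}_+$ and $i\in[n]$ there are a local loss function $f_{i,t}:\mathbb{X}\to\mathbb{R}$ and a local constraint function $g_{i,t}:\mathbb{X}\to\mathbb{R}^{m_i}$. Set $f_t(x)=\frac1n\sum_{j=1}^n f_{j,t}(x)$, $g_t(x)=\mathrm{col}(g_{1,t}(x),\dots,g_{n,t}(x))\in\mathbb{R}^m$, $m=\sum_i m_i$. $\|\cdot\|$ is the Euclidean norm (spectral norm for matrices), $[\cdot]_+$ is the componentwise positive part, $\mathcal{P}_{\mathbb{K}}$ is Euclidean projection onto $\mathbb{K}$, $\mathbb{B}^p$ and $\mathbb{S}^p$ are the unit ball and unit sphere of $\mathbb{R}^p$ centered at the origin, vector inequalities are componentwise. Performance measures: $\mathrm{Net\text{-}Reg}(\{x_{i,t}\},y_{[T]})=\frac1n\sum_{i=1}^n\sum_{t=1}^T f_t(x_{i,t})-\sum_{t=1}^T f_t(y_t)$ and $\mathrm{Net\text{-}CCV}(\{x_{i,t}\})=\frac1n\sum_{i=1}^n\sum_{t=1}^T\|[g_t(x_{i,t})]_+\|$. $\mathcal{X}_T=\{(x_1,\dots,x_T): x_t\in\mathbb{X},\ g_t(x_t)\le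 \mathbf{0}_m\ \forall t\in[T]\}$ is the set of feasible decision sequences. Feasibility assumption (standing): for every $T\in\mathbb{N}_+$, $\mathcal{X}_T$ is non-empty, and so is the set of feasible static sequences $\{(x,\dots,x): x\in\mathbb{X},\ g_t(x)\le\mathbf{0}_m\ \forall t\in[T]\}$. Assumption 1. (i) $\mathbb{X}$ is convex and closed, and $r(\mathbb{X})\mathbb{B}^p\subseteq\mathbb{X}\subseteq R(\mathbb{X})\mathbb{B}^p$ for constants $r(\mathbb{X}),R(\mathbb{X})>0$. (ii) All $f_{i,t}$ and $g_{i,t}$ are convex (the latter componentwise), and there is a constant $F_1$ with $|f_{i,t}(x)-f_{i,t}(y)|\le F_1$ and $\|g_{i,t}(x)\|\le F_1$ for all $x,y\in\mathbb{X}$, $i$, $t$. (iii) Subgradients $\partial f_{i,t}(x)\in\mathbb{R}^p$ and $\partial g_{i,t}(x)\in\mathbb{R}^{p\times m_i}$ exist and there is a constant $F_2$ with $\|\partial f_{i,t}(x)\|\le F_2$, $\|\partial g_{i,t}(x)\|\le F_2$ for all $x\in\mathbb{X}$, $i$, $t$. Assumption 2. For $t\in\mathbb{N}_+$, $\mathcal{G}_t=([n],\mathcal{E}_t)$ is a directed graph with mixing matrix $W_t\in\mathbb{R}^{n\times n}$ such that: (i) there is a constant $w\in(0,1)$ with $[W_t]_{ij}\ge w$ if $(j,i)\in\mathcal{E}_t$ or $i=j$, and $[W_t]_{ij}=0$ otherwise; (ii) $W_t$ is doubly stochastic; (iii) there is an integer $B>0$ such that $([n],\cup_{l=0}^{B-1}\mathcal{E}_{t+l})$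 is strongly connected for every $t$. Algorithm 1. Inputs: $r(\mathbb{X})$ and non-increasing sequences $\{\alpha_t\},\{\beta_t\},\{\gamma_t\},\{\tau_t\}\subseteq(0,+\infty)$, $\{\xi_t\}\subseteq(0,1)$, $\{\delta_t\}$ with $\delta_t\in(0,r(\mathbb{X})\xi_t]$. Initialization: $x_{i,1}\in(1-\xi_1)\mathbb{X}$, $\hat x_{i,1}=x_{i,1}$, $q_{i,1}=\mathbf{0}_{m_i}$. For $t=1,2,\dots$ and each $i\in[n]$: draw $u_{i,t}$ uniformly from $\mathbb{S}^p$ (all draws over $i,t$ independent), and set $\hat\partial f_{i,t}(x_{i,t})=\frac{p}{\delta_t}\big(f_{i,t}(x_{i,t}+\delta_tu_{i,t})-f_{i,t}(x_{i,t})\big)u_{i,t}\in\mathbb{R}^p$, $\hat\partial[g_{i,t}(x_{i,t})]_+=\frac{p}{\delta_t}\,u_{i,t}\big([g_{i,t}(x_{i,t}+\delta_tu_{i,t})]_+-[g_{i,t}(x_{i,t})]_+\big)^T\in\mathbb{R}^{p\times m_i}$, $z_{i,t+1}=\sum_{j=1}^n[W_t]_{ij}\hat x_{j,t}$, $\hat\omega_{i,t+1}=\hat\partial f_{i,t}(x_{i,t})+\hat\partial[g_{i,t}(x_{i,t})]_+\,q_{i,t}$, $x_{i,t+1}=\mathcal{P}_{(1-\xi_{t+1})\mathbb{X}}(z_{i,t+1}-\alpha_{t+1}\hat\omega_{i,t+1})$, $q_{i,t+1}=\big[(1-\beta_{t+1}\gamma_{t+1})q_{i,t}+\gamma_{t+1}\big([g_{i,t}(x_{i,t})]_++(\hat\partial[g_{i,t}(x_{i,t})]_+)^T(x_{i,t+1}-x_{i,t})\big)\big]_+$,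 and $\hat x_{i,t+1}=x_{i,t+1}$ if $\|x_{i,t+1}-\hat x_{i,t}\|\ge\tau_{t+1}$, otherwise $\hat x_{i,t+1}=\hat x_{i,t}$. $\mathbf{E}$ is expectation over the random vectors $u_{i,t}$. The constants hidden in $\mathcal{O}(\cdot)$ do not depend on $T$ or on the comparator sequence; they may depend on the other problem data and algorithm parameters. *)

theory Defs
  imports "HOL-Probability.Probability"
begin

text \<open>
  The agents are the elements of the finite type \<^typ>\<open>'n\<close>, so \<open>n = CARD('n)\<close>, and the
  decisions live in \<^typ>\<open>real^'p\<close>, so \<open>p = CARD('p)\<close>.  Time is \<^typ>\<open>nat\<close>, and only \<open>t \<ge> 1\<close>
  is ever used.  Since the number \<open>m i\<close> of constraints depends on the agent, a vector of
  dimension \<open>m i\<close> is a function \<^typ>\<open>nat \<Rightarrow> real\<close> of which only the entries below \<open>m i\<close> count,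
  with Euclidean norm \<open>L2_set v {..<m i}\<close>; a matrix with \<open>p\<close> rows and \<open>m i\<close> columns is the
  function \<^typ>\<open>nat \<Rightarrow> real^'p\<close> giving its columns.  The losses and constraints are total
  functions, but only their values on the decision set are ever constrained or used.
\<close>

subsection \<open>Losses and constraints\<close>

definition subgradient_on :: "'a::real_inner set \<Rightarrow> ('a \<Rightarrow> real) \<Rightarrow> 'a \<Rightarrow> 'a \<Rightarrow> bool" where
  "subgradient_on X \<phi> x s \<longleftrightarrow> (\<forall>y\<in>X. \<phi> y \<ge> \<phi> x + s \<bullet> (y - x))"

definition spectral_norm :: "nat \<Rightarrow> (nat \<Rightarrow> 'a::real_normed_vector) \<Rightarrow> real" where
  "spectral_norm m S = Sup {norm (\<Sum>k<m. v k *\<^sub>R S k) | v :: nat \<Rightarrow> real. L2_set v {..<m} \<le> 1}"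

text \<open>
  The subgradient bounds concern one subgradient at each point: at a boundary point of \<open>X\<close> the set
  of all subgradients relative to \<open>X\<close> is unbounded.
\<close>

definition problem_assms ::
  "(real^'p) set \<Rightarrow> ('n::finite \<Rightarrow> nat \<Rightarrow> real^'p \<Rightarrow> real) \<Rightarrow> ('n \<Rightarrow> nat) \<Rightarrow>
   ('n \<Rightarrow> nat \<Rightarrow> real^'p \<Rightarrow> nat \<Rightarrow> real) \<Rightarrow> real \<Rightarrow> real \<Rightarrow> real \<Rightarrow> real \<Rightarrow> bool" where
  "problem_assms X f m g r R F1 F2 \<longleftrightarrow>
     convex X \<and> closed X \<and> r > 0 \<and> R > 0 \<and> cball 0 r \<subseteq> X \<and> X \<subseteq> cball 0 R \<and>
     (\<forall>i. \<forall>t\<ge>1. convex_on X (f i t) \<and> (\<forall>k<m i. convex_on X (\<lambda>x. g i t x k))) \<and>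
     (\<forall>i. \<forall>t\<ge>1. (\<forall>x\<in>X. \<forall>y\<in>X. \<bar>f i t x - f i t y\<bar> \<le> F1) \<and>
                 (\<forall>x\<in>X. L2_set (g i t x) {..<m i} \<le> F1)) \<and>
     (\<forall>i. \<forall>t\<ge>1. \<forall>x\<in>X.
        (\<exists>s. subgradient_on X (f i t) x s \<and> norm s \<le> F2) \<and>
        (\<exists>S. (\<forall>k<m i. subgradient_on X (\<lambda>z. g i t z k) x (S k)) \<and>
             spectral_norm (m i) S \<le> F2))"

subsection \<open>Communication graphs\<close>

definition doubly_stochastic :: "real^'n^'n::finite \<Rightarrow> bool" where
  "doubly_stochastic W \<longleftrightarrow>
     (\<forall>i j. W $ i $ j \<ge> 0) \<and> (\<forall>i. (\<Sum>j\<in>UNIV. W $ i $ j) = 1) \<and> (\<forall>j. (\<Sum>i\<in>UNIV. W $ i $ j) = 1)"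

definition graph_assms :: "(nat \<Rightarrow> ('n::finite \<times> 'n) set) \<Rightarrow> (nat \<Rightarrow> real^'n^'n) \<Rightarrow> bool" where
  "graph_assms E W \<longleftrightarrow>
     (\<exists>w. 0 < w \<and> w < 1 \<and>
        (\<forall>t\<ge>1. \<forall>i j. if (j, i) \<in> E t \<or> i = j then W t $ i $ j \<ge> w else W t $ i $ j = 0)) \<and>
     (\<forall>t\<ge>1. doubly_stochastic (W t)) \<and>
     (\<exists>B>0. \<forall>t\<ge>1. \<forall>i j. (i, j) \<in> (\<Union>l<B. E (t + l))\<^sup>*)"

subsection \<open>Comparators and performance measures\<close>

definition feasible_seqs ::
  "(real^'p) set \<Rightarrow> ('n \<Rightarrow> nat) \<Rightarrow> ('n \<Rightarrow> nat \<Rightarrow> real^'p \<Rightarrow> nat \<Rightarrow> real) \<Rightarrow> nat \<Rightarrow> (nat \<Rightarrow> real^'p) set" where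
  "feasible_seqs X m g T = {y. \<forall>t\<in>{1..T}. y t \<in> X \<and> (\<forall>i. \<forall>k<m i. g i t (y t) k \<le> 0)}"

definition feasible_static_seqs ::
  "(real^'p) set \<Rightarrow> ('n \<Rightarrow> nat) \<Rightarrow> ('n \<Rightarrow> nat \<Rightarrow> real^'p \<Rightarrow> nat \<Rightarrow> real) \<Rightarrow> nat \<Rightarrow> (nat \<Rightarrow> real^'p) set" where
  "feasible_static_seqs X m g T = {y \<in> feasible_seqs X m g T. \<exists>x. \<forall>t. y t = x}"

definition feasibility_assm ::
  "(real^'p) set \<Rightarrow> ('n \<Rightarrow> nat) \<Rightarrow> ('n \<Rightarrow> nat \<Rightarrow> real^'p \<Rightarrow> nat \<Rightarrow> real) \<Rightarrow> bool" where
  "feasibility_assm X m g \<longleftrightarrow>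
     (\<forall>T\<ge>1. feasible_seqs X m g T \<noteq> {} \<and> feasible_static_seqs X m g T \<noteq> {})"

definition path_length :: "nat \<Rightarrow> (nat \<Rightarrow> 'a::real_normed_vector) \<Rightarrow> real" where
  "path_length T y = (\<Sum>t=1..T-1. norm (y (t + 1) - y t))"

definition global_loss :: "('n::finite \<Rightarrow> nat \<Rightarrow> 'a \<Rightarrow> real) \<Rightarrow> nat \<Rightarrow> 'a \<Rightarrow> real" where
  "global_loss f t z = (1 / real CARD('n)) * (\<Sum>j\<in>UNIV. f j t z)"

text \<open>The norm of the positive part of the stacked vector \<open>col(g\<^sub>1, \<dots>, g\<^sub>n)\<close>.\<close>

definition global_violation ::
  "('n::finite \<Rightarrow> nat) \<Rightarrow> ('n \<Rightarrow> nat \<Rightarrow> 'a \<Rightarrow> nat \<Rightarrow> real) \<Rightarrow> nat \<Rightarrow> 'a \<Rightarrow> real" where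
  "global_violation m g t z = L2_set (\<lambda>(j, k). max 0 (g j t z k)) (SIGMA j:UNIV. {..<m j})"

definition net_reg ::
  "('n::finite \<Rightarrow> nat \<Rightarrow> 'a \<Rightarrow> real) \<Rightarrow> nat \<Rightarrow> ('n \<Rightarrow> nat \<Rightarrow> 'a) \<Rightarrow> (nat \<Rightarrow> 'a) \<Rightarrow> real" where
  "net_reg f T x y =
     (1 / real CARD('n)) * (\<Sum>i\<in>UNIV. \<Sum>t=1..T. global_loss f t (x i t)) - (\<Sum>t=1..T. global_loss f t (y t))"

definition net_ccv ::
  "('n::finite \<Rightarrow> nat) \<Rightarrow> ('n \<Rightarrow> nat \<Rightarrow> 'a \<Rightarrow> nat \<Rightarrow> real) \<Rightarrow> nat \<Rightarrow> ('n \<Rightarrow> nat \<Rightarrow> 'a) \<Rightarrow> real" where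
  "net_ccv m g T x =
     (1 / real CARD('n)) * (\<Sum>i\<in>UNIV. \<Sum>t=1..T. global_violation m g t (x i t))"

subsection \<open>The algorithm\<close>

text \<open>
  The uniform distribution on the unit sphere (normalised surface measure): the probability of a
  set of directions is the fraction of the volume of the unit ball taken up by the cone over it.
  The origin, where the radial projection is not defined, is a null set.
\<close>

definition uniform_sphere :: "'a::euclidean_space measure" where
  "uniform_sphere = distr (uniform_measure lborel (cball 0 1)) borel (\<lambda>x. x /\<^sub>R norm x)"

definition two_point_est :: "real \<Rightarrow> (real^'p \<Rightarrow> real) \<Rightarrow> real^'p::finite \<Rightarrow> real^'p \<Rightarrow> real^'p" where
  "two_point_est \<delta> \<phi> x u = (real CARD('p) / \<delta> * (\<phi> (x + \<delta> *\<^sub>R u) - \<phi> x)) *\<^sub>R u"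

text \<open>Column \<open>k\<close> of the estimated gradient matrix of the positive part of a vector-valued map.\<close>

definition pos_part_est ::
  "real \<Rightarrow> (real^'p \<Rightarrow> nat \<Rightarrow> real) \<Rightarrow> real^'p::finite \<Rightarrow> real^'p \<Rightarrow> nat \<Rightarrow> real^'p" where
  "pos_part_est \<delta> G x u k = two_point_est \<delta> (\<lambda>z. max 0 (G z k)) x u"

text \<open>
  One run of the algorithm, for one realisation of the directions \<open>u i t\<close> and the initial
  decisions \<open>x0 i\<close>; \<open>xh\<close> is the last broadcast decision and \<open>q\<close> the dual variable.
\<close>

definition algorithm_run ::
  "(real^'p::finite) set \<Rightarrow> ('n::finite \<Rightarrow> nat \<Rightarrow> real^'p \<Rightarrow> real) \<Rightarrow> ('n \<Rightarrow> nat) \<Rightarrow>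
   ('n \<Rightarrow> nat \<Rightarrow> real^'p \<Rightarrow> nat \<Rightarrow> real) \<Rightarrow> (nat \<Rightarrow> real^'n^'n) \<Rightarrow>
   (nat \<Rightarrow> real) \<Rightarrow> (nat \<Rightarrow> real) \<Rightarrow> (nat \<Rightarrow> real) \<Rightarrow> (nat \<Rightarrow> real) \<Rightarrow> (nat \<Rightarrow> real) \<Rightarrow> (nat \<Rightarrow> real) \<Rightarrow>
   ('n \<Rightarrow> real^'p) \<Rightarrow> ('n \<Rightarrow> nat \<Rightarrow> real^'p) \<Rightarrow>
   ('n \<Rightarrow> nat \<Rightarrow> real^'p) \<Rightarrow> ('n \<Rightarrow> nat \<Rightarrow> real^'p) \<Rightarrow> ('n \<Rightarrow> nat \<Rightarrow> nat \<Rightarrow> real) \<Rightarrow> bool" where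
  "algorithm_run X f m g W \<alpha> \<beta> \<gamma> \<tau> \<xi> \<delta> x0 u x xh q \<longleftrightarrow>
     (\<forall>i. x i 1 = x0 i \<and> xh i 1 = x i 1 \<and> (\<forall>k<m i. q i 1 k = 0)) \<and>
     (\<forall>i. \<forall>t\<ge>1.
        let df = two_point_est (\<delta> t) (f i t) (x i t) (u i t);
            dg = pos_part_est (\<delta> t) (g i t) (x i t) (u i t);
            z  = (\<Sum>j\<in>UNIV. W t $ i $ j *\<^sub>R xh j t);
            \<omega>  = df + (\<Sum>k<m i. q i t k *\<^sub>R dg k)
        in x i (t + 1) = closest_point ((*\<^sub>R) (1 - \<xi> (t + 1)) ` X) (z - \<alpha> (t + 1) *\<^sub>R \<omega>) \<and>
           (\<forall>k<m i. q i (t + 1) k =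
              max 0 ((1 - \<beta> (t + 1) * \<gamma> (t + 1)) * q i t k +
                     \<gamma> (t + 1) * (max 0 (g i t (x i t) k) + dg k \<bullet> (x i (t + 1) - x i t)))) \<and>
           xh i (t + 1) = (if norm (x i (t + 1) - xh i t) \<ge> \<tau> (t + 1) then x i (t + 1) else xh i t))"

end

theory Submission
  imports Defs
begin

text \<open>
  The two-point estimator has as its mean a gradient of the loss averaged over a small ball.  Only the
  resulting inequality is needed: integrating a convex function against the difference quotients of a
  radial cut-off, and letting the cut-off tend to the indicator of the ball, gives
  \<open>E[\<langle>estimate, x - y\<rangle>] \<ge> \<phi> x - \<phi> y - O(\<delta>)\<close> without the divergence theorem.

  For a single run, the projection step is combined with the drift of \<open>\<parallel>q\<parallel>\<^sup>2\<close>.  The violation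
  \<open>q \<cdot> [g]\<^sub>+\<close> produced by the drift cancels the one produced by convexity, and what
  remains bounds the regret plus an energy made of \<open>\<parallel>q\<parallel>\<^sup>2 / \<gamma>\<close>, \<open>\<Sum> \<beta> \<parallel>q\<parallel>\<^sup>2\<close> and
  \<open>\<Sum> \<parallel>x - z\<parallel>\<^sup>2 / \<alpha>\<close>.  The disagreement of the agents is a perturbed consensus process, so its sum is
  at most a constant times \<open>\<Sum> (\<parallel>x - z\<parallel> + \<tau>)\<close>, which the energy absorbs.

  The losses are bounded, so the regret is at least \<open>-O(T)\<close> and the expected energy is \<open>O(T)\<close>.  The
  dual recursion bounds the violation by \<open>q / \<gamma> + \<Sum> \<beta> q\<close> plus the movement of the agents, and
  these are controlled by the energy through the arithmetic-geometric mean inequality.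

  With \<open>\<alpha> t = sqrt (\<Psi> t / t)\<close> the sums of \<open>\<alpha>\<close> and of \<open>\<tau> / \<alpha>\<close> are both \<open>O(sqrt (T * \<Psi> T))\<close>; this
  is the term that turns into \<open>T\<^bsup>1 - \<theta>/2\<^esup>\<close>, \<open>sqrt (T * ln T)\<close> or \<open>sqrt T\<close>.
\<close>

section \<open>The two-point estimator on the sphere\<close>

text \<open>The dual variables are bounded only by a multiple of
  \<open>1 / \<beta> t = t powr \<kappa>\<close>, so the product of \<open>q\<close> with the
  movement of an agent is too large to be estimated termwise. In the step inequality it occurs
  twice, once from replacing \<open>x t\<close> by \<open>x (t + 1)\<close> in the descent direction
  and once from the linearised constraint in the dual update, and the two occurrences cancel
  exactly. What \<open>q\<close> still multiplies is bias: the smoothing error of the estimator, and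
  the shift of the comparator into the shrunken set that keeps sampled points in \<open>X\<close>.
  With \<delta> and \<xi> of order \<open>1 / t\<close> this costs
  \<open>t powr (\<kappa> - 1)\<close> per step, one of the sources of
  \<open>T powr \<kappa>\<close>. A decision depends on earlier directions of all agents, but a
  fresh direction is independent of them. The joint law is therefore a product measure, and Fubini
  takes the place of conditional expectation. The energy belongs to the run and not to a comparator,
  so a static feasible sequence, of path length 0, may be inserted to bound it. This is why the
  violation bound contains no path length.\<close>

lemma lborel_integral_translation:
  fixes F :: "'a::euclidean_space \<Rightarrow> real"
  assumes [measurable]: "F \<in> borel_measurable borel"
  shows "(LINT v|lborel. F (v + a)) = (LINT v|lborel. F v)"
proof -
  have "(LINT v|lborel. F v) = (LINT v|distr lborel borel ((+) a). F v)"
    by (simp add: lborel_distr_plus)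
  also have "\<dots> = (LINT v|lborel. F (a + v))"
    by (subst integral_distr) auto
  finally show ?thesis by (simp add: add.commute)
qed

lemma lborel_integral_dilation:
  fixes F :: "'a::euclidean_space \<Rightarrow> real"
  assumes [measurable]: "F \<in> borel_measurable borel" and "c > 0"
  shows "(LINT v|lborel. F v) = c ^ DIM('a) * (LINT v|lborel. F (c *\<^sub>R v))"
proof -
  have eq: "(lborel :: 'a measure) = density (distr lborel borel (\<lambda>x. 0 + c *\<^sub>R x)) (\<lambda>_. ennreal (c ^ DIM('a)))"
    using lborel_affine[of c "0::'a"] assms(2) by simp
  have "(LINT v|lborel. F v) = (LINT v|density (distr lborel borel (\<lambda>x. 0 + c *\<^sub>R x)) (\<lambda>_. ennreal (c ^ DIM('a))). F v)"
    using eq by simp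
  also have "\<dots> = (LINT v|distr lborel borel (\<lambda>x. 0 + c *\<^sub>R x). c ^ DIM('a) *\<^sub>R F v)"
    by (subst integral_density) (use assms(2) in auto)
  also have "\<dots> = (LINT v|lborel. c ^ DIM('a) *\<^sub>R F (0 + c *\<^sub>R v))"
    by (subst integral_distr) auto
  finally show ?thesis by simp
qed

abbreviation unit_vol :: "'a::euclidean_space itself \<Rightarrow> real" where
  "unit_vol _ \<equiv> measure lborel (cball (0::'a) 1)"

lemma unit_vol_pos: "unit_vol TYPE('a::euclidean_space) > 0"
  using content_cball_pos[of 1 "0::'a"] by simp

lemma sgn_borel [measurable]: "(sgn :: 'a::euclidean_space \<Rightarrow> 'a) \<in> borel_measurable borel"
  unfolding sgn_div_norm by measurable

lemma cball_borel [measurable]: "cball (a::'a::euclidean_space) \<rho> \<in> sets borel"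
  by simp

text \<open>The radial projection in \<open>uniform_sphere\<close> is \<open>sgn\<close>. Its
  push-forward turns sphere integrals into Lebesgue integrals over the ball of functions constant
  along rays, and all later computations on the sphere are done in this form.\<close>

lemma integral_uniform_sphere:
  fixes F :: "'a::euclidean_space \<Rightarrow> real"
  assumes [measurable]: "F \<in> borel_measurable borel"
  shows "(LINT u|uniform_sphere. F u) * unit_vol TYPE('a) =
    (LINT v|lborel. indicator (cball 0 1) v * F (sgn v))"
proof -
  let ?V = "unit_vol TYPE('a)"
  have V: "emeasure lborel (cball (0::'a) 1) = ennreal ?V"
    using emeasure_eq_ennreal_measure[of lborel "cball (0::'a) 1"] emeasure_lborel_cball_finite[of "0::'a" 1]
    by (simp add: less_top[symmetric])
  have eq: "uniform_measure lborel (cball (0::'a) 1) =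
      density lborel (\<lambda>v. ennreal (indicator (cball 0 1) v / ?V))"
    unfolding uniform_measure_def V
    by (intro density_cong) (auto simp: divide_ennreal[symmetric] unit_vol_pos ennreal_indicator split: split_indicator)
  have "(LINT u|uniform_sphere. F u) = (LINT v|uniform_measure lborel (cball (0::'a) 1). F (sgn v))"
    unfolding uniform_sphere_def sgn_div_norm[symmetric] by (subst integral_distr) auto
  also have "\<dots> = (LINT v|lborel. (indicator (cball 0 1) v / ?V) *\<^sub>R F (sgn v))"
    unfolding eq by (subst integral_density) (auto split: split_indicator)
  also have "\<dots> = (LINT v|lborel. indicator (cball 0 1) v * F (sgn v)) / ?V"
    by (subst integral_divide_zero[symmetric]) (simp add: field_simps)
  finally show ?thesis using unit_vol_pos[where 'a='a] by (simp add: field_simps)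
qed

text \<open>A positive dilation does not change \<open>sgn\<close>, so the radius enters only
  through the volume factor. Subtracting two radii gives the integral over a thin shell.\<close>

lemma integral_cball_sgn:
  fixes F :: "'a::euclidean_space \<Rightarrow> real"
  assumes [measurable]: "F \<in> borel_measurable borel" and c: "c > 0"
  shows "(LINT v|lborel. indicator (cball 0 c) v * F (sgn v)) =
    c ^ DIM('a) * (LINT v|lborel. indicator (cball 0 1) v * F (sgn v))"
proof -
  have "(LINT v|lborel. indicator (cball 0 c) v * F (sgn v)) =
     c ^ DIM('a) * (LINT v|lborel. indicator (cball 0 c) (c *\<^sub>R v) * F (sgn (c *\<^sub>R v)))"
    by (rule lborel_integral_dilation) (use c in auto)
  also have "(\<lambda>v::'a. indicator (cball 0 c) (c *\<^sub>R v) * F (sgn (c *\<^sub>R v))) = (\<lambda>v. indicator (cball 0 1) v * F (sgn v))"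
    using c by (auto simp: fun_eq_iff sgn_scaleR indicator_def abs_mult)
  finally show ?thesis .
qed

lemma sgn_in_cball: "sgn (v::'a::real_normed_vector) \<in> cball 0 1"
  by (simp add: norm_sgn)

lemma integrable_bounded_support:
  fixes F :: "'a::euclidean_space \<Rightarrow> real"
  assumes "F \<in> borel_measurable borel" "\<And>v. \<bar>F v\<bar> \<le> B" "\<And>v. v \<notin> cball 0 \<rho> \<Longrightarrow> F v = 0"
  shows "integrable lborel F"
proof (rule Bochner_Integration.integrable_bound)
  have "emeasure lborel (cball (0::'a) \<rho>) < \<infinity>"
    using emeasure_lborel_cball_finite[of "0::'a" \<rho>] by simp
  then show "integrable lborel (\<lambda>v::'a. indicator (cball 0 \<rho>) v *\<^sub>R B)"
    by (intro integrable_scaleR_left integrable_real_indicator) auto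
  show "AE v in lborel. norm (F v) \<le> norm (indicator (cball 0 \<rho>) v *\<^sub>R B)"
  proof (rule AE_I2)
    fix v show "norm (F v) \<le> norm (indicator (cball 0 \<rho>) v *\<^sub>R B)"
      using assms(2)[of v] assms(3)[of v] by (cases "v \<in> cball 0 \<rho>") auto
  qed
qed (use assms(1) in auto)

text \<open>A Lipschitz substitute for the indicator of the unit ball, falling linearly to 0 across
  a shell of thickness \<epsilon>. Inside the shell its gradient is
  \<open>- (sgn v /\<^sub>R \<epsilon>)\<close>, which imitates the normal of the sphere.\<close>

definition ramp :: "real \<Rightarrow> 'a::euclidean_space \<Rightarrow> real" where
  "ramp \<epsilon> v = max 0 (min 1 ((1 - norm v) / \<epsilon>))"

lemma ramp_borel [measurable]: "ramp \<epsilon> \<in> borel_measurable borel"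
  unfolding ramp_def by measurable

lemma ramp_bounds: "0 \<le> ramp \<epsilon> v" "ramp \<epsilon> v \<le> 1"
  by (auto simp: ramp_def)

lemma ramp_outside: "\<epsilon> > 0 \<Longrightarrow> norm v \<ge> 1 \<Longrightarrow> ramp \<epsilon> v = 0"
  by (auto simp: ramp_def divide_le_0_iff)

lemma ramp_inside: "\<epsilon> > 0 \<Longrightarrow> norm v \<le> 1 - \<epsilon> \<Longrightarrow> ramp \<epsilon> v = 1"
  by (auto simp: ramp_def)

lemma ramp_lipschitz:
  assumes "\<epsilon> > 0" shows "\<bar>ramp \<epsilon> v - ramp \<epsilon> w\<bar> \<le> norm (v - w) / \<epsilon>"
proof -
  have "\<bar>ramp \<epsilon> v - ramp \<epsilon> w\<bar> \<le> \<bar>(1 - norm v) / \<epsilon> - (1 - norm w) / \<epsilon>\<bar>"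
    unfolding ramp_def by (auto simp: max_def min_def abs_if)
  also have "\<dots> = \<bar>norm w - norm v\<bar> / \<epsilon>"
    using assms by (simp add: diff_divide_distrib[symmetric])
  also have "\<dots> \<le> norm (v - w) / \<epsilon>"
    using assms norm_triangle_ineq3[of w v] by (intro divide_right_mono) (auto simp: norm_minus_commute)
  finally show ?thesis .
qed

text \<open>The derivative of the norm away from the origin is \<open>sgn\<close>, and
  \<open>\<epsilon> < 1\<close> keeps the shell away from the origin. The two spheres on which the
  cut-off has a kink are excluded; they are null sets when the limit is integrated.\<close>

lemma ramp_difference_quotient:
  fixes k :: "'a::euclidean_space"
  assumes e: "0 < \<epsilon>" "\<epsilon> < 1" and v: "norm v \<noteq> 1" "norm v \<noteq> 1 - \<epsilon>"
    and s: "s \<longlonglongrightarrow> 0" "\<And>n. s n \<noteq> 0"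
  shows "(\<lambda>n. (ramp \<epsilon> (v - s n *\<^sub>R k) - ramp \<epsilon> v) / s n) \<longlonglongrightarrow>
     (if 1 - \<epsilon> < norm v \<and> norm v \<le> 1 then (sgn v \<bullet> k) / \<epsilon> else 0)" (is "?Q \<longlonglongrightarrow> _")
proof -
  have lim: "(\<lambda>n. norm (v - s n *\<^sub>R k)) \<longlonglongrightarrow> norm (v - 0 *\<^sub>R k)"
    by (intro tendsto_intros s)
  then have lim: "(\<lambda>n. norm (v - s n *\<^sub>R k)) \<longlonglongrightarrow> norm v" by simp
  consider "norm v < 1 - \<epsilon>" | "norm v > 1" | "1 - \<epsilon> < norm v" "norm v < 1"
    using v by linarith
  then show ?thesis
  proof cases
    case 1
    have "\<forall>\<^sub>F n in sequentially. ?Q n = 0"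
      using order_tendstoD(2)[OF lim 1] by eventually_elim (use 1 e in \<open>simp add: ramp_inside\<close>)
    then show ?thesis using 1 by (simp add: tendsto_eventually)
  next
    case 2
    have "\<forall>\<^sub>F n in sequentially. ?Q n = 0"
      using order_tendstoD(1)[OF lim 2] by eventually_elim (use 2 e in \<open>simp add: ramp_outside\<close>)
    then show ?thesis using 2 by (simp add: tendsto_eventually)
  next
    case 3
    then have "v \<noteq> 0" using e by auto
    have *: "ramp \<epsilon> w = (1 - norm w) / \<epsilon>" if "1 - \<epsilon> < norm w" "norm w < 1" for w :: 'a
      using that e by (auto simp: ramp_def max_def min_def field_simps)
    have "\<forall>\<^sub>F n in sequentially. ?Q n = - (norm (v - s n *\<^sub>R k) - norm v) / s n / \<epsilon>"
      using order_tendstoD(2)[OF lim 3(2)] order_tendstoD(1)[OF lim 3(1)]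
    proof eventually_elim
      case (elim n)
      have "(1 - a) / \<epsilon> - (1 - b) / \<epsilon> = - (a - b) / \<epsilon>" for a b
        by (simp add: diff_divide_distrib)
      then show ?case
        unfolding *[OF elim(2,1)] *[OF 3] by (simp add: mult.commute)
    qed
    moreover have "(\<lambda>n. - (norm (v - s n *\<^sub>R k) - norm v) / s n / \<epsilon>) \<longlonglongrightarrow> (sgn v \<bullet> k) / \<epsilon>"
    proof -
      have "((\<lambda>x. norm (v - x *\<^sub>R k)) has_derivative (\<lambda>x. sgn (v - 0 *\<^sub>R k) \<bullet> (0 - x *\<^sub>R k))) (at 0)"
        by (rule has_derivative_compose[where g=norm and f="\<lambda>x. v - x *\<^sub>R k", OF _ has_derivative_norm[THEN has_derivative_eq_rhs], THEN has_derivative_eq_rhs])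
           (auto intro!: derivative_eq_intros simp: \<open>v \<noteq> 0\<close> inner_commute)
      then have "((\<lambda>x. norm (v - x *\<^sub>R k)) has_real_derivative - (sgn v \<bullet> k)) (at 0)"
        unfolding has_field_derivative_def by (rule has_derivative_eq_rhs) (auto simp: fun_eq_iff)
      then have "((\<lambda>x. (norm (v - x *\<^sub>R k) - norm v) / x) \<longlongrightarrow> - (sgn v \<bullet> k)) (at 0)"
        by (simp add: DERIV_def)
      moreover have "filterlim s (at 0) sequentially"
        using s by (simp add: filterlim_at)
      ultimately have "(\<lambda>n. (norm (v - s n *\<^sub>R k) - norm v) / s n) \<longlonglongrightarrow> - (sgn v \<bullet> k)"
        by (rule filterlim_compose)
      then have "(\<lambda>n. - ((norm (v - s n *\<^sub>R k) - norm v) / s n) / \<epsilon>) \<longlonglongrightarrow> - (- (sgn v \<bullet> k)) / \<epsilon>"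
        by (intro tendsto_intros) (use e in auto)
      then show ?thesis by (simp add: minus_divide_left)
    qed
    ultimately show ?thesis using 3 by (simp add: tendsto_cong)
  qed
qed

text \<open>The derivative of \<open>- ((1 - \<epsilon>) ^ n)\<close> at 0. With \<open>n\<close>
  the dimension it is the limit of relative shell volume over shell thickness, which produces the
  factor that the estimator carries as \<open>CARD('p)\<close>.\<close>

lemma one_minus_power_quotient:
  "((\<lambda>\<epsilon>. (1 - (1 - \<epsilon>) ^ n) / \<epsilon>) \<longlongrightarrow> real n) (at_right (0::real))"
proof -
  have "((\<lambda>\<epsilon>. - ((1 - \<epsilon>) ^ n)) has_real_derivative real n) (at 0)"
    by (auto intro!: derivative_eq_intros)
  then have "((\<lambda>\<epsilon>. (- ((1 - \<epsilon>) ^ n) - - ((1 - 0) ^ n)) / (\<epsilon> - 0)) \<longlongrightarrow> real n) (at 0)"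
    unfolding has_field_derivative_iff .
  then show ?thesis
    by (simp add: filterlim_at_split)
qed

text \<open>A discrete integration by parts: translation invariance moves the difference from \<open>\<eta>\<close> to \<open>\<psi>\<close>.\<close>

lemma lborel_integral_difference_quotient_le:
  fixes \<psi> \<eta> :: "'a::euclidean_space \<Rightarrow> real"
  assumes [measurable]: "\<psi> \<in> borel_measurable borel" "\<eta> \<in> borel_measurable borel"
    and bnd: "\<And>v. \<bar>\<psi> v\<bar> \<le> B" "\<And>v. \<bar>\<eta> v\<bar> \<le> 1" and supp: "\<And>v. v \<notin> cball 0 1 \<Longrightarrow> \<eta> v = 0"
    and s: "s > 0" and le: "\<And>v. (\<psi> (v + s *\<^sub>R k) - \<psi> v) * \<eta> v \<le> s * A * \<eta> v"
  shows "(LINT v|lborel. \<psi> v * ((\<eta> (v - s *\<^sub>R k) - \<eta> v) / s)) \<le> A * (LINT v|lborel. \<eta> v)"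
proof -
  have B: "B \<ge> 0" using order_trans[OF abs_ge_zero bnd(1)] .
  have p: "\<bar>a * b\<bar> \<le> B" if "\<bar>a\<bar> \<le> B" "\<bar>b\<bar> \<le> 1" for a b :: real
    using mult_mono[OF that] B by (simp add: abs_mult)
  have int: "integrable lborel (\<lambda>v. \<psi> v * \<eta> v)" "integrable lborel (\<lambda>v. \<psi> (v + s *\<^sub>R k) * \<eta> v)"
    by (rule integrable_bounded_support[where \<rho>=1 and B=B]; use bnd supp p in auto)+
  have int3: "integrable lborel \<eta>"
    by (rule integrable_bounded_support[where \<rho>=1 and B=1]; use bnd supp in auto)
  have int2: "integrable lborel (\<lambda>v. \<psi> v * \<eta> (v - s *\<^sub>R k))"
  proof (rule integrable_bounded_support[where B=B])
    fix v :: 'a assume "v \<notin> cball 0 (1 + norm (s *\<^sub>R k))"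
    then have "v - s *\<^sub>R k \<notin> cball 0 1"
      using norm_triangle_ineq4[of "v - s *\<^sub>R k" "- s *\<^sub>R k"] by auto
    then show "\<psi> v * \<eta> (v - s *\<^sub>R k) = 0" using supp by simp
  qed (use bnd p in auto)
  have "s * (LINT v|lborel. \<psi> v * ((\<eta> (v - s *\<^sub>R k) - \<eta> v) / s)) =
      (LINT v|lborel. \<psi> v * \<eta> (v - s *\<^sub>R k) - \<psi> v * \<eta> v)"
  proof -
    have "s * (\<psi> v * ((\<eta> (v - s *\<^sub>R k) - \<eta> v) / s)) = \<psi> v * \<eta> (v - s *\<^sub>R k) - \<psi> v * \<eta> v" for v
      using s by (simp add: field_simps)
    then show ?thesis unfolding integral_mult_right_zero[symmetric] by simp
  qed
  also have "\<dots> = (LINT v|lborel. \<psi> v * \<eta> (v - s *\<^sub>R k)) - (LINT v|lborel. \<psi> v * \<eta> v)"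
    using int int2 by simp
  also have "(LINT v|lborel. \<psi> v * \<eta> (v - s *\<^sub>R k)) = (LINT v|lborel. \<psi> (v + s *\<^sub>R k) * \<eta> v)"
    using lborel_integral_translation[of "\<lambda>v. \<psi> v * \<eta> (v - s *\<^sub>R k)" "s *\<^sub>R k"] by simp
  also have "\<dots> - (LINT v|lborel. \<psi> v * \<eta> v) = (LINT v|lborel. (\<psi> (v + s *\<^sub>R k) - \<psi> v) * \<eta> v)"
    using int by (simp add: left_diff_distrib)
  also have "\<dots> \<le> (LINT v|lborel. s * A * \<eta> v)"
    using int int3 le by (intro integral_mono) (auto simp: left_diff_distrib)
  also have "\<dots> = s * (A * (LINT v|lborel. \<eta> v))" by simp
  finally show ?thesis using s by (rule mult_left_le_imp_le)
qed

text \<open>The step of the discrete integration by parts tends to 0 while \<epsilon> stays fixed.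
  Only the cut-off is differentiated; \<open>\<psi>\<close> enters through its increments, and the
  Lipschitz bound of the cut-off supplies the dominating function.\<close>

lemma lborel_shell_integral_le:
  fixes \<psi> :: "'a::euclidean_space \<Rightarrow> real"
  assumes \<psi>[measurable]: "\<psi> \<in> borel_measurable borel"
    and bnd: "\<And>v. \<bar>\<psi> v\<bar> \<le> B"
    and e: "0 < \<epsilon>" "\<epsilon> < 1"
    and le: "\<And>v s. norm v \<le> 1 \<Longrightarrow> 0 < s \<Longrightarrow> s \<le> 1 \<Longrightarrow> \<psi> (v + s *\<^sub>R k) - \<psi> v \<le> s * A"
  shows "(LINT v|lborel. indicator (cball 0 1 - cball 0 (1 - \<epsilon>)) v * (\<psi> v * (sgn v \<bullet> k))) \<le>
     \<epsilon> * (A * (LINT v|lborel. ramp \<epsilon> (v::'a)))"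
proof -
  have B: "B \<ge> 0" using order_trans[OF abs_ge_zero bnd] .
  define s where "s n = 1 / real (Suc n)" for n
  have s: "s n > 0" "s n \<le> 1" for n by (auto simp: s_def)
  have s0: "s \<longlonglongrightarrow> 0" unfolding s_def by (rule LIMSEQ_inverse_real_of_nat[unfolded inverse_eq_divide])
  define h where "h v = indicator (cball 0 1 - cball 0 (1 - \<epsilon>)) v * ((sgn v \<bullet> k) / \<epsilon>)" for v :: 'a
  have [measurable]: "h \<in> borel_measurable borel" unfolding h_def by measurable
  let ?Q = "\<lambda>n v. \<psi> v * ((ramp \<epsilon> (v - s n *\<^sub>R k) - ramp \<epsilon> v) / s n)"
  \<comment> \<open>Since \<open>s n \<le> 1\<close>, all difference quotients vanish outside the
    ball of radius \<open>1 + norm k\<close>.\<close>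
  let ?w = "\<lambda>v::'a. indicator (cball 0 (1 + norm k)) v * (B * (norm k / \<epsilon>)) :: real"
  have "(\<lambda>n. LINT v|lborel. ?Q n v) \<longlonglongrightarrow> (LINT v|lborel. \<psi> v * h v)"
  proof (rule integral_dominated_convergence[where w="?w"])
    show "integrable lborel ?w"
      by (rule integrable_bounded_support[where B="\<bar>B * (norm k / \<epsilon>)\<bar>" and \<rho>="1 + norm k"]) (auto simp: indicator_def)
    have "AE v::'a in lborel. norm v \<noteq> 1 \<and> norm v \<noteq> 1 - \<epsilon>"
    proof -
      have "sphere (0::'a) c \<in> null_sets lborel" for c
        using negligible_sphere[of "0::'a" c] by (simp add: negligible_iff_null_sets null_sets_completion_iff)
      then have "AE v::'a in lborel. norm v \<noteq> c" for c
        by (intro AE_I'[where N="sphere (0::'a) c"]) auto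
      from this[of 1] this[of "1 - \<epsilon>"] show ?thesis by simp
    qed
    then show "AE v in lborel. (\<lambda>n. ?Q n v) \<longlonglongrightarrow> \<psi> v * h v"
    proof eventually_elim
      case (elim v)
      have "h v = (if 1 - \<epsilon> < norm v \<and> norm v \<le> 1 then (sgn v \<bullet> k) / \<epsilon> else 0)"
        by (auto simp: h_def indicator_def)
      then show ?case
        using ramp_difference_quotient[OF e _ _ s0, of v k] elim s(1)[THEN less_imp_neq, symmetric]
        by (intro tendsto_mult tendsto_const) simp
    qed
    show "AE v in lborel. norm (?Q n v) \<le> ?w v" for n
    proof (rule AE_I2)
      fix v
      have q: "\<bar>(ramp \<epsilon> (v - s n *\<^sub>R k) - ramp \<epsilon> v) / s n\<bar> \<le> norm k / \<epsilon>"
        using ramp_lipschitz[OF e(1), of "v - s n *\<^sub>R k" v] s(1)[of n]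
        by (simp add: pos_divide_le_eq) (simp add: mult.commute)
      show "norm (?Q n v) \<le> ?w v"
      proof (cases "v \<in> cball 0 (1 + norm k)")
        case True
        then show ?thesis using mult_mono[OF bnd q] B by (simp add: abs_mult)
      next
        case False
        have "norm v \<le> norm (v - s n *\<^sub>R k) + s n * norm k"
          using norm_triangle_ineq[of "v - s n *\<^sub>R k" "s n *\<^sub>R k"] s(1)[of n] by simp
        also have "\<dots> \<le> norm (v - s n *\<^sub>R k) + norm k"
          using mult_right_mono[OF s(2)[of n], of "norm k"] by simp
        finally have "norm (v - s n *\<^sub>R k) \<ge> 1" "norm v \<ge> 1"
          using False norm_ge_zero[of k] by (auto simp del: norm_ge_zero)
        then show ?thesis using e(1) False by (simp add: ramp_outside)
      qed
    qed
  qed measurable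
  moreover have "(LINT v|lborel. ?Q n v) \<le> A * (LINT v|lborel. ramp \<epsilon> (v::'a))" for n
  proof (rule lborel_integral_difference_quotient_le[where B=B and \<eta>="ramp \<epsilon>" and \<psi>=\<psi>])
    show "\<bar>ramp \<epsilon> v\<bar> \<le> 1" for v :: 'a using ramp_bounds[of \<epsilon> v] by simp
    show "v \<notin> cball 0 1 \<Longrightarrow> ramp \<epsilon> v = 0" for v :: 'a using e by (simp add: ramp_outside)
    show "(\<psi> (v + s n *\<^sub>R k) - \<psi> v) * ramp \<epsilon> v \<le> s n * A * ramp \<epsilon> v" for v
    proof (cases "norm v \<le> 1")
      case True
      then show ?thesis using le s ramp_bounds by (intro mult_right_mono) auto
    next
      case False then show ?thesis using e by (simp add: ramp_outside)
    qed
  qed (use bnd s in simp_all)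
  ultimately have "(LINT v|lborel. \<psi> v * h v) \<le> A * (LINT v|lborel. ramp \<epsilon> (v::'a))"
    by (intro LIMSEQ_le_const2) auto
  moreover have "(LINT v|lborel. \<psi> v * h v) = (LINT v|lborel. indicator (cball 0 1 - cball 0 (1 - \<epsilon>)) v * (\<psi> v * (sgn v \<bullet> k))) / \<epsilon>"
    unfolding integral_divide_zero[symmetric] h_def by (simp only: times_divide_eq_right mult.left_commute)
  ultimately show ?thesis using e(1) by (simp add: pos_divide_le_eq mult.commute)
qed
text \<open>In coordinates centred at \<open>x\<close> and scaled by \<delta>, passing from
  \<open>x\<close> to \<open>y\<close> is translation by \<open>k\<close>. Convexity along the
  segment from \<open>x + \<delta> *\<^sub>R v\<close> to \<open>y + \<delta> *\<^sub>R v\<close>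
  bounds the increments of \<open>\<psi>\<close> by \<open>s * A\<close>, and the shell integral
  tends to the sphere integral as the shell gets thin. Divided by
  \<open>\<delta>\<^sup>2\<close>-free scaling of the estimator, that is by one factor \<delta>,
  this is the lower bound for its mean with smoothing error \<open>2 * L * \<delta>\<close>.\<close>

proposition sphere_two_point_le:
  fixes \<phi> :: "'a::euclidean_space \<Rightarrow> real"
  assumes [measurable]: "\<phi> \<in> borel_measurable borel"
    and X: "convex X" "closed X" and conv: "convex_on X \<phi>"
    and lip: "\<And>a b. a \<in> X \<Longrightarrow> b \<in> X \<Longrightarrow> \<bar>\<phi> a - \<phi> b\<bar> \<le> L * norm (a - b)"
    and \<delta>: "\<delta> > 0" and x: "cball x \<delta> \<subseteq> X" and y: "cball y \<delta> \<subseteq> X"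
  shows "real DIM('a) * (LINT u|uniform_sphere. (\<phi> (x + \<delta> *\<^sub>R u) - \<phi> x) * (u \<bullet> (y - x)))
    \<le> \<delta> * (\<phi> y - \<phi> x + 2 * L * \<delta>)"
proof -
  define k where "k = (y - x) /\<^sub>R \<delta>"
  define \<rho> where "\<rho> = 1 + norm k"
  \<comment> \<open>Moving the centres \<open>x\<close> and \<open>y\<close> by a vector of length
    at most \<delta> changes each value by at most \<open>L * \<delta>\<close>; hence the summand
    \<open>2 * L * \<delta>\<close>.\<close>
  define A where "A = \<phi> y - \<phi> x + 2 * L * \<delta>"
  \<comment> \<open>The radius \<open>\<rho>\<close> makes \<open>\<psi>\<close> bounded and still
    leaves room for \<open>v + s *\<^sub>R k\<close> with \<open>norm v \<le> 1\<close> and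
    \<open>s \<le> 1\<close>.\<close>
  define D where "D = {v. x + \<delta> *\<^sub>R v \<in> X \<and> norm v \<le> \<rho>}"
  define \<psi> where "\<psi> v = indicator D v * (\<phi> (x + \<delta> *\<^sub>R v) - \<phi> x)" for v
  have y_eq: "y = x + \<delta> *\<^sub>R k" using \<delta> by (simp add: k_def)
  have xX: "x \<in> X" and yX: "y \<in> X" using x y \<delta> by auto
  have nearx: "x + \<delta> *\<^sub>R v \<in> X" and neary: "y + \<delta> *\<^sub>R v \<in> X" if "norm v \<le> 1" for v
    using x y that \<delta> mult_left_mono[OF that, of \<delta>] by (auto simp: subset_iff dist_norm)
  have L: "L \<ge> 0"
  proof -
    obtain b :: 'a where b: "norm b = 1" using vector_choose_size[of 1] by auto
    have "0 \<le> L * norm (x + \<delta> *\<^sub>R b - x)"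
      by (rule order_trans[OF abs_ge_zero lip]) (use nearx[of b] b xX in auto)
    then show ?thesis using b \<delta> by (simp add: zero_le_mult_iff)
  qed
  have "closed D"
  proof -
    have "D = (\<lambda>v. x + \<delta> *\<^sub>R v) -` X \<inter> cball 0 \<rho>" by (auto simp: D_def)
    moreover have "closed ((\<lambda>v. x + \<delta> *\<^sub>R v) -` X)"
      by (intro continuous_closed_vimage X) (auto intro!: continuous_intros)
    ultimately show ?thesis by auto
  qed
  then have [measurable]: "D \<in> sets borel" by simp
  have [measurable]: "\<psi> \<in> borel_measurable borel" unfolding \<psi>_def by measurable
  have unit: "norm v \<le> 1 \<Longrightarrow> v \<in> D" for v
    using nearx[of v] by (simp add: D_def \<rho>_def add_increasing2)
  have \<psi>_bnd: "\<bar>\<psi> v\<bar> \<le> L * (\<delta> * \<rho>)" for v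
  proof (cases "v \<in> D")
    case True
    then have "\<bar>\<psi> v\<bar> \<le> L * norm (x + \<delta> *\<^sub>R v - x)"
      using lip[of "x + \<delta> *\<^sub>R v" x] xX by (simp add: \<psi>_def D_def)
    also have "\<dots> \<le> L * (\<delta> * \<rho>)"
      using True L \<delta> by (auto simp: D_def intro!: mult_left_mono)
    finally show ?thesis .
  next
    case False then show ?thesis using L \<delta> by (simp add: \<psi>_def \<rho>_def)
  qed
  have quot: "\<psi> (v + s *\<^sub>R k) - \<psi> v \<le> s * A" if v: "norm v \<le> 1" and s: "0 < s" "s \<le> 1" for v s
  proof -
    have eq: "x + \<delta> *\<^sub>R (v + s *\<^sub>R k) = (1 - s) *\<^sub>R (x + \<delta> *\<^sub>R v) + s *\<^sub>R (y + \<delta> *\<^sub>R v)"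
      by (simp add: y_eq algebra_simps)
    have inX: "x + \<delta> *\<^sub>R (v + s *\<^sub>R k) \<in> X"
      unfolding eq using nearx[OF v] neary[OF v] s X(1) by (intro convexD) auto
    moreover have "norm (v + s *\<^sub>R k) \<le> \<rho>"
    proof -
      have "norm (v + s *\<^sub>R k) \<le> norm v + s * norm k" using norm_triangle_ineq[of v "s *\<^sub>R k"] s by simp
      also have "\<dots> \<le> 1 + 1 * norm k" using v s by (intro add_mono mult_right_mono) auto
      finally show ?thesis by (simp add: \<rho>_def)
    qed
    ultimately have "v + s *\<^sub>R k \<in> D" by (simp add: D_def)
    then have "\<psi> (v + s *\<^sub>R k) - \<psi> v = \<phi> (x + \<delta> *\<^sub>R (v + s *\<^sub>R k)) - \<phi> (x + \<delta> *\<^sub>R v)"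
      using unit[OF v] by (simp add: \<psi>_def)
    also have "\<phi> (x + \<delta> *\<^sub>R (v + s *\<^sub>R k)) \<le> (1 - s) * \<phi> (x + \<delta> *\<^sub>R v) + s * \<phi> (y + \<delta> *\<^sub>R v)"
      unfolding eq by (rule convex_onD[OF conv]) (use nearx[OF v] neary[OF v] s in auto)
    finally have "\<psi> (v + s *\<^sub>R k) - \<psi> v \<le> s * (\<phi> (y + \<delta> *\<^sub>R v) - \<phi> (x + \<delta> *\<^sub>R v))"
      by (simp add: algebra_simps)
    also have "\<phi> (y + \<delta> *\<^sub>R v) - \<phi> (x + \<delta> *\<^sub>R v) \<le> A"
    proof -
      have "L * (\<delta> * norm v) \<le> L * (\<delta> * 1)" using v L \<delta> by (intro mult_left_mono) auto
      then show ?thesis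
        using lip[OF neary[OF v] yX] lip[OF nearx[OF v] xX] \<delta> by (simp add: A_def abs_le_iff mult.assoc)
    qed
    finally show ?thesis using s by (simp add: mult_left_mono)
  qed
  define F where "F u = \<psi> u * (u \<bullet> k)" for u
  have [measurable]: "F \<in> borel_measurable borel" unfolding F_def by measurable
  define I where "I = (LINT u|uniform_sphere. F u)"
  define V where "V = unit_vol TYPE('a)"
  have V: "V > 0" unfolding V_def by (rule unit_vol_pos)
  \<comment> \<open>The fraction of the volume of the unit ball that lies between the radii
    \<open>1 - \<epsilon>\<close> and 1.\<close>
  define a where "a \<epsilon> = 1 - (1 - \<epsilon>) ^ DIM('a)" for \<epsilon> :: real
  have shell: "(LINT v|lborel. indicator (cball 0 1 - cball 0 (1 - \<epsilon>)) v * H (sgn v)) = a \<epsilon> * (LINT v|lborel. indicator (cball 0 1) v * H (sgn v))"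
    if e: "0 < \<epsilon>" "\<epsilon> < 1" and [measurable]: "H \<in> borel_measurable borel" and H: "\<And>v. norm v \<le> 1 \<Longrightarrow> \<bar>H v\<bar> \<le> B" for \<epsilon> and H :: "'a \<Rightarrow> real" and B
  proof -
    have int: "integrable lborel (\<lambda>v. indicator (cball 0 c) v * H (sgn v))" for c
      by (rule integrable_bounded_support[where B=B and \<rho>=c])
         (use H[OF sgn_in_cball[unfolded mem_cball dist_0_norm]] order_trans[OF abs_ge_zero] in \<open>auto simp: indicator_def\<close>)
    have "(LINT v|lborel. indicator (cball 0 1 - cball 0 (1 - \<epsilon>)) v * H (sgn v)) =
       (LINT v|lborel. indicator (cball 0 1) v * H (sgn v) - indicator (cball 0 (1 - \<epsilon>)) v * H (sgn v))"
      using e by (intro Bochner_Integration.integral_cong) (auto simp: indicator_def)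
    also have "\<dots> = (LINT v|lborel. indicator (cball 0 1) v * H (sgn v)) - (LINT v|lborel. indicator (cball 0 (1 - \<epsilon>)) v * H (sgn v))"
      by (intro Bochner_Integration.integral_diff int)
    also have "(LINT v|lborel. indicator (cball 0 (1 - \<epsilon>)) v * H (sgn v)) =
        (1 - \<epsilon>) ^ DIM('a) * (LINT v|lborel. indicator (cball 0 1) v * H (sgn v))"
      by (rule integral_cball_sgn) (use e in auto)
    finally show ?thesis by (simp add: a_def algebra_simps)
  qed
  have F_bnd: "\<bar>F v\<bar> \<le> L * (\<delta> * \<rho>) * norm k" if "norm v \<le> 1" for v
  proof -
    have "\<bar>v \<bullet> k\<bar> \<le> norm k"
      using Cauchy_Schwarz_ineq2[of v k] mult_right_mono[OF that norm_ge_zero[of k]] by simp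
    then show ?thesis
      unfolding F_def abs_mult using \<psi>_bnd[of v] by (intro mult_mono) auto
  qed
  \<comment> \<open>The left-hand side is the shell integral of \<open>F (sgn v)\<close> divided by
    \<open>\<epsilon> * V\<close>. All errors on the right carry the factor
    \<open>a \<epsilon>\<close>, which tends to 0, while \<open>a \<epsilon> / \<epsilon>\<close>
    tends to the dimension.\<close>
  have key: "a \<epsilon> / \<epsilon> * I \<le> A + (\<bar>A\<bar> + L * \<delta> * norm k) * a \<epsilon>" if e: "0 < \<epsilon>" "\<epsilon> < 1" for \<epsilon>
  proof -
    let ?S = "cball 0 1 - cball 0 (1 - \<epsilon>) :: 'a set"
    let ?R = "LINT v|lborel. ramp \<epsilon> (v::'a)"
    have volS: "(LINT v|lborel. indicator ?S v) = a \<epsilon> * V"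
      using shell[OF e, of "\<lambda>_. 1" 1] by (simp add: V_def)
    have intS: "integrable lborel (\<lambda>v. indicator ?S v * G v)"
      if "\<And>v. norm v \<le> 1 \<Longrightarrow> \<bar>G v\<bar> \<le> B" and [measurable]: "G \<in> borel_measurable borel" for G :: "'a \<Rightarrow> real" and B
      by (rule integrable_bounded_support[where B=B and \<rho>=1])
         (use that(1) order_trans[OF abs_ge_zero that(1)[of 0]] in \<open>auto simp: indicator_def\<close>)
    have sgnk: "\<bar>sgn v \<bullet> k\<bar> \<le> norm k" for v
      using Cauchy_Schwarz_ineq2[of "sgn v" k] mult_right_mono[OF sgn_in_cball[of v, unfolded mem_cball dist_0_norm] norm_ge_zero[of k]] by simp
    have Gb: "\<bar>\<psi> v * (sgn v \<bullet> k)\<bar> \<le> L * (\<delta> * \<rho>) * norm k" for v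
      unfolding abs_mult using \<psi>_bnd[of v] sgnk[of v] by (intro mult_mono) auto
    have "a \<epsilon> * (I * V) = (LINT v|lborel. indicator ?S v * F (sgn v))"
      unfolding I_def V_def integral_uniform_sphere[OF \<open>F \<in> borel_measurable borel\<close>]
      by (rule shell[OF e _ F_bnd, symmetric]) auto
    \<comment> \<open>Pulling \<open>sgn v\<close> back to \<open>v\<close> inside the shell changes
      \<open>\<psi>\<close> by at most \<open>L * \<delta> * \<epsilon>\<close>; the factor
      \<open>sgn v \<bullet> k\<close> is constant along rays and stays as it is.\<close>
    also have "\<dots> \<le> (LINT v|lborel. indicator ?S v * (\<psi> v * (sgn v \<bullet> k)) + indicator ?S v * (L * \<delta> * \<epsilon> * norm k))"
    proof (rule integral_mono)
      show "integrable lborel (\<lambda>v. indicator ?S v * F (sgn v))"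
        by (rule intS[where B="L * (\<delta> * \<rho>) * norm k"]) (use F_bnd sgn_in_cball in auto)
      show "integrable lborel (\<lambda>v. indicator ?S v * (\<psi> v * (sgn v \<bullet> k)) + indicator ?S v * (L * \<delta> * \<epsilon> * norm k))"
        by (intro Bochner_Integration.integrable_add intS[OF Gb] intS[OF order_refl]) auto
      fix v
      show "indicator ?S v * F (sgn v) \<le> indicator ?S v * (\<psi> v * (sgn v \<bullet> k)) + indicator ?S v * (L * \<delta> * \<epsilon> * norm k)"
      proof (cases "v \<in> ?S")
        case True
        then have nv: "norm v \<le> 1" "1 - \<epsilon> < norm v" and "v \<noteq> 0" using e by auto
        have "sgn v - v = (1 - norm v) *\<^sub>R sgn v"
          using \<open>v \<noteq> 0\<close> by (simp add: sgn_div_norm algebra_simps)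
        then have "norm (sgn v - v) = 1 - norm v" using nv \<open>v \<noteq> 0\<close> by (simp add: norm_sgn)
        then have near: "norm (sgn v - v) \<le> \<epsilon>" using nv by simp
        have s1: "norm (sgn v) \<le> 1" by (simp add: norm_sgn)
        have "\<psi> (sgn v) - \<psi> v = \<phi> (x + \<delta> *\<^sub>R sgn v) - \<phi> (x + \<delta> *\<^sub>R v)"
          using unit[OF nv(1)] unit[OF s1] by (simp add: \<psi>_def)
        moreover have "\<bar>\<dots>\<bar> \<le> L * norm (x + \<delta> *\<^sub>R sgn v - (x + \<delta> *\<^sub>R v))"
          by (rule lip[OF nearx[OF s1] nearx[OF nv(1)]])
        moreover have "x + \<delta> *\<^sub>R sgn v - (x + \<delta> *\<^sub>R v) = \<delta> *\<^sub>R (sgn v - v)" by (simp add: algebra_simps)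
        moreover have "L * (\<delta> * norm (sgn v - v)) \<le> L * (\<delta> * \<epsilon>)"
          using near L \<delta> by (intro mult_left_mono) auto
        ultimately have d: "\<bar>\<psi> (sgn v) - \<psi> v\<bar> \<le> L * \<delta> * \<epsilon>" using \<delta> by simp
        have "(\<psi> (sgn v) - \<psi> v) * (sgn v \<bullet> k) \<le> \<bar>(\<psi> (sgn v) - \<psi> v) * (sgn v \<bullet> k)\<bar>" by simp
        also have "\<dots> \<le> L * \<delta> * \<epsilon> * norm k"
          unfolding abs_mult using d sgnk[of v] by (intro mult_mono) auto
        finally show ?thesis using True by (simp add: F_def algebra_simps)
      qed auto
    qed
    also have "\<dots> = (LINT v|lborel. indicator ?S v * (\<psi> v * (sgn v \<bullet> k))) + (LINT v|lborel. indicator ?S v * (L * \<delta> * \<epsilon> * norm k))"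
      by (intro Bochner_Integration.integral_add intS[OF Gb] intS[OF order_refl]) auto
    also have "(LINT v|lborel. indicator ?S v * (L * \<delta> * \<epsilon> * norm k)) = a \<epsilon> * V * (L * \<delta> * \<epsilon> * norm k)"
      using volS by simp
    also have "(LINT v|lborel. indicator ?S v * (\<psi> v * (sgn v \<bullet> k))) \<le> \<epsilon> * (A * ?R)"
      by (rule lborel_shell_integral_le[OF _ \<psi>_bnd e quot]) auto
    \<comment> \<open>\<open>A\<close> may have either sign, so \<open>?R\<close> is needed from
      both sides; it differs from \<open>V\<close> by at most the volume of the shell.\<close>
    also have "A * ?R \<le> A * V + \<bar>A\<bar> * (a \<epsilon> * V)"
    proof -
      have intR: "integrable lborel (ramp \<epsilon> :: 'a \<Rightarrow> real)"
        by (rule integrable_bounded_support[where B=1 and \<rho>=1]) (use e in \<open>auto simp: ramp_bounds ramp_outside\<close>)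
      have fin: "emeasure lborel (cball (0::'a) 1) < \<infinity>" using emeasure_lborel_cball_finite[of "0::'a" 1] by simp
      have i1: "integrable lborel (indicator (cball (0::'a) 1) :: 'a \<Rightarrow> real)"
        using fin by (intro integrable_real_indicator) auto
      have iS: "integrable lborel (indicator ?S :: 'a \<Rightarrow> real)"
        using intS[of "\<lambda>_. 1" 1] by simp
      have "?R \<le> (LINT v|lborel. indicator (cball (0::'a) 1) v)"
        by (rule integral_mono[OF intR i1]) (use e in \<open>auto simp: ramp_bounds ramp_outside indicator_def\<close>)
      then have R1: "?R \<le> V" by (simp add: V_def)
      have "(LINT v|lborel. indicator (cball (0::'a) 1) v - indicator ?S v) \<le> ?R"
        by (rule integral_mono[OF Bochner_Integration.integrable_diff[OF i1 iS] intR])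
           (use e in \<open>auto simp: ramp_bounds ramp_inside indicator_def\<close>)
      then have R2: "V - a \<epsilon> * V \<le> ?R"
        using Bochner_Integration.integral_diff[OF i1 iS] volS by (simp add: V_def)
      have "A * ?R - A * V \<le> \<bar>A * (?R - V)\<bar>" by (simp add: algebra_simps)
      also have "\<dots> \<le> \<bar>A\<bar> * (a \<epsilon> * V)"
        unfolding abs_mult using R1 R2 by (intro mult_left_mono) auto
      finally show ?thesis by simp
    qed
    finally have "a \<epsilon> * (I * V) \<le> \<epsilon> * (A * V + \<bar>A\<bar> * (a \<epsilon> * V)) + a \<epsilon> * V * (L * \<delta> * \<epsilon> * norm k)"
      using e by (simp add: mult_left_mono)
    then have "V * (a \<epsilon> * I) \<le> V * (\<epsilon> * (A + (\<bar>A\<bar> + L * \<delta> * norm k) * a \<epsilon>))"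
      by (simp add: algebra_simps)
    then have "a \<epsilon> * I \<le> \<epsilon> * (A + (\<bar>A\<bar> + L * \<delta> * norm k) * a \<epsilon>)"
      using V by (rule mult_left_le_imp_le)
    then show ?thesis using e by (simp add: pos_divide_le_eq mult.commute)
  qed
  have alim: "(a \<longlongrightarrow> 0) (at_right 0)"
  proof -
    have "((\<lambda>\<epsilon>. 1 - (1 - \<epsilon>) ^ DIM('a)) \<longlongrightarrow> 1 - (1 - 0) ^ DIM('a)) (at_right (0::real))"
      by (intro tendsto_intros)
    then show ?thesis by (simp add: a_def[abs_def])
  qed
  have "real DIM('a) * I \<le> A + (\<bar>A\<bar> + L * \<delta> * norm k) * 0"
  proof (rule tendsto_le[OF trivial_limit_at_right_real])
    show "((\<lambda>\<epsilon>. a \<epsilon> / \<epsilon> * I) \<longlongrightarrow> real DIM('a) * I) (at_right 0)"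
      unfolding a_def by (intro tendsto_intros one_minus_power_quotient)
    show "((\<lambda>\<epsilon>. A + (\<bar>A\<bar> + L * \<delta> * norm k) * a \<epsilon>) \<longlongrightarrow> A + (\<bar>A\<bar> + L * \<delta> * norm k) * 0) (at_right 0)"
      by (intro tendsto_intros alim)
    show "\<forall>\<^sub>F \<epsilon> in at_right 0. a \<epsilon> / \<epsilon> * I \<le> A + (\<bar>A\<bar> + L * \<delta> * norm k) * a \<epsilon>"
      using key by (auto simp: eventually_at_right_field intro!: exI[of _ 1])
  qed
  moreover have "(LINT u|uniform_sphere. (\<phi> (x + \<delta> *\<^sub>R u) - \<phi> x) * (u \<bullet> (y - x))) = \<delta> * I"
  proof -
    have "(LINT u|uniform_sphere. (\<phi> (x + \<delta> *\<^sub>R u) - \<phi> x) * (u \<bullet> (y - x))) * V = (LINT u|uniform_sphere. \<delta> * F u) * V"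
      unfolding V_def
      by (subst (1 2) integral_uniform_sphere)
         (auto intro!: Bochner_Integration.integral_cong simp: F_def \<psi>_def y_eq unit norm_sgn indicator_def)
    then show ?thesis using V by (simp add: I_def)
  qed
  ultimately show ?thesis using \<delta> mult_left_mono[of "real DIM('a) * I" A \<delta>] by (simp add: A_def algebra_simps)
qed

section \<open>Perturbed consensus\<close>

text \<open>The diameter of the set of positions. Averaging cannot enlarge it in any normed space,
  so the consensus estimate needs neither a mean nor an inner product.\<close>

definition spread :: "('n::finite \<Rightarrow> 'a::real_normed_vector) \<Rightarrow> real" where
  "spread z = (MAX (i, j) \<in> UNIV. norm (z i - z j))"

lemma norm_diff_le_spread: "norm (z i - z j) \<le> spread z"
  unfolding spread_def by (rule Max_ge) (auto intro!: image_eqI[of _ _ "(i, j)"])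

lemma spread_le: "(\<And>i j. norm (z i - z j) \<le> d) \<Longrightarrow> spread z \<le> d"
  unfolding spread_def by (rule Max.boundedI) auto

lemma spread_nonneg: "spread z \<ge> 0"
  using norm_diff_le_spread[of z undefined undefined] by simp

lemma spread_perturb:
  assumes "\<And>i. norm (z i - z' i) \<le> e"
  shows "spread z \<le> spread z' + 2 * e"
proof (rule spread_le)
  fix i j
  have "z i - z j = (z i - z' i) - (z j - z' j) + (z' i - z' j)" by simp
  then have "norm (z i - z j) \<le> norm (z i - z' i) + norm (z j - z' j) + norm (z' i - z' j)"
    by (metis add_right_mono norm_triangle_ineq norm_triangle_ineq4 order_trans)
  then show "norm (z i - z j) \<le> spread z' + 2 * e"
    using assms[of i] assms[of j] norm_diff_le_spread[of z' i j] by linarith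
qed

section \<open>Averaging by stochastic matrices\<close>

definition row_stochastic :: "('n::finite \<Rightarrow> 'n \<Rightarrow> real) \<Rightarrow> bool" where
  "row_stochastic P \<longleftrightarrow> (\<forall>i j. P i j \<ge> 0) \<and> (\<forall>i. (\<Sum>j\<in>UNIV. P i j) = 1)"

lemma norm_average_le:
  fixes z :: "'n::finite \<Rightarrow> 'a::real_normed_vector"
  assumes "row_stochastic P" "\<And>k. norm (z k) \<le> b"
  shows "norm (\<Sum>k\<in>UNIV. P i k *\<^sub>R z k) \<le> b"
proof -
  have "norm (\<Sum>k\<in>UNIV. P i k *\<^sub>R z k) \<le> (\<Sum>k\<in>UNIV. P i k * b)"
    by (rule sum_norm_le) (use assms in \<open>auto simp: row_stochastic_def intro: mult_left_mono\<close>)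
  also have "\<dots> = b" using assms by (simp add: row_stochastic_def sum_distrib_right[symmetric])
  finally show ?thesis .
qed

text \<open>
  In \<open>\<Sum>\<^bsub>k,l\<^esub> P i k * P j l *\<^sub>R (z k - z l)\<close> the diagonal terms vanish, and they carry a
  positive part of the total weight.
\<close>

lemma spread_contraction:
  fixes z :: "'n::finite \<Rightarrow> 'a::real_normed_vector"
  assumes P: "row_stochastic P" and \<eta>: "\<eta> \<ge> 0" "\<And>i j. P i j \<ge> \<eta>"
  shows "spread (\<lambda>i. \<Sum>k\<in>UNIV. P i k *\<^sub>R z k) \<le> (1 - \<eta>\<^sup>2) * spread z"
proof (rule spread_le)
  fix i j
  have P0: "P i j \<ge> 0" and P1: "(\<Sum>j\<in>UNIV. P i j) = 1" for i j using P by (auto simp: row_stochastic_def)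
  have "(\<Sum>k\<in>UNIV. P i k *\<^sub>R z k) = (\<Sum>k\<in>UNIV. \<Sum>l\<in>UNIV. (P i k * P j l) *\<^sub>R z k)"
    by (simp add: scaleR_left.sum[symmetric] sum_distrib_left[symmetric] P1)
  moreover have "(\<Sum>l\<in>UNIV. P j l *\<^sub>R z l) = (\<Sum>k\<in>UNIV. \<Sum>l\<in>UNIV. (P i k * P j l) *\<^sub>R z l)"
    by (subst sum.swap) (simp add: scaleR_left.sum[symmetric] sum_distrib_right[symmetric] P1)
  ultimately have "(\<Sum>k\<in>UNIV. P i k *\<^sub>R z k) - (\<Sum>k\<in>UNIV. P j k *\<^sub>R z k) =
      (\<Sum>k\<in>UNIV. \<Sum>l\<in>UNIV. (P i k * P j l) *\<^sub>R (z k - z l))"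
    by (simp add: sum_subtractf scaleR_diff_right)
  also have "norm \<dots> \<le> (\<Sum>k\<in>UNIV. \<Sum>l\<in>UNIV. P i k * P j l * (if k = l then 0 else spread z))"
    by (intro sum_norm_le) (auto intro!: mult_left_mono norm_diff_le_spread simp: P0 spread_nonneg)
  also have "\<dots> = (\<Sum>k\<in>UNIV. \<Sum>l\<in>UNIV. P i k * P j l * spread z) - (\<Sum>k\<in>UNIV. P i k * P j k * spread z)"
  proof -
    have "P i k * P j l * (if k = l then 0 else spread z) = P i k * P j l * spread z - (if l = k then P i k * P j l * spread z else 0)" for k l
      by simp
    then show ?thesis by (simp add: sum_subtractf)
  qed
  also have "(\<Sum>k\<in>UNIV. \<Sum>l\<in>UNIV. P i k * P j l * spread z) = spread z"
    by (simp add: sum_distrib_left[symmetric] sum_distrib_right[symmetric] P1)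
  \<comment> \<open>One common target, here \<open>k = i\<close>, already has weight at least \<eta>
    in both rows.\<close>
  also have "spread z - (\<Sum>k\<in>UNIV. P i k * P j k * spread z) \<le> spread z - P i i * P j i * spread z"
    using member_le_sum[of i UNIV "\<lambda>k. P i k * P j k * spread z"] by (simp add: P0 spread_nonneg)
  also have "\<dots> \<le> spread z - \<eta> * \<eta> * spread z"
    using \<eta> by (intro diff_left_mono mult_right_mono mult_mono spread_nonneg) (auto intro: order_trans)
  finally show "norm ((\<Sum>k\<in>UNIV. P i k *\<^sub>R z k) - (\<Sum>k\<in>UNIV. P j k *\<^sub>R z k)) \<le> (1 - \<eta>\<^sup>2) * spread z"
    by (simp add: power2_eq_square algebra_simps)
qed

text \<open>The product of the \<open>l\<close> matrices starting with \<open>W t\<close>, the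
  newest factor on the left: it maps the positions at time \<open>t\<close> to the unperturbed
  positions at time \<open>t + l\<close>.\<close>

primrec mix_prod :: "(nat \<Rightarrow> real^'n^'n::finite) \<Rightarrow> nat \<Rightarrow> nat \<Rightarrow> 'n \<Rightarrow> 'n \<Rightarrow> real" where
  "mix_prod W t 0 = (\<lambda>i j. if i = j then 1 else 0)"
| "mix_prod W t (Suc l) = (\<lambda>i j. \<Sum>k\<in>UNIV. W (t + l) $ i $ k * mix_prod W t l k j)"

lemma doubly_stochastic_row: "doubly_stochastic W \<Longrightarrow> row_stochastic (\<lambda>i j. W $ i $ j)"
  by (simp add: doubly_stochastic_def row_stochastic_def)

lemma row_stochastic_mix_prod:
  assumes "\<And>l. doubly_stochastic (W (t + l))"
  shows "row_stochastic (mix_prod W t l)"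
proof (induction l)
  case 0 then show ?case by (auto simp: row_stochastic_def)
next
  case (Suc l)
  have W: "W (t + l) $ i $ k \<ge> 0" "(\<Sum>k\<in>UNIV. W (t + l) $ i $ k) = 1" for i k
    using assms[of l] by (auto simp: doubly_stochastic_def)
  have "(\<Sum>j\<in>UNIV. \<Sum>k\<in>UNIV. W (t + l) $ i $ k * mix_prod W t l k j) = 1" for i
    by (subst sum.swap) (use Suc W in \<open>simp add: row_stochastic_def sum_distrib_left[symmetric]\<close>)
  then show ?case using Suc W by (auto simp: row_stochastic_def intro!: sum_nonneg mult_nonneg_nonneg)
qed

lemma rtrancl_leaves_set:
  assumes "(a, b) \<in> r\<^sup>*" "a \<in> S" "b \<notin> S"
  shows "\<exists>c d. (c, d) \<in> r \<and> c \<in> S \<and> d \<notin> S"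
  using assms by (induction rule: rtrancl_induct) auto

text \<open>For a fixed column \<open>j\<close>, let \<open>S l\<close> collect the rows whose entry
  is at least \<open>w ^ l\<close>. Self-loops make \<open>S\<close> increasing, and connectivity of
  each window of length \<open>B\<close> supplies an edge leaving \<open>S\<close> unless it
  contains everyone. So \<open>S\<close> gains an agent per window and is full after
  \<open>CARD('n)\<close> windows.\<close>

lemma mix_prod_positive:
  fixes W :: "nat \<Rightarrow> real^'n^'n::finite"
  assumes t: "t \<ge> 1" and w: "0 < w" "w < 1"
    and Ww: "\<And>t i j. t \<ge> 1 \<Longrightarrow> (j, i) \<in> E t \<or> i = j \<Longrightarrow> W t $ i $ j \<ge> w"
    and ds: "\<And>t. t \<ge> 1 \<Longrightarrow> doubly_stochastic (W t)"
    and conn: "\<And>t i j. t \<ge> 1 \<Longrightarrow> (i, j) \<in> (\<Union>l<B. E (t + l))\<^sup>*"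
  shows "mix_prod W t (CARD('n) * B) i j \<ge> w ^ (CARD('n) * B)"
proof -
  define S where "S l = {i. mix_prod W t l i j \<ge> w ^ l}" for l
  have nn: "mix_prod W t l i j \<ge> 0" for l i j
    using row_stochastic_mix_prod[of W t l] ds t by (simp add: row_stochastic_def)
  have W0: "W s $ i $ k \<ge> 0" if "s \<ge> 1" for s i k
    using ds[OF that] by (simp add: doubly_stochastic_def)
  have step: "b \<in> S (Suc l)" if "a \<in> S l" "(a, b) \<in> E (t + l) \<or> b = a" for a b l
  proof -
    have "w * w ^ l \<le> W (t + l) $ b $ a * mix_prod W t l a j"
      using that w Ww[of "t + l" a b] t by (intro mult_mono W0) (auto simp: S_def)
    also have "\<dots> \<le> mix_prod W t (Suc l) b j"
      using t by (auto intro!: member_le_sum[of a UNIV "\<lambda>a. W (t + l) $ b $ a * mix_prod W t l a j"] mult_nonneg_nonneg nn W0)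
    finally show ?thesis by (simp add: S_def)
  qed
  have mono: "S l \<subseteq> S l'" if "l \<le> l'" for l l'
    using that by (induction rule: dec_induct) (use step in blast)+
  have grow: "card (S (k * B)) \<ge> min (CARD('n)) (Suc k)" for k
  proof (induction k)
    case 0
    have "j \<in> S 0" by (simp add: S_def)
    then have "card (S 0) > 0" by (auto simp: card_gt_0_iff)
    then show ?case by auto
  next
    case (Suc k)
    show ?case
    proof (cases "S (k * B) = UNIV")
      case True
      then have "S (Suc k * B) = UNIV" using mono[of "k * B" "Suc k * B"] by auto
      then show ?thesis by simp
    next
      case False
      then obtain b where b: "b \<notin> S (k * B)" by auto
      have "j \<in> S (k * B)" using mono[of 0 "k * B"] by (auto simp: S_def)
      \<comment> \<open>A path from \<open>j\<close> to an agent not yet reached crosses the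
        boundary of \<open>S (k * B)\<close>. The crossing edge is active at some time of the
        window, and monotonicity carries its tail forward to that time.\<close>
      from rtrancl_leaves_set[OF conn[of "t + k * B" j b] this b] t obtain c d l where
        cd: "(c, d) \<in> E (t + k * B + l)" "l < B" "c \<in> S (k * B)" "d \<notin> S (k * B)" by auto
      have "c \<in> S (k * B + l)" using cd mono[of "k * B" "k * B + l"] by auto
      then have "d \<in> S (Suc (k * B + l))" using cd(1) by (intro step) (auto simp: add.assoc)
      then have "d \<in> S (Suc k * B)" using mono[of "Suc (k * B + l)" "Suc k * B"] cd(2) by auto
      then have "insert d (S (k * B)) \<subseteq> S (Suc k * B)" using mono[of "k * B" "Suc k * B"] by auto
      then have "card (insert d (S (k * B))) \<le> card (S (Suc k * B))" by (intro card_mono) auto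
      then show ?thesis using cd(4) Suc by auto
    qed
  qed
  have "card (S (CARD('n) * B)) = CARD('n)"
    using grow[of "CARD('n)"] card_mono[of UNIV "S (CARD('n) * B)"] by simp
  then have "S (CARD('n) * B) = UNIV" by (intro card_subset_eq) auto
  then show ?thesis by (auto simp: S_def)
qed

definition perturbed_consensus :: "(nat \<Rightarrow> real^'n^'n) \<Rightarrow> (nat \<Rightarrow> 'n \<Rightarrow> 'a::real_normed_vector) \<Rightarrow> (nat \<Rightarrow> 'n \<Rightarrow> 'a) \<Rightarrow> bool" where
  "perturbed_consensus W z e \<longleftrightarrow> (\<forall>t\<ge>1. \<forall>i. z (t + 1) i = (\<Sum>j\<in>UNIV. W t $ i $ j *\<^sub>R z t j) + e t i)"

text \<open>Row averaging is non-expansive, so errors simply add up over a window. The contraction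
  is applied afterwards, to the unperturbed part alone.\<close>

lemma mix_prod_perturbed:
  fixes z e :: "nat \<Rightarrow> 'n::finite \<Rightarrow> 'a::real_normed_vector"
  assumes "perturbed_consensus W z e" and t: "t \<ge> 1"
    and ds: "\<And>t. t \<ge> 1 \<Longrightarrow> doubly_stochastic (W t)"
  shows "norm (z (t + l) i - (\<Sum>j\<in>UNIV. mix_prod W t l i j *\<^sub>R z t j)) \<le> (\<Sum>s=t..<t+l. \<Sum>j\<in>UNIV. norm (e s j))"
proof (induction l arbitrary: i)
  case 0
  have "(\<Sum>j\<in>UNIV. (if i = j then 1 else 0) *\<^sub>R z t j) = (\<Sum>j\<in>UNIV. if i = j then z t j else 0)"
    by (rule sum.cong) auto
  then show ?case by simp
next
  case (Suc l)
  let ?y = "\<lambda>l k. \<Sum>j\<in>UNIV. mix_prod W t l k j *\<^sub>R z t j"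
  have "?y (Suc l) i = (\<Sum>k\<in>UNIV. W (t + l) $ i $ k *\<^sub>R ?y l k)"
    by (simp add: scaleR_sum_left scaleR_sum_right) (rule sum.swap)
  moreover have "z (t + Suc l) i = (\<Sum>k\<in>UNIV. W (t + l) $ i $ k *\<^sub>R z (t + l) k) + e (t + l) i"
    using assms(1) t unfolding perturbed_consensus_def by (metis add.assoc le_add1 order_trans Suc_eq_plus1)
  ultimately have "z (t + Suc l) i - ?y (Suc l) i = (\<Sum>k\<in>UNIV. W (t + l) $ i $ k *\<^sub>R (z (t + l) k - ?y l k)) + e (t + l) i"
    by (simp add: scaleR_diff_right sum_subtractf)
  also have "norm \<dots> \<le> (\<Sum>s=t..<t+l. \<Sum>j\<in>UNIV. norm (e s j)) + (\<Sum>j\<in>UNIV. norm (e (t + l) j))"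
    by (intro norm_triangle_mono norm_average_le[OF doubly_stochastic_row] Suc ds member_le_sum[of i UNIV "\<lambda>j. norm (e (t + l) j)"]) (use t in auto)
  finally show ?case by simp
qed

text \<open>Over a window of length \<open>L\<close> the spread shrinks by the factor
  \<open>1 - \<eta>\<^sup>2\<close>, up to twice the errors in the window. When all windows are
  summed, each error is counted at most \<open>L\<close> times and the shrunken sum is absorbed on
  the left. \<open>K\<close> is fixed before \<open>z\<close>, \<open>e\<close> and
  \<open>T\<close>, so that it serves every realisation of the random directions.\<close>

theorem perturbed_consensus_sum:
  fixes W :: "nat \<Rightarrow> real^'n^'n::finite"
  assumes "graph_assms E W"
  obtains K where "K \<ge> 0"
    "\<And>z e T. perturbed_consensus W z (e :: nat \<Rightarrow> 'n \<Rightarrow> 'a::real_normed_vector) \<Longrightarrow>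
       (\<Sum>t=1..T. spread (z t)) \<le> K * (spread (z 1) + (\<Sum>t=1..T. \<Sum>i\<in>UNIV. norm (e t i)))"
proof -
  from assms obtain w B where w: "0 < w" "w < 1"
    and W_if: "\<forall>t\<ge>1. \<forall>i j. if (j, i) \<in> E t \<or> i = j then W t $ i $ j \<ge> w else W t $ i $ j = 0"
    and ds_all: "\<forall>t\<ge>1. doubly_stochastic (W t)"
    and conn_all: "\<forall>t\<ge>1. \<forall>i j. (i, j) \<in> (\<Union>l<B. E (t + l))\<^sup>*"
    unfolding graph_assms_def by (elim conjE exE) rule
  have Ww: "W t $ i $ j \<ge> w" if "t \<ge> 1" "(j, i) \<in> E t \<or> i = j" for t i j
    using W_if[rule_format, OF that(1), of j i] that(2) by (simp only: if_True)
  note ds = ds_all[rule_format] and conn = conn_all[rule_format]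
  define L where "L = CARD('n) * B"
  define \<eta> where "\<eta> = w ^ L"
  have \<eta>: "\<eta> > 0" using w by (simp add: \<eta>_def)
  \<comment> \<open>The first \<open>L\<close> terms contribute \<open>L * (S 1 + 2 * D)\<close> and
    the windows \<open>2 * L * D\<close>, together at most \<open>4 * L * (S 1 + D)\<close>.\<close>
  define K where "K = 4 * real L / \<eta>\<^sup>2"
  have "(\<Sum>t=1..T. spread (z t)) \<le> K * (spread (z 1) + (\<Sum>t=1..T. \<Sum>i\<in>UNIV. norm (e t i)))"
    if pc: "perturbed_consensus W z e" for z e :: "nat \<Rightarrow> 'n \<Rightarrow> 'a" and T
  proof -
    define S where "S t = spread (z t)" for t
    define en where "en t = (\<Sum>i\<in>UNIV. norm (e t i))" for t
    define D where "D = (\<Sum>t=1..T. en t)"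
    have S0: "S t \<ge> 0" and en0: "en t \<ge> 0" for t by (auto simp: S_def en_def spread_nonneg intro: sum_nonneg)
    have D0: "D \<ge> 0" using en0 by (simp add: D_def sum_nonneg)
    have rs: "row_stochastic (mix_prod W t l)" if "t \<ge> 1" for t l
      by (rule row_stochastic_mix_prod) (use ds that in auto)
    have bound: "S (t + l) \<le> (1 - c\<^sup>2) * S t + 2 * (\<Sum>s=t..<t+l. en s)"
      if "t \<ge> 1" "c \<ge> 0" "\<And>i j. mix_prod W t l i j \<ge> c" for t l c
    proof -
      let ?y = "\<lambda>i. \<Sum>j\<in>UNIV. mix_prod W t l i j *\<^sub>R z t j"
      have "spread (z (t + l)) \<le> spread ?y + 2 * (\<Sum>s=t..<t+l. en s)"
        unfolding en_def by (intro spread_perturb mix_prod_perturbed[OF pc] that(1) ds)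
      moreover have "spread ?y \<le> (1 - c\<^sup>2) * spread (z t)"
        by (rule spread_contraction[OF rs[OF that(1)] that(2,3)])
      ultimately show ?thesis by (simp add: S_def)
    qed
    \<comment> \<open>Terms not preceded by a full window: the trivial lower bound 0 on the entries
      gives non-expansion.\<close>
    have initial: "S t \<le> S 1 + 2 * D" if "1 \<le> t" "t \<le> T" for t
    proof -
      have "S (1 + (t - 1)) \<le> (1 - 0\<^sup>2) * S 1 + 2 * (\<Sum>s=1..<1+(t-1). en s)"
        by (rule bound) (use rs[of 1 "t - 1"] in \<open>auto simp: row_stochastic_def\<close>)
      moreover have "(\<Sum>s=1..<1+(t-1). en s) \<le> D"
        unfolding D_def using that en0 by (intro sum_mono2) auto
      ultimately show ?thesis using that by simp
    qed
    have window: "S (t + L) \<le> (1 - \<eta>\<^sup>2) * S t + 2 * (\<Sum>l<L. en (t + l))" if "t \<ge> 1" for t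
    proof -
      have "S (t + L) \<le> (1 - \<eta>\<^sup>2) * S t + 2 * (\<Sum>s=t..<t+L. en s)"
        by (rule bound) (use \<eta> that mix_prod_positive[OF that w Ww ds conn] in \<open>auto simp: \<eta>_def L_def\<close>)
      also have "(\<Sum>s=t..<t+L. en s) = (\<Sum>l<L. en (t + l))"
        using sum.shift_bounds_nat_ivl[of en 0 t L] by (simp add: atLeast0LessThan add.commute)
      finally show ?thesis .
    qed
    have \<eta>1: "\<eta> \<le> 1" using w by (simp add: \<eta>_def power_le_one)
    then have \<eta>2: "\<eta>\<^sup>2 \<le> 1" using \<eta> by (simp add: power_le_one)
    have "(\<Sum>t=1..T. S t) \<le> (\<Sum>t=1..min L T. S t) + (\<Sum>t=1..T-L. S (t + L))"
    proof -
      have "{1..T} \<subseteq> {1..min L T} \<union> (\<lambda>t. t + L) ` {1..T-L}"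
      proof
        fix t assume "t \<in> {1..T}"
        then show "t \<in> {1..min L T} \<union> (\<lambda>t. t + L) ` {1..T-L}"
          by (cases "t \<le> L") (auto intro!: image_eqI[of _ _ "t - L"])
      qed
      then have "(\<Sum>t=1..T. S t) \<le> (\<Sum>t\<in>{1..min L T} \<union> (\<lambda>t. t + L) ` {1..T-L}. S t)"
        using S0 by (intro sum_mono2) auto
      also have "\<dots> \<le> (\<Sum>t=1..min L T. S t) + (\<Sum>t\<in>(\<lambda>t. t + L) ` {1..T-L}. S t)"
        by (subst sum_Un) (use S0 in \<open>auto intro!: sum_nonneg\<close>)
      also have "(\<Sum>t\<in>(\<lambda>t. t + L) ` {1..T-L}. S t) = (\<Sum>t=1..T-L. S (t + L))"
        by (subst sum.reindex) (auto simp: inj_on_def)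
      finally show ?thesis .
    qed
    also have "(\<Sum>t=1..min L T. S t) \<le> real L * (S 1 + 2 * D)"
    proof -
      have "(\<Sum>t=1..min L T. S t) \<le> real (min L T) * (S 1 + 2 * D)"
        using sum_bounded_above[of "{1..min L T}" S "S 1 + 2 * D"] initial by simp
      also have "\<dots> \<le> real L * (S 1 + 2 * D)" using S0[of 1] D0 by (intro mult_right_mono) auto
      finally show ?thesis .
    qed
    also have "(\<Sum>t=1..T-L. S (t + L)) \<le> (1 - \<eta>\<^sup>2) * (\<Sum>t=1..T. S t) + 2 * (real L * D)"
    proof -
      have "(\<Sum>t=1..T-L. S (t + L)) \<le> (\<Sum>t=1..T-L. (1 - \<eta>\<^sup>2) * S t + 2 * (\<Sum>l<L. en (t + l)))"
        by (intro sum_mono window) auto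
      also have "\<dots> = (1 - \<eta>\<^sup>2) * (\<Sum>t=1..T-L. S t) + 2 * (\<Sum>l<L. \<Sum>t=1..T-L. en (t + l))"
        by (simp add: sum.distrib sum_distrib_left) (rule sum.swap)
      also have "(\<Sum>l<L. \<Sum>t=1..T-L. en (t + l)) \<le> (\<Sum>l<L. D)"
      proof (rule sum_mono)
        fix l assume "l \<in> {..<L}"
        then have "(\<lambda>t. t + l) ` {1..T-L} \<subseteq> {1..T}" by auto
        then have "(\<Sum>t\<in>(\<lambda>t. t + l) ` {1..T-L}. en t) \<le> D"
          unfolding D_def using en0 by (intro sum_mono2) auto
        moreover have "(\<Sum>t\<in>(\<lambda>t. t + l) ` {1..T-L}. en t) = (\<Sum>t=1..T-L. en (t + l))"
          by (subst sum.reindex) (auto simp: inj_on_def)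
        ultimately show "(\<Sum>t=1..T-L. en (t + l)) \<le> D" by simp
      qed
      also have "(\<Sum>t=1..T-L. S t) \<le> (\<Sum>t=1..T. S t)" using S0 by (intro sum_mono2) auto
      finally show ?thesis using \<eta>2 by (simp add: mult_left_mono)
    qed
    finally have "\<eta>\<^sup>2 * (\<Sum>t=1..T. S t) \<le> real L * S 1 + 4 * real L * D"
      by (simp add: algebra_simps)
    also have "\<dots> \<le> 4 * real L * (S 1 + D)" using S0[of 1] by (simp add: algebra_simps)
    also have "\<dots> = \<eta>\<^sup>2 * (K * (S 1 + D))" using \<eta> by (simp add: K_def)
    finally have "(\<Sum>t=1..T. S t) \<le> K * (S 1 + D)"
      by (rule mult_left_le_imp_le) (use \<eta> in simp)
    then show ?thesis by (simp only: S_def D_def en_def)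
  qed
  moreover have "K \<ge> 0" by (simp add: K_def)
  ultimately show ?thesis using that by blast
qed

section \<open>The algorithm with general step sizes\<close>

text \<open>Summation by parts with increasing weights. Here \<open>a t\<close> and
  \<open>b t\<close> stand for squared distances to the comparator before and after a step,
  \<open>d t\<close> pays for the change of comparator, and each increase of the weight is charged
  to the bound \<open>M\<close>.\<close>

lemma sum_telescope_weighted_le:
  fixes a b w d :: "nat \<Rightarrow> real"
  assumes "T \<ge> 1" and w: "\<And>t. t \<ge> 1 \<Longrightarrow> 0 \<le> w t" "\<And>t. t \<ge> 1 \<Longrightarrow> w t \<le> w (t + 1)"
    and M: "\<And>t. 1 \<le> t \<Longrightarrow> t \<le> T \<Longrightarrow> a t \<le> M" "\<And>t. 1 \<le> t \<Longrightarrow> t \<le> T \<Longrightarrow> b t \<le> M"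
    and step: "\<And>t. 1 \<le> t \<Longrightarrow> t < T \<Longrightarrow> a (t + 1) \<le> b t + d t"
  shows "(\<Sum>t=1..T. w t * (a t - b t)) \<le> w T * (M - b T) + (\<Sum>t=1..T-1. w (t + 1) * d t)"
  using assms(1) M step
proof (induction T rule: nat_induct_at_least)
  case base
  then show ?case using w(1)[of 1] by (auto intro!: mult_left_mono)
next
  case (Suc T)
  have "(\<Sum>t=1..Suc T. w t * (a t - b t)) \<le>
      w T * (M - b T) + (\<Sum>t=1..T-1. w (t + 1) * d t) + w (Suc T) * (a (Suc T) - b (Suc T))"
    using Suc by simp
  also have "w T * (M - b T) \<le> w (Suc T) * (M - b T)"
    using w(2)[of T] Suc by (intro mult_right_mono) auto
  also have "w (Suc T) * (a (Suc T) - b (Suc T)) \<le> w (Suc T) * (b T + d T - b (Suc T))"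
    using w(1)[of "Suc T"] Suc.prems(3)[of T] Suc.hyps by (intro mult_left_mono) auto
  also have "w (Suc T) * (M - b T) + (\<Sum>t=1..T-1. w (t + 1) * d t) + w (Suc T) * (b T + d T - b (Suc T)) =
      w (Suc T) * (M - b (Suc T)) + ((\<Sum>t=1..T-1. w (t + 1) * d t) + w (T + 1) * d T)"
    by (simp add: algebra_simps)
  also have "(\<Sum>t=1..T-1. w (t + 1) * d t) + w (T + 1) * d T = (\<Sum>t=1..Suc T-1. w (t + 1) * d t)"
    using Suc.hyps by (cases T) auto
  finally show ?case by simp
qed

text \<open>Summation by parts charges the growth of \<open>1 / \<gamma>\<close> to
  \<open>Q\<close>. This growth is at most \<beta> and comes with the factor 1/2, so it consumes
  half of the regularisation term and leaves the other half.\<close>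

lemma sum_drift_weighted_ge:
  fixes Q \<gamma> \<beta> :: "nat \<Rightarrow> real"
  assumes Q: "\<And>t. Q t \<ge> 0" "Q 1 = 0"
    and \<gamma>: "\<And>t. t \<ge> 1 \<Longrightarrow> 1 / \<gamma> (t + 1) - 1 / \<gamma> t \<le> \<beta> (t + 1)"
  shows "Q (T + 1) / (2 * \<gamma> (T + 1)) + (\<Sum>t=1..T. \<beta> (t + 1) * Q t) / 2
    \<le> (\<Sum>t=1..T. (Q (t + 1) - Q t) / (2 * \<gamma> (t + 1)) + \<beta> (t + 1) * Q t)"
proof (induction T)
  case 0 then show ?case using Q by simp
next
  case (Suc T)
  have "(1 / \<gamma> (T + 2) - 1 / \<gamma> (T + 1)) * Q (T + 1) \<le> \<beta> (T + 2) * Q (T + 1)"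
    using \<gamma>[of "T + 1"] Q by (intro mult_right_mono) auto
  then have "Q (T + 1) / \<gamma> (T + 2) \<le> Q (T + 1) / \<gamma> (T + 1) + \<beta> (T + 2) * Q (T + 1)"
    by (simp add: algebra_simps)
  then show ?case using Suc by (simp add: diff_divide_distrib add_divide_distrib)
qed

text \<open>With increasing weights, summation by parts leaves only non-positive terms besides the
  boundary term.\<close>

lemma sum_increments_weighted_le:
  fixes Q \<gamma> :: "nat \<Rightarrow> real"
  assumes Q: "\<And>t. t \<ge> 1 \<Longrightarrow> Q t \<ge> 0" "Q 1 = 0" and \<gamma>: "\<And>t. t \<ge> 1 \<Longrightarrow> 1 / \<gamma> t \<le> 1 / \<gamma> (t + 1)"
  shows "(\<Sum>t=1..T. (Q (t + 1) - Q t) / \<gamma> (t + 1)) \<le> Q (T + 1) / \<gamma> (T + 1)"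
proof (induction T)
  case 0 then show ?case using Q by simp
next
  case (Suc T)
  have "1 / \<gamma> (T + 1) * Q (T + 1) \<le> 1 / \<gamma> (T + 2) * Q (T + 1)"
    using \<gamma>[of "T + 1"] Q(1)[of "T + 1"] by (intro mult_right_mono) auto
  then show ?case using Suc by (simp add: diff_divide_distrib)
qed

lemma am_gm_weighted:
  fixes a b s :: real
  assumes "s > 0"
  shows "a * b \<le> a\<^sup>2 / (4 * s) + b\<^sup>2 * s"
proof -
  have "0 \<le> (a - 2 * s * b)\<^sup>2" by simp
  then have "a * b * (4 * s) \<le> a\<^sup>2 + 4 * s\<^sup>2 * b\<^sup>2" by (simp add: power2_eq_square algebra_simps)
  then show ?thesis using assms by (simp add: field_simps power2_eq_square)
qed

text \<open>A column is the image of a unit vector. For the \<open>Sup\<close> to be an upper bound,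
  its set has to be bounded above, and the sum of the column norms provides this.\<close>

lemma norm_le_spectral_norm:
  assumes "k < m" shows "norm (S k) \<le> spectral_norm m S"
proof -
  have "norm (S k) = norm (\<Sum>j<m. (if j = k then 1 else 0) *\<^sub>R S j)"
  proof -
    have "(\<Sum>j<m. (if j = k then 1 else 0) *\<^sub>R S j) = (\<Sum>j<m. if j = k then S j else 0)"
      by (rule sum.cong) auto
    then show ?thesis using assms by simp
  qed
  also have "\<dots> \<le> spectral_norm m S"
    unfolding spectral_norm_def
  proof (rule cSup_upper)
    have "L2_set (\<lambda>j. if j = k then 1 else 0) {..<m} \<le> (1::real)"
      unfolding L2_set_def using assms by (simp add: if_distrib[of "\<lambda>x. x\<^sup>2"] cong: if_cong)
    then show "norm (\<Sum>j<m. (if j = k then 1 else 0) *\<^sub>R S j) \<in> {norm (\<Sum>k<m. v k *\<^sub>R S k) |v. L2_set v {..<m} \<le> 1}"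
      by (intro CollectI exI[of _ "\<lambda>j. if j = k then 1 else 0"] conjI refl)
    show "bdd_above {norm (\<Sum>k<m. v k *\<^sub>R S k) |v. L2_set v {..<m} \<le> 1}"
    proof (rule bdd_aboveI)
      fix y assume "y \<in> {norm (\<Sum>k<m. v k *\<^sub>R S k) |v. L2_set v {..<m} \<le> 1}"
      then obtain v where y: "y = norm (\<Sum>k<m. v k *\<^sub>R S k)" and v: "L2_set v {..<m} \<le> 1" by blast
      have "norm (v j *\<^sub>R S j) \<le> norm (S j)" if "j < m" for j
      proof -
        have "\<bar>v j\<bar> \<le> L2_set (\<lambda>j. \<bar>v j\<bar>) {..<m}"
          using that by (intro member_le_L2_set) auto
        also have "\<dots> = L2_set v {..<m}" by (simp add: L2_set_def)
        finally have "\<bar>v j\<bar> \<le> 1" using v by simp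
        then show ?thesis by (simp add: mult_left_le_one_le)
      qed
      then show "y \<le> (\<Sum>j<m. norm (S j))" unfolding y by (intro sum_norm_le) auto
    qed
  qed
  finally show ?thesis .
qed

text \<open>A subgradient at each of the two points bounds the difference from one side.\<close>

lemma subgradient_bounded_imp_lipschitz:
  fixes \<phi> :: "'a::real_inner \<Rightarrow> real"
  assumes "\<And>x. x \<in> X \<Longrightarrow> \<exists>s. subgradient_on X \<phi> x s \<and> norm s \<le> L" and xy: "x \<in> X" "y \<in> X"
  shows "\<bar>\<phi> x - \<phi> y\<bar> \<le> L * norm (x - y)"
proof -
  have "\<phi> a - \<phi> b \<le> L * norm (a - b)" if ab: "a \<in> X" "b \<in> X" for a b
  proof -
    obtain s where s: "subgradient_on X \<phi> a s" "norm s \<le> L" using assms(1)[OF ab(1)] by blast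
    have "\<phi> a - \<phi> b \<le> s \<bullet> (a - b)" using s(1) ab(2) by (auto simp: subgradient_on_def algebra_simps)
    also have "\<dots> \<le> norm s * norm (a - b)" by (rule norm_cauchy_schwarz)
    also have "\<dots> \<le> L * norm (a - b)" using s(2) by (intro mult_right_mono) auto
    finally show ?thesis .
  qed
  from this[of x y] this[of y x] xy show ?thesis by (simp add: abs_le_iff norm_minus_commute)
qed

text \<open>The step sizes are reduced to the inequalities that a run uses:
  \<open>\<beta>\<gamma>\<close> keeps the coefficient of the old dual variable non-negative,
  \<open>\<gamma>_step\<close> lets the regularisation absorb the growth of
  \<open>1 / \<gamma>\<close>, and the bound of \<delta> by \<open>r * \<xi>\<close> keeps the
  sampled points in \<open>X\<close>. Connectivity of the graphs enters as the constant
  \<open>K\<close>.\<close>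

locale bandit_setting =
  fixes X :: "(real^'p::finite) set"
    and f :: "'n::finite \<Rightarrow> nat \<Rightarrow> real^'p \<Rightarrow> real"
    and m :: "'n \<Rightarrow> nat"
    and g :: "'n \<Rightarrow> nat \<Rightarrow> real^'p \<Rightarrow> nat \<Rightarrow> real"
    and r R F1 F2 :: real
    and W :: "nat \<Rightarrow> real^'n^'n" and K :: real
    and \<alpha> \<beta> \<gamma> \<tau> \<xi> \<delta> :: "nat \<Rightarrow> real"
  assumes problem: "problem_assms X f m g r R F1 F2"
    and mixing: "\<And>t. t \<ge> 1 \<Longrightarrow> doubly_stochastic (W t)"
    and K_nonneg: "K \<ge> 0"
    and consensus: "\<And>z e T. perturbed_consensus W z (e :: nat \<Rightarrow> 'n \<Rightarrow> real^'p) \<Longrightarrow>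
       (\<Sum>t=1..T. spread (z t)) \<le> K * (spread (z 1) + (\<Sum>t=1..T. \<Sum>i\<in>UNIV. norm (e t i)))"
    and \<alpha>_pos: "\<And>t. t \<ge> 1 \<Longrightarrow> \<alpha> t > 0" and \<alpha>_mono: "\<And>t. t \<ge> 1 \<Longrightarrow> \<alpha> (t + 1) \<le> \<alpha> t"
    and \<beta>_pos: "\<And>t. t \<ge> 1 \<Longrightarrow> \<beta> t > 0" and \<beta>_mono: "\<And>t. t \<ge> 1 \<Longrightarrow> \<beta> (t + 1) \<le> \<beta> t"
    and \<gamma>_pos: "\<And>t. t \<ge> 1 \<Longrightarrow> \<gamma> t > 0" and \<gamma>_mono: "\<And>t. t \<ge> 1 \<Longrightarrow> \<gamma> (t + 1) \<le> \<gamma> t"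
    and \<beta>\<gamma>: "\<And>t. t \<ge> 1 \<Longrightarrow> \<beta> t * \<gamma> t \<le> 1"
    and \<gamma>_step: "\<And>t. t \<ge> 1 \<Longrightarrow> 1 / \<gamma> (t + 1) - 1 / \<gamma> t \<le> \<beta> (t + 1)"
    and \<tau>_nonneg: "\<And>t. t \<ge> 1 \<Longrightarrow> \<tau> t \<ge> 0"
    and \<xi>_bounds: "\<And>t. t \<ge> 1 \<Longrightarrow> 0 < \<xi> t" "\<And>t. t \<ge> 1 \<Longrightarrow> \<xi> t < 1"
    and \<xi>_mono: "\<And>t. t \<ge> 1 \<Longrightarrow> \<xi> (t + 1) \<le> \<xi> t"
    and \<delta>_bounds: "\<And>t. t \<ge> 1 \<Longrightarrow> 0 < \<delta> t" "\<And>t. t \<ge> 1 \<Longrightarrow> \<delta> t \<le> r * \<xi> t"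
begin

definition viol :: "'n \<Rightarrow> nat \<Rightarrow> real^'p \<Rightarrow> nat \<Rightarrow> real" where "viol i t z k = max 0 (g i t z k)"
definition Xs :: "nat \<Rightarrow> (real^'p) set" where "Xs t = (*\<^sub>R) (1 - \<xi> t) ` X"
text \<open>Bound on the norm of every two-point estimate: an increment of at most
  \<open>F2 * \<delta>\<close> is multiplied by \<open>CARD('p) / \<delta>\<close>, so \<delta>
  drops out.\<close>

definition G :: real where "G = real CARD('p) * F2"
text \<open>\<open>F1\<close> bounds a violation and \<open>2 * R * G\<close> its linear correction,
  since \<open>X\<close> has diameter at most \<open>2 * R\<close>.\<close>

definition dual_bound :: real where "dual_bound = F1 + 2 * R * G"
definition M :: real where "M = (\<Sum>i\<in>UNIV. real (m i))"

lemma X_facts: "convex X" "closed X" "r > 0" "R > 0" "cball 0 r \<subseteq> X" "X \<subseteq> cball 0 R"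
  and convex_f: "t \<ge> 1 \<Longrightarrow> convex_on X (f i t)"
  and convex_g: "t \<ge> 1 \<Longrightarrow> k < m i \<Longrightarrow> convex_on X (\<lambda>x. g i t x k)"
  and f_diff: "t \<ge> 1 \<Longrightarrow> z \<in> X \<Longrightarrow> z' \<in> X \<Longrightarrow> \<bar>f i t z - f i t z'\<bar> \<le> F1"
  and g_norm: "t \<ge> 1 \<Longrightarrow> z \<in> X \<Longrightarrow> L2_set (g i t z) {..<m i} \<le> F1"
  and f_subgrad: "t \<ge> 1 \<Longrightarrow> z \<in> X \<Longrightarrow> \<exists>s. subgradient_on X (f i t) z s \<and> norm s \<le> F2"
  and g_subgrad: "t \<ge> 1 \<Longrightarrow> z \<in> X \<Longrightarrow> \<exists>S. (\<forall>k<m i. subgradient_on X (\<lambda>z. g i t z k) z (S k)) \<and> spectral_norm (m i) S \<le> F2"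
  using problem unfolding problem_assms_def by auto

lemma norm_X: "z \<in> X \<Longrightarrow> norm z \<le> R"
  using X_facts(6) by auto

lemma zero_X: "0 \<in> X"
  using X_facts(3,5) by auto

lemma F2_nonneg: "F2 \<ge> 0"
  using f_subgrad[OF order_refl zero_X] norm_ge_zero order_trans by blast

lemma F1_nonneg: "F1 \<ge> 0"
  using f_diff[OF order_refl zero_X zero_X] by simp

lemma G_nonneg: "G \<ge> 0"
  by (simp add: G_def F2_nonneg)

lemma dual_bound_nonneg: "dual_bound \<ge> 0"
  using X_facts(4) by (simp add: dual_bound_def F1_nonneg G_nonneg)

lemma norm_X_diff: "z \<in> X \<Longrightarrow> z' \<in> X \<Longrightarrow> norm (z - z') \<le> 2 * R"
  using norm_triangle_ineq4[of z z'] norm_X[of z] norm_X[of z'] by simp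

lemma f_lip: "t \<ge> 1 \<Longrightarrow> z \<in> X \<Longrightarrow> z' \<in> X \<Longrightarrow> \<bar>f i t z - f i t z'\<bar> \<le> F2 * norm (z - z')"
  by (rule subgradient_bounded_imp_lipschitz[OF f_subgrad])

lemma g_lip:
  assumes "t \<ge> 1" "k < m i" "z \<in> X" "z' \<in> X"
  shows "\<bar>g i t z k - g i t z' k\<bar> \<le> F2 * norm (z - z')"
proof (rule subgradient_bounded_imp_lipschitz[OF _ assms(3,4)])
  fix x assume "x \<in> X"
  then obtain S where S: "\<forall>k<m i. subgradient_on X (\<lambda>z. g i t z k) x (S k)" "spectral_norm (m i) S \<le> F2"
    using g_subgrad[OF assms(1)] by blast
  then show "\<exists>s. subgradient_on X (\<lambda>z. g i t z k) x s \<and> norm s \<le> F2"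
    using assms(2) norm_le_spectral_norm[OF assms(2), of S] by (auto intro!: exI[of _ "S k"])
qed

lemma viol_lip: "t \<ge> 1 \<Longrightarrow> k < m i \<Longrightarrow> z \<in> X \<Longrightarrow> z' \<in> X \<Longrightarrow> \<bar>viol i t z k - viol i t z' k\<bar> \<le> F2 * norm (z - z')"
  using g_lip[of t k i z z'] unfolding viol_def by linarith

lemma viol_nonneg: "viol i t z k \<ge> 0"
  by (simp add: viol_def)

lemma viol_le:
  assumes "t \<ge> 1" "k < m i" "z \<in> X" shows "viol i t z k \<le> F1"
proof -
  have "\<bar>g i t z k\<bar> \<le> L2_set (\<lambda>k. \<bar>g i t z k\<bar>) {..<m i}"
    using assms(2) by (intro member_le_L2_set) auto
  also have "\<dots> \<le> F1" using g_norm[OF assms(1,3)] by (simp add: L2_set_def)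
  finally show ?thesis using F1_nonneg by (simp add: viol_def)
qed

lemma convex_viol:
  assumes "t \<ge> 1" "k < m i" shows "convex_on X (\<lambda>z. viol i t z k)"
  using convex_g[OF assms] X_facts(1) unfolding convex_on_def viol_def
proof (intro conjI ballI allI impI)
  fix x y and u v :: real
  assume *: "x \<in> X" "y \<in> X" "0 \<le> u" "0 \<le> v" "u + v = 1"
    and "convex X \<and> (\<forall>x\<in>X. \<forall>y\<in>X. \<forall>u\<ge>0. \<forall>v\<ge>0. u + v = 1 \<longrightarrow> g i t (u *\<^sub>R x + v *\<^sub>R y) k \<le> u * g i t x k + v * g i t y k)"
  then have "g i t (u *\<^sub>R x + v *\<^sub>R y) k \<le> u * g i t x k + v * g i t y k" by blast
  also have "\<dots> \<le> u * max 0 (g i t x k) + v * max 0 (g i t y k)"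
    using * by (intro add_mono mult_left_mono) auto
  finally show "max 0 (g i t (u *\<^sub>R x + v *\<^sub>R y) k) \<le> u * max 0 (g i t x k) + v * max 0 (g i t y k)"
    using * by simp
qed auto

lemma Xs: "convex (Xs t)" "closed (Xs t)" "0 \<in> Xs t" "Xs t \<noteq> {}"
  using zero_X X_facts(1,2) by (auto simp: Xs_def intro: convex_scaling closed_scaling)

lemma Xs_subset: "t \<ge> 1 \<Longrightarrow> Xs t \<subseteq> X"
proof
  fix z assume t: "t \<ge> 1" and "z \<in> Xs t"
  then obtain y where y: "y \<in> X" "z = (1 - \<xi> t) *\<^sub>R y" by (auto simp: Xs_def)
  have "(1 - \<xi> t) *\<^sub>R y + \<xi> t *\<^sub>R 0 \<in> X"
    by (rule convexD[OF X_facts(1) y(1) zero_X]) (use \<xi>_bounds[OF t] in auto)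
  then show "z \<in> X" using y(2) by simp
qed

lemma Xs_mono: assumes t: "t \<ge> 1" shows "Xs t \<subseteq> Xs (t + 1)"
proof
  fix z assume "z \<in> Xs t"
  then obtain y where y: "y \<in> X" "z = (1 - \<xi> t) *\<^sub>R y" by (auto simp: Xs_def)
  have \<xi>: "0 < 1 - \<xi> (t + 1)" "1 - \<xi> t \<le> 1 - \<xi> (t + 1)" "0 < 1 - \<xi> t" using \<xi>_bounds \<xi>_mono t by auto
  define c where "c = (1 - \<xi> t) / (1 - \<xi> (t + 1))"
  have c: "0 \<le> c" "c \<le> 1" using \<xi> by (auto simp: c_def)
  have "c *\<^sub>R y + (1 - c) *\<^sub>R 0 \<in> X" by (rule convexD[OF X_facts(1) y(1) zero_X]) (use c in auto)
  moreover have "z = (1 - \<xi> (t + 1)) *\<^sub>R (c *\<^sub>R y)" using \<xi> y(2) by (simp add: c_def)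
  ultimately show "z \<in> Xs (t + 1)" unfolding Xs_def by (intro image_eqI[of _ _ "c *\<^sub>R y"]) auto
qed

text \<open>A point of the ball is a convex combination of a point of \<open>X\<close>, with weight
  \<open>1 - \<xi> t\<close>, and a vector of norm at most \<open>r\<close>, with weight
  \<open>\<xi> t\<close>. This is the purpose of shrinking the domain.\<close>

lemma cball_Xs: assumes t: "t \<ge> 1" and z: "z \<in> Xs t" shows "cball z (\<delta> t) \<subseteq> X"
proof
  fix w assume w: "w \<in> cball z (\<delta> t)"
  obtain y where y: "y \<in> X" "z = (1 - \<xi> t) *\<^sub>R y" using z by (auto simp: Xs_def)
  define v where "v = (w - z) /\<^sub>R \<xi> t"
  have \<xi>: "0 < \<xi> t" "\<xi> t < 1" using \<xi>_bounds[OF t] by auto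
  have "norm (w - z) \<le> r * \<xi> t"
    using w \<delta>_bounds(2)[OF t] by (simp add: dist_norm norm_minus_commute)
  then have "norm (w - z) / \<xi> t \<le> r" using \<xi> by (simp add: pos_divide_le_eq)
  then have "norm v \<le> r" using \<xi> by (simp add: v_def divide_inverse_commute)
  then have "v \<in> X" using X_facts(5) by auto
  then have "(1 - \<xi> t) *\<^sub>R y + \<xi> t *\<^sub>R v \<in> X" using \<xi> y(1) by (intro convexD[OF X_facts(1)]) auto
  moreover have "w = (1 - \<xi> t) *\<^sub>R y + \<xi> t *\<^sub>R v" using \<xi> by (simp add: v_def y(2)[symmetric])
  ultimately show "w \<in> X" by simp
qed

lemma two_point_est_bound:
  assumes t: "t \<ge> 1" and z: "z \<in> Xs t" and u: "norm u = 1"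
    and lip: "\<And>z z'. z \<in> X \<Longrightarrow> z' \<in> X \<Longrightarrow> \<bar>\<phi> z - \<phi> z'\<bar> \<le> F2 * norm (z - z')"
  shows "norm (two_point_est (\<delta> t) \<phi> z u) \<le> G"
proof -
  have \<delta>: "\<delta> t > 0" using \<delta>_bounds[OF t] by simp
  have "z \<in> X" "z + \<delta> t *\<^sub>R u \<in> X" using cball_Xs[OF t z] u \<delta> by (auto simp: subset_iff dist_norm)
  then have "\<bar>\<phi> (z + \<delta> t *\<^sub>R u) - \<phi> z\<bar> \<le> F2 * norm (z + \<delta> t *\<^sub>R u - z)" by (intro lip)
  also have "\<dots> = F2 * \<delta> t" using u \<delta> by simp
  finally have "real CARD('p) / \<delta> t * \<bar>\<phi> (z + \<delta> t *\<^sub>R u) - \<phi> z\<bar> \<le> real CARD('p) / \<delta> t * (F2 * \<delta> t)"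
    using \<delta> by (intro mult_left_mono) auto
  then show ?thesis using u \<delta> by (simp add: two_point_est_def G_def abs_mult)
qed

lemma M_nonneg: "M \<ge> 0" and m_le_M: "real (m i) \<le> M"
  unfolding M_def by (auto intro!: sum_nonneg member_le_sum[of i UNIV "\<lambda>i. real (m i)"])

text \<open>One constant for both disagreement and movement. The agents together move by at most the
  residuals plus \<open>CARD('n)\<close> times the threshold plus \<open>CARD('n)\<close> times the
  disagreement; the consensus estimate contributes \<open>K\<close>, with \<open>2 * R\<close> for
  the initial spread.\<close>

definition move_const :: real where "move_const = 1 + real CARD('n) + real CARD('n) * K * (2 * R + real CARD('n) + 1)"

lemma move_const_nonneg: "move_const \<ge> 0"
  using K_nonneg X_facts(4) by (simp add: move_const_def)

text \<open>\<open>M * G\<close> multiplies the movement in the dual recursion, and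
  \<open>M * F2\<close> the disagreement when a constraint is evaluated at another agent's
  decision.\<close>

definition ccv_const :: real where "ccv_const = M * (G + F2) * move_const"

lemma ccv_const_nonneg: "ccv_const \<ge> 0"
  by (simp add: ccv_const_def M_nonneg G_nonneg F2_nonneg move_const_nonneg)

text \<open>The deterministic right-hand side of the regret bound. \<open>N\<close> times the
  residual norms is traded against squared residuals, which leaves the sum of \<alpha>; the sums of
  \<open>\<tau> / \<alpha>\<close> and \<gamma> are the costs of triggering and of the second-order
  dual drift; the last two terms are the initial distance to the comparator \<open>c\<close> and its
  movement.\<close>

definition err :: "real \<Rightarrow> (nat \<Rightarrow> real^'p) \<Rightarrow> nat \<Rightarrow> real" where
  "err N c T = N * (1 + (\<Sum>t=1..T. \<tau> t)) + N\<^sup>2 * real CARD('n) * (\<Sum>t=1..T. \<alpha> (t + 1))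
      + 3 * R * real CARD('n) * (\<Sum>t=1..T. \<tau> t / \<alpha> (t + 1)) + 2 * dual_bound\<^sup>2 * M * (\<Sum>t=1..T. \<gamma> (t + 1))
      + 2 * R\<^sup>2 * real CARD('n) / \<alpha> (T + 1) + 2 * R * real CARD('n) / \<alpha> (T + 1) * (\<Sum>t=1..T-1. norm (c (t + 1) - c t))"

end

text \<open>The difference of the two sides is the weighted variance around the mean.\<close>

lemma norm_power2_average_le:
  fixes v :: "'n::finite \<Rightarrow> 'a::real_inner"
  assumes "\<And>j. w j \<ge> 0" "(\<Sum>j\<in>UNIV. w j) = 1"
  shows "(norm (\<Sum>j\<in>UNIV. w j *\<^sub>R v j))\<^sup>2 \<le> (\<Sum>j\<in>UNIV. w j * (norm (v j))\<^sup>2)"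
proof -
  let ?y = "\<Sum>j\<in>UNIV. w j *\<^sub>R v j"
  have "0 \<le> (\<Sum>j\<in>UNIV. w j * (norm (v j - ?y))\<^sup>2)" using assms by (intro sum_nonneg) auto
  also have "\<dots> = (\<Sum>j\<in>UNIV. w j * (norm (v j))\<^sup>2 - 2 * (w j * (v j \<bullet> ?y)) + w j * (?y \<bullet> ?y))"
    unfolding power2_norm_eq_inner by (intro sum.cong refl) (simp add: algebra_simps inner_commute)
  also have "\<dots> = (\<Sum>j\<in>UNIV. w j * (norm (v j))\<^sup>2) - 2 * (\<Sum>j\<in>UNIV. w j * (v j \<bullet> ?y)) + (\<Sum>j\<in>UNIV. w j) * (?y \<bullet> ?y)"
    unfolding sum.distrib sum_subtractf sum_distrib_left sum_distrib_right ..
  also have "(\<Sum>j\<in>UNIV. w j * (v j \<bullet> ?y)) = ?y \<bullet> ?y"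
    unfolding inner_sum_left by simp
  finally show ?thesis using assms(2) by (simp add: power2_norm_eq_inner)
qed

locale bandit_run = bandit_setting X f m g r R F1 F2 W K \<alpha> \<beta> \<gamma> \<tau> \<xi> \<delta>
  for X :: "(real^'p::finite) set"
    and f :: "'n::finite \<Rightarrow> nat \<Rightarrow> real^'p \<Rightarrow> real"
    and m g r R F1 F2 W K \<alpha> \<beta> \<gamma> \<tau> \<xi> \<delta> +
  fixes x0 :: "'n \<Rightarrow> real^'p" and u x xh :: "'n \<Rightarrow> nat \<Rightarrow> real^'p" and q :: "'n \<Rightarrow> nat \<Rightarrow> nat \<Rightarrow> real"
  assumes x0: "\<And>i. x0 i \<in> Xs 1"
    and run: "algorithm_run X f m g W \<alpha> \<beta> \<gamma> \<tau> \<xi> \<delta> x0 u x xh q"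
    and u_norm: "\<And>i t. t \<ge> 1 \<Longrightarrow> norm (u i t) = 1"
begin

section \<open>Primal and dual steps of one realisation\<close>

definition loss_est :: "'n \<Rightarrow> nat \<Rightarrow> real^'p" where "loss_est i t = two_point_est (\<delta> t) (f i t) (x i t) (u i t)"
definition viol_est :: "'n \<Rightarrow> nat \<Rightarrow> nat \<Rightarrow> real^'p" where "viol_est i t = pos_part_est (\<delta> t) (g i t) (x i t) (u i t)"
definition mix :: "'n \<Rightarrow> nat \<Rightarrow> real^'p" where "mix i t = (\<Sum>j\<in>UNIV. W t $ i $ j *\<^sub>R xh j t)"
definition direction :: "'n \<Rightarrow> nat \<Rightarrow> real^'p" where "direction i t = loss_est i t + (\<Sum>k<m i. q i t k *\<^sub>R viol_est i t k)"
definition residual :: "'n \<Rightarrow> nat \<Rightarrow> real^'p" where "residual i t = x i (t + 1) - mix i t"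

lemma x_1: "x i 1 = x0 i" and xh_1: "xh i 1 = x i 1" and q_1: "k < m i \<Longrightarrow> q i 1 k = 0"
  using run unfolding algorithm_run_def by auto

lemma
  assumes "t \<ge> 1"
  shows x_step: "x i (t + 1) = closest_point (Xs (t + 1)) (mix i t - \<alpha> (t + 1) *\<^sub>R direction i t)"
    and q_step: "k < m i \<Longrightarrow> q i (t + 1) k = max 0 ((1 - \<beta> (t + 1) * \<gamma> (t + 1)) * q i t k +
                     \<gamma> (t + 1) * (viol i t (x i t) k + viol_est i t k \<bullet> (x i (t + 1) - x i t)))"
    and xh_step: "xh i (t + 1) = (if norm (x i (t + 1) - xh i t) \<ge> \<tau> (t + 1) then x i (t + 1) else xh i t)"
  using run[unfolded algorithm_run_def, THEN conjunct2, rule_format, OF assms, of i]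
  unfolding Let_def Xs_def mix_def direction_def loss_est_def viol_est_def viol_def by blast+

lemma x_in: "t \<ge> 1 \<Longrightarrow> x i t \<in> Xs t"
proof (induction t rule: nat_induct_at_least)
  case base then show ?case by (simp only: x_1 x0)
next
  case (Suc t)
  then show ?case using x_step[OF Suc.hyps, of i] Xs[of "t + 1"] by (simp add: closest_point_in_set)
qed

lemma x_in_X: "t \<ge> 1 \<Longrightarrow> x i t \<in> X"
  using x_in Xs_subset by blast

lemma xh_in_X: "t \<ge> 1 \<Longrightarrow> xh i t \<in> X"
proof (induction t rule: nat_induct_at_least)
  case base then show ?case using x_in_X[of 1 i] xh_1[of i] by simp
next
  case (Suc t)
  then show ?case using xh_step[OF Suc.hyps, of i] x_in_X[of "Suc t" i] by simp
qed

text \<open>Either the decision was broadcast and the error is 0, or the trigger condition failed,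
  which is the bound itself.\<close>

lemma trigger_error: assumes "t \<ge> 1" shows "norm (xh i t - x i t) \<le> \<tau> t"
proof (cases "t = 1")
  case True then show ?thesis using \<tau>_nonneg[of 1] xh_1[of i] by simp
next
  case False
  then obtain s where s: "t = s + 1" "s \<ge> 1" using assms by (cases t) auto
  show ?thesis
    unfolding s(1) xh_step[OF s(2)] using \<tau>_nonneg[of "s + 1"] by (auto simp: norm_minus_commute)
qed

lemma loss_est_bound: "t \<ge> 1 \<Longrightarrow> norm (loss_est i t) \<le> G"
  unfolding loss_est_def by (intro two_point_est_bound x_in u_norm f_lip)

lemma viol_est_bound: "t \<ge> 1 \<Longrightarrow> k < m i \<Longrightarrow> norm (viol_est i t k) \<le> G"
  unfolding viol_est_def pos_part_est_def viol_def[symmetric] by (intro two_point_est_bound x_in u_norm viol_lip)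

lemma viol_est_inner_bound:
  assumes "t \<ge> 1" "k < m i" shows "\<bar>viol_est i t k \<bullet> (x i (t + 1) - x i t)\<bar> \<le> G * norm (x i (t + 1) - x i t)"
  using Cauchy_Schwarz_ineq2[of "viol_est i t k" "x i (t + 1) - x i t"]
    mult_right_mono[OF viol_est_bound[OF assms] norm_ge_zero[of "x i (t + 1) - x i t"]] by linarith

definition dual_input :: "'n \<Rightarrow> nat \<Rightarrow> nat \<Rightarrow> real" where
  "dual_input i t k = viol i t (x i t) k + viol_est i t k \<bullet> (x i (t + 1) - x i t)"

lemma dual_input_bound: assumes "t \<ge> 1" "k < m i" shows "\<bar>dual_input i t k\<bar> \<le> dual_bound"
proof -
  have "G * norm (x i (t + 1) - x i t) \<le> G * (2 * R)"
    using assms by (intro mult_left_mono norm_X_diff x_in_X G_nonneg) auto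
  moreover have "\<bar>dual_input i t k\<bar> \<le> viol i t (x i t) k + \<bar>viol_est i t k \<bullet> (x i (t + 1) - x i t)\<bar>"
    using abs_triangle_ineq[of "viol i t (x i t) k"] viol_nonneg[of i t "x i t" k] by (simp add: dual_input_def)
  moreover have "G * (2 * R) = 2 * R * G" by simp
  ultimately show ?thesis
    using viol_est_inner_bound[OF assms] viol_le[OF assms x_in_X[OF assms(1), of i]] unfolding dual_bound_def by linarith
qed

text \<open>The update is bounded by the combination of \<open>q\<close> and
  \<open>dual_bound / \<beta>\<close> with weights \<open>1 - \<beta> * \<gamma>\<close> and
  \<open>\<beta> * \<gamma>\<close>. The bound persists because \<beta> does not increase.\<close>

lemma q_bounds:
  assumes "t \<ge> 1" "k < m i" shows "0 \<le> q i t k" "q i t k \<le> dual_bound / \<beta> t"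
proof -
  have "0 \<le> q i t k \<and> q i t k \<le> dual_bound / \<beta> t"
    using assms(1)
  proof (induction t rule: nat_induct_at_least)
    case base
    then show ?case using q_1[OF assms(2)] dual_bound_nonneg \<beta>_pos[of 1] by simp
  next
    case (Suc t)
    have b: "0 < \<beta> (t + 1)" "0 < \<gamma> (t + 1)" "\<beta> (t + 1) * \<gamma> (t + 1) \<le> 1" "\<beta> (t + 1) \<le> \<beta> t"
      using \<beta>_pos \<gamma>_pos \<beta>\<gamma> \<beta>_mono Suc.hyps by auto
    have "(1 - \<beta> (t + 1) * \<gamma> (t + 1)) * q i t k + \<gamma> (t + 1) * dual_input i t k
       \<le> (1 - \<beta> (t + 1) * \<gamma> (t + 1)) * (dual_bound / \<beta> (t + 1)) + \<gamma> (t + 1) * dual_bound"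
    proof (intro add_mono mult_left_mono)
      show "q i t k \<le> dual_bound / \<beta> (t + 1)"
        using Suc.IH b dual_bound_nonneg divide_left_mono[of "\<beta> (t + 1)" "\<beta> t" dual_bound] \<beta>_pos[OF Suc.hyps] by fastforce
    qed (use b dual_input_bound[OF Suc.hyps assms(2)] in auto)
    also have "\<dots> = dual_bound / \<beta> (t + 1)" using b by (simp add: field_simps)
    finally show ?case
      using q_step[OF Suc.hyps assms(2)] b dual_bound_nonneg by (simp add: dual_input_def)
  qed
  then show "0 \<le> q i t k" "q i t k \<le> dual_bound / \<beta> t" by auto
qed

text \<open>Clipping at 0 cannot increase the square of \<open>q + \<gamma> * c\<close>. The linear
  term of the expansion yields \<open>q * dual_input\<close> and the regularisation; the quadratic
  term is controlled because the bound on \<open>q\<close> keeps \<open>c\<close> within twice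
  \<open>dual_bound\<close>.\<close>

lemma drift:
  assumes "t \<ge> 1" "k < m i"
  shows "((q i (t + 1) k)\<^sup>2 - (q i t k)\<^sup>2) / (2 * \<gamma> (t + 1)) + \<beta> (t + 1) * (q i t k)\<^sup>2
    \<le> q i t k * dual_input i t k + 2 * dual_bound\<^sup>2 * \<gamma> (t + 1)"
proof -
  have b: "0 < \<beta> (t + 1)" "0 < \<gamma> (t + 1)" "\<beta> (t + 1) \<le> \<beta> t" "0 < \<beta> t"
    using \<beta>_pos \<gamma>_pos \<beta>_mono assms(1) by auto
  define c where "c = dual_input i t k - \<beta> (t + 1) * q i t k"
  have "\<beta> (t + 1) * q i t k \<le> \<beta> t * (dual_bound / \<beta> t)"
    using b q_bounds[OF assms] by (intro mult_mono) auto
  moreover have "0 \<le> \<beta> (t + 1) * q i t k" using b q_bounds[OF assms] by simp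
  ultimately have "\<bar>c\<bar> \<le> 2 * dual_bound" using dual_input_bound[OF assms] b by (auto simp: c_def)
  then have c2: "c\<^sup>2 \<le> 4 * dual_bound\<^sup>2" using power_mono[of "\<bar>c\<bar>" "2 * dual_bound" 2] by (simp add: power_mult_distrib)
  have "q i (t + 1) k = max 0 (q i t k + \<gamma> (t + 1) * c)"
    unfolding q_step[OF assms] c_def dual_input_def by (simp add: algebra_simps)
  then have "(q i (t + 1) k)\<^sup>2 \<le> (q i t k + \<gamma> (t + 1) * c)\<^sup>2"
    by (simp add: max_def)
  also have "\<dots> = (q i t k)\<^sup>2 + 2 * \<gamma> (t + 1) * (q i t k * c) + (\<gamma> (t + 1))\<^sup>2 * c\<^sup>2"
    by (simp add: power2_eq_square algebra_simps)
  also have "\<dots> \<le> (q i t k)\<^sup>2 + 2 * \<gamma> (t + 1) * (q i t k * c) + (\<gamma> (t + 1))\<^sup>2 * (4 * dual_bound\<^sup>2)"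
    using c2 by (intro add_left_mono mult_left_mono) auto
  finally have "((q i (t + 1) k)\<^sup>2 - (q i t k)\<^sup>2) / (2 * \<gamma> (t + 1)) \<le> q i t k * c + 2 * dual_bound\<^sup>2 * \<gamma> (t + 1)"
    using b by (simp add: field_simps power2_eq_square)
  then show ?thesis by (simp add: c_def power2_eq_square algebra_simps)
qed

text \<open>The variational inequality of the projection and the three-point identity. The negative
  squared residual is kept, since it later pays for disagreement and movement.\<close>

lemma projection:
  assumes "t \<ge> 1" "c \<in> Xs (t + 1)"
  shows "direction i t \<bullet> (x i (t + 1) - c) \<le>
    ((norm (mix i t - c))\<^sup>2 - (norm (x i (t + 1) - c))\<^sup>2 - (norm (residual i t))\<^sup>2) / (2 * \<alpha> (t + 1))"
proof -
  have a: "\<alpha> (t + 1) > 0" using \<alpha>_pos assms(1) by simp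
  have "(mix i t - \<alpha> (t + 1) *\<^sub>R direction i t - x i (t + 1)) \<bullet> (c - x i (t + 1)) \<le> 0"
    unfolding x_step[OF assms(1)] by (rule closest_point_dot[OF Xs(1,2) assms(2)])
  then have "2 * \<alpha> (t + 1) * (direction i t \<bullet> (x i (t + 1) - c)) \<le> 2 * ((mix i t - x i (t + 1)) \<bullet> (x i (t + 1) - c))"
    by (simp add: algebra_simps)
  also have "\<dots> = (norm (mix i t - c))\<^sup>2 - (norm (x i (t + 1) - c))\<^sup>2 - (norm (residual i t))\<^sup>2"
    unfolding power2_norm_eq_inner residual_def by (simp add: algebra_simps inner_commute)
  finally show ?thesis using a by (simp add: field_simps)
qed

text \<open>The product of \<open>q\<close> with \<open>viol_est \<bullet> (x (t + 1) - x t)\<close>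
  comes once from the direction and once from the dual input, and cancels. Only the loss estimate
  leaves a movement term, with the bounded coefficient \<open>G\<close>.\<close>

lemma step_bound:
  assumes "t \<ge> 1" "c \<in> Xs (t + 1)"
  shows "direction i t \<bullet> (x i t - c) - (\<Sum>k<m i. q i t k * viol i t (x i t) k)
      + (\<Sum>k<m i. ((q i (t + 1) k)\<^sup>2 - (q i t k)\<^sup>2) / (2 * \<gamma> (t + 1)) + \<beta> (t + 1) * (q i t k)\<^sup>2)
      + (norm (residual i t))\<^sup>2 / (2 * \<alpha> (t + 1))
    \<le> G * norm (x i (t + 1) - x i t) + ((norm (mix i t - c))\<^sup>2 - (norm (x i (t + 1) - c))\<^sup>2) / (2 * \<alpha> (t + 1))
      + 2 * dual_bound\<^sup>2 * \<gamma> (t + 1) * real (m i)"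
proof -
  have "direction i t \<bullet> (x i t - c) = loss_est i t \<bullet> (x i t - x i (t + 1)) - (\<Sum>k<m i. q i t k * (viol_est i t k \<bullet> (x i (t + 1) - x i t))) + direction i t \<bullet> (x i (t + 1) - c)"
    unfolding direction_def by (simp add: algebra_simps inner_sum_left sum_subtractf)
  moreover have "loss_est i t \<bullet> (x i t - x i (t + 1)) \<le> G * norm (x i (t + 1) - x i t)"
    using norm_cauchy_schwarz[of "loss_est i t" "x i t - x i (t + 1)"]
      mult_right_mono[OF loss_est_bound[OF assms(1), of i] norm_ge_zero[of "x i (t + 1) - x i t"]]
    by (simp add: norm_minus_commute)
  moreover have "(\<Sum>k<m i. ((q i (t + 1) k)\<^sup>2 - (q i t k)\<^sup>2) / (2 * \<gamma> (t + 1)) + \<beta> (t + 1) * (q i t k)\<^sup>2)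
      \<le> (\<Sum>k<m i. q i t k * dual_input i t k + 2 * dual_bound\<^sup>2 * \<gamma> (t + 1))"
    by (intro sum_mono drift assms(1)) auto
  moreover have "(\<Sum>k<m i. q i t k * dual_input i t k + 2 * dual_bound\<^sup>2 * \<gamma> (t + 1)) =
      (\<Sum>k<m i. q i t k * viol i t (x i t) k) + (\<Sum>k<m i. q i t k * (viol_est i t k \<bullet> (x i (t + 1) - x i t))) + 2 * dual_bound\<^sup>2 * \<gamma> (t + 1) * real (m i)"
    by (simp add: dual_input_def sum.distrib distrib_left)
  ultimately show ?thesis
    using projection[OF assms, of i] by (simp add: diff_divide_distrib)
qed

text \<open>Convexity of the squared norm handles each row; the column sums of \<open>W\<close> then
  make the total over the agents no larger than that of \<open>xh\<close>. Passing from
  \<open>xh\<close> to \<open>x\<close> costs \<open>4 * R * \<tau> t\<close> per agent, rounded up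
  to \<open>6 * R * \<tau> t\<close>.\<close>

lemma mix_dist:
  assumes "t \<ge> 1" "c \<in> X"
  shows "(\<Sum>i\<in>UNIV. (norm (mix i t - c))\<^sup>2) \<le> (\<Sum>i\<in>UNIV. (norm (x i t - c))\<^sup>2) + 6 * R * real CARD('n) * \<tau> t"
proof -
  have W: "W t $ i $ j \<ge> 0" "(\<Sum>j\<in>UNIV. W t $ i $ j) = 1" "(\<Sum>i\<in>UNIV. W t $ i $ j) = 1" for i j
    using mixing[OF assms(1)] by (auto simp: doubly_stochastic_def)
  have "(norm (mix i t - c))\<^sup>2 \<le> (\<Sum>j\<in>UNIV. W t $ i $ j * (norm (xh j t - c))\<^sup>2)" for i
  proof -
    have "mix i t - c = (\<Sum>j\<in>UNIV. W t $ i $ j *\<^sub>R (xh j t - c))"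
      unfolding mix_def scaleR_diff_right sum_subtractf by (simp add: scaleR_left.sum[symmetric] W)
    then show ?thesis using norm_power2_average_le[of "\<lambda>j. W t $ i $ j" "\<lambda>j. xh j t - c"] W by simp
  qed
  then have "(\<Sum>i\<in>UNIV. (norm (mix i t - c))\<^sup>2) \<le> (\<Sum>i\<in>UNIV. \<Sum>j\<in>UNIV. W t $ i $ j * (norm (xh j t - c))\<^sup>2)"
    by (rule sum_mono)
  also have "\<dots> = (\<Sum>j\<in>UNIV. (norm (xh j t - c))\<^sup>2)"
    by (subst sum.swap) (simp add: sum_distrib_right[symmetric] W)
  also have "\<dots> \<le> (\<Sum>j\<in>UNIV. (norm (x j t - c))\<^sup>2 + 6 * R * \<tau> t)"
  proof (rule sum_mono)
    fix j
    define a b where "a = norm (xh j t - c)" and "b = norm (x j t - c)"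
    have ab: "a - b \<le> \<tau> t" "0 \<le> a" "0 \<le> b" "a \<le> 2 * R" "b \<le> 2 * R"
      using norm_triangle_ineq2[of "xh j t - c" "x j t - c"] trigger_error[OF assms(1), of j]
        norm_X_diff[OF xh_in_X[OF assms(1)] assms(2)] norm_X_diff[OF x_in_X[OF assms(1)] assms(2)]
      by (auto simp: a_def b_def intro: order_trans)
    have "a\<^sup>2 - b\<^sup>2 = (a - b) * (a + b)" by (simp add: power2_eq_square algebra_simps)
    also have "\<dots> \<le> \<tau> t * (4 * R)"
      using ab \<tau>_nonneg[OF assms(1)] by (intro mult_mono) auto
    also have "\<dots> \<le> \<tau> t * (6 * R)" using \<tau>_nonneg[OF assms(1)] X_facts(4) by (intro mult_left_mono) auto
    finally show "(norm (xh j t - c))\<^sup>2 \<le> (norm (x j t - c))\<^sup>2 + 6 * R * \<tau> t"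
      by (simp add: a_def b_def mult.commute)
  qed
  finally show ?thesis by (simp add: sum.distrib algebra_simps)
qed

section \<open>Summation over agents and time\<close>

definition dual_sq :: "nat \<Rightarrow> real" where "dual_sq t = (\<Sum>i\<in>UNIV. \<Sum>k<m i. (q i t k)\<^sup>2)"
text \<open>The linearised regret minus the part of the dual drift that convexity is going to match:
  for a comparator without violation the two constraint terms cancel in expectation, up to
  \<open>bias\<close>.\<close>

definition gap :: "(nat \<Rightarrow> real^'p) \<Rightarrow> nat \<Rightarrow> real" where
  "gap c t = (\<Sum>i\<in>UNIV. direction i t \<bullet> (x i t - c t) - (\<Sum>k<m i. q i t k * viol i t (x i t) k))"
definition residual_sq :: "nat \<Rightarrow> real" where "residual_sq t = (\<Sum>i\<in>UNIV. (norm (residual i t))\<^sup>2)"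
definition move :: "nat \<Rightarrow> real" where "move t = (\<Sum>i\<in>UNIV. norm (x i (t + 1) - x i t))"
definition disagreement :: "nat \<Rightarrow> real" where "disagreement t = spread (\<lambda>i. x i t)"

lemma step_bound_sum:
  assumes t: "t \<ge> 1" and c: "c t \<in> Xs t"
  shows "gap c t + ((dual_sq (t + 1) - dual_sq t) / (2 * \<gamma> (t + 1)) + \<beta> (t + 1) * dual_sq t) + residual_sq t / (2 * \<alpha> (t + 1))
    \<le> G * move t + 1 / (2 * \<alpha> (t + 1)) * ((\<Sum>i\<in>UNIV. (norm (x i t - c t))\<^sup>2) - (\<Sum>i\<in>UNIV. (norm (x i (t + 1) - c t))\<^sup>2))
      + 3 * R * real CARD('n) * (\<tau> t / \<alpha> (t + 1)) + 2 * dual_bound\<^sup>2 * M * \<gamma> (t + 1)"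
proof -
  have \<alpha>: "\<alpha> (t + 1) > 0" using \<alpha>_pos by simp
  have c': "c t \<in> Xs (t + 1)" "c t \<in> X" using c Xs_mono[OF t] Xs_subset[OF t] by auto
  have "(\<Sum>i\<in>UNIV. direction i t \<bullet> (x i t - c t) - (\<Sum>k<m i. q i t k * viol i t (x i t) k)
      + (\<Sum>k<m i. ((q i (t + 1) k)\<^sup>2 - (q i t k)\<^sup>2) / (2 * \<gamma> (t + 1)) + \<beta> (t + 1) * (q i t k)\<^sup>2)
      + (norm (residual i t))\<^sup>2 / (2 * \<alpha> (t + 1)))
    \<le> (\<Sum>i\<in>UNIV. G * norm (x i (t + 1) - x i t) + ((norm (mix i t - c t))\<^sup>2 - (norm (x i (t + 1) - c t))\<^sup>2) / (2 * \<alpha> (t + 1))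
      + 2 * dual_bound\<^sup>2 * \<gamma> (t + 1) * real (m i))"
    by (intro sum_mono step_bound t c')
  also have "\<dots> = G * move t + ((\<Sum>i\<in>UNIV. (norm (mix i t - c t))\<^sup>2) - (\<Sum>i\<in>UNIV. (norm (x i (t + 1) - c t))\<^sup>2)) / (2 * \<alpha> (t + 1))
      + 2 * dual_bound\<^sup>2 * \<gamma> (t + 1) * M"
    by (simp add: move_def M_def sum.distrib sum_distrib_left sum_divide_distrib sum_subtractf diff_divide_distrib)
  also have "\<dots> \<le> G * move t + ((\<Sum>i\<in>UNIV. (norm (x i t - c t))\<^sup>2) + 6 * R * real CARD('n) * \<tau> t - (\<Sum>i\<in>UNIV. (norm (x i (t + 1) - c t))\<^sup>2)) / (2 * \<alpha> (t + 1))
      + 2 * dual_bound\<^sup>2 * \<gamma> (t + 1) * M"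
    using mix_dist[OF t c'(2)] \<alpha> by (intro add_mono divide_right_mono) auto
  also have "\<dots> = G * move t + 1 / (2 * \<alpha> (t + 1)) * ((\<Sum>i\<in>UNIV. (norm (x i t - c t))\<^sup>2) - (\<Sum>i\<in>UNIV. (norm (x i (t + 1) - c t))\<^sup>2))
      + 3 * R * real CARD('n) * (\<tau> t / \<alpha> (t + 1)) + 2 * dual_bound\<^sup>2 * M * \<gamma> (t + 1)"
    by (simp add: add_divide_distrib diff_divide_distrib right_diff_distrib)
  finally show ?thesis
    by (simp add: gap_def dual_sq_def residual_sq_def sum.distrib sum_subtractf sum_divide_distrib sum_distrib_left diff_divide_distrib)
qed

lemma inverse_\<alpha>_mono:
  assumes "1 \<le> s" "s \<le> t" shows "1 / \<alpha> s \<le> 1 / \<alpha> t"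
  using assms(2)
proof (induction rule: dec_induct)
  case (step j)
  then have "1 / \<alpha> j \<le> 1 / \<alpha> (j + 1)"
    using \<alpha>_pos[of j] \<alpha>_pos[of "j + 1"] \<alpha>_mono[of j] assms(1) by (intro divide_left_mono) auto
  then show ?case using step by simp
qed simp

text \<open>The weights \<open>1 / (2 * \<alpha> (t + 1))\<close> increase, so the squared distances
  are summed by parts; the movement of the comparator is charged with the last and largest
  weight.\<close>

lemma regret_sum:
  assumes T: "T \<ge> 1" and c: "\<And>t. 1 \<le> t \<Longrightarrow> t \<le> T \<Longrightarrow> c t \<in> Xs t"
  shows "(\<Sum>t=1..T. gap c t) + dual_sq (T + 1) / (2 * \<gamma> (T + 1)) + (\<Sum>t=1..T. \<beta> (t + 1) * dual_sq t) / 2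
      + (\<Sum>t=1..T. residual_sq t / (2 * \<alpha> (t + 1)))
    \<le> G * (\<Sum>t=1..T. move t) + 3 * R * real CARD('n) * (\<Sum>t=1..T. \<tau> t / \<alpha> (t + 1)) + 2 * dual_bound\<^sup>2 * M * (\<Sum>t=1..T. \<gamma> (t + 1))
      + 2 * R\<^sup>2 * real CARD('n) / \<alpha> (T + 1) + 2 * R * real CARD('n) / \<alpha> (T + 1) * (\<Sum>t=1..T-1. norm (c (t + 1) - c t))"
proof -
  define a b where "a t = (\<Sum>i\<in>UNIV. (norm (x i t - c t))\<^sup>2)" and "b t = (\<Sum>i\<in>UNIV. (norm (x i (t + 1) - c t))\<^sup>2)" for t
  define w where "w t = 1 / (2 * \<alpha> (t + 1))" for t
  \<comment> \<open>For distances of at most \<open>2 * R\<close>, a displacement of the comparator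
    changes the square by at most \<open>4 * R\<close> times its length.\<close>
  define d where "d t = 4 * R * real CARD('n) * norm (c (t + 1) - c t)" for t
  define N where "N = 4 * R\<^sup>2 * real CARD('n)"
  have cX: "c t \<in> X" if "1 \<le> t" "t \<le> T" for t using c[OF that] Xs_subset that by blast
  have sq: "(norm (z - z'))\<^sup>2 \<le> 4 * R\<^sup>2" if "z \<in> X" "z' \<in> X" for z z'
    using power_mono[OF norm_X_diff[OF that], of 2] by (simp add: power_mult_distrib)
  have aM: "a t \<le> N" and bM: "b t \<le> N" if "1 \<le> t" "t \<le> T" for t
    using sum_bounded_above[of UNIV "\<lambda>i. (norm (x i t - c t))\<^sup>2" "4 * R\<^sup>2"]
      sum_bounded_above[of UNIV "\<lambda>i. (norm (x i (t + 1) - c t))\<^sup>2" "4 * R\<^sup>2"]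
      sq[OF x_in_X cX[OF that]] that by (simp_all add: a_def b_def N_def mult.commute)
  have ab: "a (t + 1) \<le> b t + d t" if "1 \<le> t" "t < T" for t
  proof -
    have "a (t + 1) \<le> (\<Sum>i\<in>UNIV. (norm (x i (t + 1) - c t))\<^sup>2 + 4 * R * norm (c (t + 1) - c t))"
      unfolding a_def
    proof (rule sum_mono)
      fix i
      define p p' where "p = norm (x i (t + 1) - c (t + 1))" and "p' = norm (x i (t + 1) - c t)"
      have 1: "p \<le> 2 * R" "p' \<le> 2 * R" "0 \<le> p" "0 \<le> p'" unfolding p_def p'_def
        using that by (auto intro!: norm_X_diff x_in_X cX)
      have 2: "p - p' \<le> norm (c (t + 1) - c t)"
        using norm_triangle_ineq2[of "x i (t + 1) - c (t + 1)" "x i (t + 1) - c t"]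
        by (simp add: p_def p'_def norm_minus_commute)
      have "p\<^sup>2 - p'\<^sup>2 = (p - p') * (p + p')" by (simp add: power2_eq_square algebra_simps)
      also have "\<dots> \<le> norm (c (t + 1) - c t) * (4 * R)"
        using 1 2 by (intro mult_mono) auto
      finally show "(norm (x i (t + 1) - c (t + 1)))\<^sup>2 \<le> (norm (x i (t + 1) - c t))\<^sup>2 + 4 * R * norm (c (t + 1) - c t)"
        by (simp add: p_def p'_def mult.commute)
    qed
    then show ?thesis by (simp add: b_def d_def sum.distrib mult_ac)
  qed
  have w0: "w t \<ge> 0" for t using \<alpha>_pos[of "t + 1"] by (simp add: w_def)
  have wm: "w s \<le> w t" if "s \<le> t" for s t
    using inverse_\<alpha>_mono[of "s + 1" "t + 1"] that by (simp add: w_def)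
  have "(\<Sum>t=1..T. w t * (a t - b t)) \<le> w T * (N - b T) + (\<Sum>t=1..T-1. w (t + 1) * d t)"
    by (rule sum_telescope_weighted_le[where w=w and a=a and b=b and d=d, OF T]) (use w0 wm aM bM ab in auto)
  also have "w T * (N - b T) \<le> w T * N"
    using w0[of T] by (intro mult_left_mono) (auto simp: b_def sum_nonneg)
  also have "(\<Sum>t=1..T-1. w (t + 1) * d t) \<le> (\<Sum>t=1..T-1. w T * d t)"
    using X_facts(4) by (intro sum_mono mult_right_mono wm) (auto simp: d_def)
  finally have tele: "(\<Sum>t=1..T. w t * (a t - b t)) \<le> 2 * R\<^sup>2 * real CARD('n) / \<alpha> (T + 1)
      + 2 * R * real CARD('n) / \<alpha> (T + 1) * (\<Sum>t=1..T-1. norm (c (t + 1) - c t))"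
    by (simp add: w_def d_def N_def sum_distrib_left mult_ac)
  have Q1: "dual_sq 1 = 0" by (simp add: dual_sq_def q_1[simplified])
  have Q0: "dual_sq t \<ge> 0" for t by (simp add: dual_sq_def sum_nonneg)
  have "(\<Sum>t=1..T. gap c t + ((dual_sq (t + 1) - dual_sq t) / (2 * \<gamma> (t + 1)) + \<beta> (t + 1) * dual_sq t) + residual_sq t / (2 * \<alpha> (t + 1)))
    \<le> (\<Sum>t=1..T. G * move t + w t * (a t - b t) + 3 * R * real CARD('n) * (\<tau> t / \<alpha> (t + 1)) + 2 * dual_bound\<^sup>2 * M * \<gamma> (t + 1))"
    unfolding w_def a_def b_def by (intro sum_mono step_bound_sum c) auto
  then have "(\<Sum>t=1..T. gap c t) + (\<Sum>t=1..T. (dual_sq (t + 1) - dual_sq t) / (2 * \<gamma> (t + 1)) + \<beta> (t + 1) * dual_sq t) + (\<Sum>t=1..T. residual_sq t / (2 * \<alpha> (t + 1)))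
    \<le> G * (\<Sum>t=1..T. move t) + (\<Sum>t=1..T. w t * (a t - b t)) + 3 * R * real CARD('n) * (\<Sum>t=1..T. \<tau> t / \<alpha> (t + 1)) + 2 * dual_bound\<^sup>2 * M * (\<Sum>t=1..T. \<gamma> (t + 1))"
    by (simp only: sum.distrib sum_distrib_left)
  then show ?thesis
    using tele sum_drift_weighted_ge[of dual_sq \<gamma> \<beta> T, OF Q0 Q1 \<gamma>_step] by linarith
qed

text \<open>The decisions themselves follow the consensus recursion; the perturbation consists of
  the averaged trigger errors and the residual. The movement is then bounded through the triangle
  inequality by residual, threshold and disagreement.\<close>

lemma disagreement_move_sums:
  defines "tot T \<equiv> 1 + (\<Sum>t=1..T. \<tau> t) + (\<Sum>t=1..T. \<Sum>i\<in>UNIV. norm (residual i t))"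
  shows "(\<Sum>t=1..T. disagreement t) \<le> move_const * tot T" "(\<Sum>t=1..T. move t) \<le> move_const * tot T"
proof -
  define n where "n = real CARD('n)"
  have n: "n \<ge> 1" by (simp add: n_def Suc_leI)
  define Ta D where "Ta = (\<Sum>t=1..T. \<tau> t)" and "D = (\<Sum>t=1..T. \<Sum>i\<in>UNIV. norm (residual i t))"
  have Ta0: "Ta \<ge> 0" and D0: "D \<ge> 0" unfolding Ta_def D_def by (auto intro!: sum_nonneg \<tau>_nonneg)
  define e where "e t i = (\<Sum>j\<in>UNIV. W t $ i $ j *\<^sub>R (xh j t - x j t)) + residual i t" for t i
  have avg: "norm (\<Sum>j\<in>UNIV. W t $ i $ j *\<^sub>R v j) \<le> b" if "t \<ge> 1" "\<And>j. norm (v j) \<le> b" for t i b and v :: "'n \<Rightarrow> real^'p"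
    by (rule norm_average_le[OF doubly_stochastic_row[OF mixing[OF that(1)]] that(2)])
  have W1: "(\<Sum>j\<in>UNIV. W t $ i $ j) = 1" if "t \<ge> 1" for t i
    using mixing[OF that] by (auto simp: doubly_stochastic_def)
  have "perturbed_consensus W (\<lambda>t i. x i t) e"
    unfolding perturbed_consensus_def e_def residual_def mix_def by (simp add: scaleR_diff_right sum_subtractf)
  from consensus[OF this, of T]
  have "(\<Sum>t=1..T. disagreement t) \<le> K * (spread (\<lambda>i. x i 1) + (\<Sum>t=1..T. \<Sum>i\<in>UNIV. norm (e t i)))"
    by (simp add: disagreement_def)
  also have "\<dots> \<le> K * (2 * R + (\<Sum>t=1..T. \<Sum>i\<in>UNIV. \<tau> t + norm (residual i t)))"
  proof (intro mult_left_mono add_mono sum_mono K_nonneg)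
    show "spread (\<lambda>i. x i 1) \<le> 2 * R" by (rule spread_le) (auto intro!: norm_X_diff x_in_X)
    show "norm (e t i) \<le> \<tau> t + norm (residual i t)" if "t \<in> {1..T}" for t i
      unfolding e_def using that by (intro norm_triangle_mono avg trigger_error order_refl) auto
  qed
  also have "(\<Sum>t=1..T. \<Sum>i\<in>UNIV. \<tau> t + norm (residual i t)) = n * Ta + D"
    by (simp add: sum.distrib Ta_def D_def n_def sum_distrib_left)
  finally have dis: "(\<Sum>t=1..T. disagreement t) \<le> K * (2 * R + n * Ta + D)" by (simp add: add.assoc)
  have mv: "move t \<le> (\<Sum>i\<in>UNIV. norm (residual i t)) + n * \<tau> t + n * disagreement t" if t: "t \<ge> 1" for t
  proof -
    have "norm (x i (t + 1) - x i t) \<le> norm (residual i t) + (\<tau> t + disagreement t)" for i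
    proof -
      have "mix i t - x i t = (\<Sum>j\<in>UNIV. W t $ i $ j *\<^sub>R (xh j t - x i t))"
        unfolding mix_def scaleR_diff_right sum_subtractf by (simp add: scaleR_left.sum[symmetric] W1[OF t])
      moreover have "norm (\<Sum>j\<in>UNIV. W t $ i $ j *\<^sub>R (xh j t - x i t)) \<le> \<tau> t + disagreement t"
      proof (rule avg[OF t])
        fix j
        have "norm (xh j t - x i t) \<le> norm (xh j t - x j t) + norm (x j t - x i t)"
          using norm_triangle_ineq[of "xh j t - x j t" "x j t - x i t"] by simp
        then show "norm (xh j t - x i t) \<le> \<tau> t + disagreement t"
          using trigger_error[OF t, of j] norm_diff_le_spread[of "\<lambda>i. x i t" j i] unfolding disagreement_def by linarith
      qed
      moreover have "norm (x i (t + 1) - x i t) \<le> norm (residual i t) + norm (mix i t - x i t)"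
        using norm_triangle_ineq[of "residual i t" "mix i t - x i t"] by (simp add: residual_def)
      ultimately show ?thesis by simp
    qed
    then have "move t \<le> (\<Sum>i\<in>UNIV. norm (residual i t) + (\<tau> t + disagreement t))"
      unfolding move_def by (rule sum_mono)
    then show ?thesis by (simp add: sum.distrib n_def algebra_simps)
  qed
  have "(\<Sum>t=1..T. move t) \<le> (\<Sum>t=1..T. (\<Sum>i\<in>UNIV. norm (residual i t)) + n * \<tau> t + n * disagreement t)"
    by (intro sum_mono mv) auto
  also have "\<dots> = D + n * Ta + n * (\<Sum>t=1..T. disagreement t)"
    by (simp add: sum.distrib D_def Ta_def sum_distrib_left)
  also have "\<dots> \<le> D + n * Ta + n * (K * (2 * R + n * Ta + D))"
    using dis n by (intro add_left_mono mult_left_mono) auto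
  finally have mov: "(\<Sum>t=1..T. move t) \<le> D + n * Ta + n * (K * (2 * R + n * Ta + D))" .
  have base: "2 * R + n * Ta + D \<le> (2 * R + n + 1) * tot T"
  proof -
    have "tot T = 1 + Ta + D" by (simp add: tot_def Ta_def D_def)
    moreover have "0 \<le> 2 * R * Ta + 2 * R * D + n + n * D + 1 + Ta"
      using Ta0 D0 n X_facts(4) by (intro add_nonneg_nonneg mult_nonneg_nonneg) auto
    ultimately show ?thesis by (simp add: algebra_simps)
  qed
  have tot: "tot T = 1 + Ta + D" by (simp add: tot_def Ta_def D_def)
  have t0: "tot T \<ge> 0" using tot Ta0 D0 by simp
  have kb: "K * (2 * R + n * Ta + D) \<le> K * ((2 * R + n + 1) * tot T)" by (rule mult_left_mono[OF base K_nonneg])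
  have K0: "0 \<le> K * ((2 * R + n + 1) * tot T)" using K_nonneg n X_facts(4) t0 by (intro mult_nonneg_nonneg) auto
  then have kn: "K * ((2 * R + n + 1) * tot T) \<le> n * (K * ((2 * R + n + 1) * tot T))"
    using mult_right_mono[OF n] by simp
  have move_const: "move_const * tot T = tot T + n * tot T + n * (K * ((2 * R + n + 1) * tot T))"
    by (simp add: move_const_def n_def[symmetric] algebra_simps)
  have nt: "n * tot T \<ge> 0" using n t0 by simp
  show "(\<Sum>t=1..T. disagreement t) \<le> move_const * tot T"
    using dis kb kn t0 nt unfolding move_const by linarith
  have "D + n * Ta \<le> tot T + n * tot T"
    using Ta0 D0 n mult_nonneg_nonneg[of n D] by (simp add: tot algebra_simps)
  moreover have "n * (K * (2 * R + n * Ta + D)) \<le> n * (K * ((2 * R + n + 1) * tot T))"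
    by (rule mult_left_mono[OF kb]) (use n in simp)
  ultimately show "(\<Sum>t=1..T. move t) \<le> move_const * tot T"
    using mov unfolding move_const by linarith
qed

text \<open>The dual terms of \<open>regret_sum\<close> in full, but only half of its residual term:
  the other half is spent on disagreement and movement.\<close>

definition energy :: "nat \<Rightarrow> real" where
  "energy T = dual_sq (T + 1) / (2 * \<gamma> (T + 1)) + (\<Sum>t=1..T. \<beta> (t + 1) * dual_sq t) / 2 + (\<Sum>t=1..T. residual_sq t / (4 * \<alpha> (t + 1)))"

text \<open>\<open>H\<close> is left free so that the disagreement caused by evaluating losses at
  other agents can be paid here as well.\<close>

lemma regret_run:
  assumes T: "T \<ge> 1" and c: "\<And>t. 1 \<le> t \<Longrightarrow> t \<le> T \<Longrightarrow> c t \<in> Xs t" and H: "H \<ge> 0"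
  shows "(\<Sum>t=1..T. gap c t) + H * (\<Sum>t=1..T. disagreement t) + energy T \<le> err ((G + H) * move_const) c T"
proof -
  define N where "N = (G + H) * move_const"
  have "G * (\<Sum>t=1..T. move t) + H * (\<Sum>t=1..T. disagreement t) \<le>
     N * (1 + (\<Sum>t=1..T. \<tau> t)) + N * (\<Sum>t=1..T. \<Sum>i\<in>UNIV. norm (residual i t))"
    using mult_left_mono[OF disagreement_move_sums(2)[of T] G_nonneg] mult_left_mono[OF disagreement_move_sums(1)[of T] H]
    by (simp add: N_def algebra_simps)
  also have "N * (\<Sum>t=1..T. \<Sum>i\<in>UNIV. norm (residual i t)) \<le> (\<Sum>t=1..T. \<Sum>i\<in>UNIV. (norm (residual i t))\<^sup>2 / (4 * \<alpha> (t + 1)) + N\<^sup>2 * \<alpha> (t + 1))"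
    unfolding sum_distrib_left
  proof (intro sum_mono)
    fix t i
    show "N * norm (residual i t) \<le> (norm (residual i t))\<^sup>2 / (4 * \<alpha> (t + 1)) + N\<^sup>2 * \<alpha> (t + 1)"
      using am_gm_weighted[of "\<alpha> (t + 1)" "norm (residual i t)" N] \<alpha>_pos[of "t + 1"] by (simp add: mult.commute)
  qed
  also have "\<dots> = (\<Sum>t=1..T. residual_sq t / (4 * \<alpha> (t + 1))) + N\<^sup>2 * real CARD('n) * (\<Sum>t=1..T. \<alpha> (t + 1))"
    by (simp add: sum.distrib residual_sq_def sum_divide_distrib sum_distrib_left mult_ac)
  finally have "G * (\<Sum>t=1..T. move t) + H * (\<Sum>t=1..T. disagreement t) \<le> N * (1 + (\<Sum>t=1..T. \<tau> t)) +
     (\<Sum>t=1..T. residual_sq t / (4 * \<alpha> (t + 1))) + N\<^sup>2 * real CARD('n) * (\<Sum>t=1..T. \<alpha> (t + 1))" by simp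
  moreover have "(\<Sum>t=1..T. residual_sq t / (2 * \<alpha> (t + 1))) = (\<Sum>t=1..T. residual_sq t / (4 * \<alpha> (t + 1))) + (\<Sum>t=1..T. residual_sq t / (4 * \<alpha> (t + 1)))"
    unfolding sum.distrib[symmetric] by (intro sum.cong refl) simp
  ultimately show ?thesis
    using regret_sum[OF T c] unfolding err_def energy_def N_def[symmetric] by linarith
qed

lemma energy_nonneg: "energy T \<ge> 0"
  unfolding energy_def dual_sq_def residual_sq_def
  using \<alpha>_pos[THEN less_imp_le] \<beta>_pos[THEN less_imp_le] \<gamma>_pos[THEN less_imp_le]
  by (intro add_nonneg_nonneg divide_nonneg_nonneg sum_nonneg mult_nonneg_nonneg) auto

definition dual_sum :: "nat \<Rightarrow> real" where "dual_sum t = (\<Sum>i\<in>UNIV. \<Sum>k<m i. q i t k)"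

text \<open>Dropping the maximum in the dual update bounds the new dual variable from below; the
  inequality is then solved for the violation.\<close>

lemma viol_sum_step:
  assumes t: "t \<ge> 1"
  shows "(\<Sum>i\<in>UNIV. \<Sum>k<m i. viol i t (x i t) k)
    \<le> (dual_sum (t + 1) - dual_sum t) / \<gamma> (t + 1) + \<beta> (t + 1) * dual_sum t + G * M * move t"
proof -
  have \<gamma>: "\<gamma> (t + 1) > 0" using \<gamma>_pos by simp
  have "viol i t (x i t) k \<le> (q i (t + 1) k - q i t k) / \<gamma> (t + 1) + \<beta> (t + 1) * q i t k + G * norm (x i (t + 1) - x i t)"
    if "k < m i" for i k
  proof -
    have "q i t k + \<gamma> (t + 1) * (viol i t (x i t) k + viol_est i t k \<bullet> (x i (t + 1) - x i t) - \<beta> (t + 1) * q i t k) \<le> q i (t + 1) k"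
      unfolding q_step[OF t that] by (simp add: algebra_simps)
    then have "viol i t (x i t) k + viol_est i t k \<bullet> (x i (t + 1) - x i t) - \<beta> (t + 1) * q i t k \<le> (q i (t + 1) k - q i t k) / \<gamma> (t + 1)"
      using \<gamma> by (simp add: pos_le_divide_eq mult.commute)
    then show ?thesis using viol_est_inner_bound[OF t that] by (simp add: abs_le_iff)
  qed
  then have "(\<Sum>i\<in>UNIV. \<Sum>k<m i. viol i t (x i t) k) \<le>
     (\<Sum>i\<in>UNIV. \<Sum>k<m i. (q i (t + 1) k - q i t k) / \<gamma> (t + 1) + \<beta> (t + 1) * q i t k + G * norm (x i (t + 1) - x i t))"
    by (intro sum_mono) auto
  also have "\<dots> = (dual_sum (t + 1) - dual_sum t) / \<gamma> (t + 1) + \<beta> (t + 1) * dual_sum t + (\<Sum>i\<in>UNIV. real (m i) * (G * norm (x i (t + 1) - x i t)))"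
    by (simp add: dual_sum_def sum.distrib sum_subtractf sum_divide_distrib sum_distrib_left diff_divide_distrib)
  also have "(\<Sum>i\<in>UNIV. real (m i) * (G * norm (x i (t + 1) - x i t))) \<le> (\<Sum>i\<in>UNIV. M * (G * norm (x i (t + 1) - x i t)))"
    by (intro sum_mono mult_right_mono m_le_M mult_nonneg_nonneg G_nonneg) auto
  also have "\<dots> = G * M * move t" by (simp add: move_def sum_distrib_left mult_ac)
  finally show ?thesis by simp
qed

text \<open>The Euclidean norm is at most the sum of the entries, and each constraint is moved to
  the decision of its own agent by Lipschitz continuity.\<close>

lemma global_violation_le:
  assumes t: "t \<ge> 1"
  shows "global_violation m g t (x i t) \<le> (\<Sum>j\<in>UNIV. \<Sum>k<m j. viol j t (x j t) k) + M * F2 * disagreement t"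
proof -
  have "global_violation m g t (x i t) \<le> (\<Sum>(j, k)\<in>(SIGMA j:UNIV. {..<m j}). viol j t (x i t) k)"
    unfolding global_violation_def viol_def by (rule order_trans[OF L2_set_le_sum]) auto
  also have "\<dots> = (\<Sum>j\<in>UNIV. \<Sum>k<m j. viol j t (x i t) k)"
    by (subst sum.Sigma) auto
  also have "\<dots> \<le> (\<Sum>j\<in>UNIV. \<Sum>k<m j. viol j t (x j t) k + F2 * disagreement t)"
  proof (intro sum_mono)
    fix j k assume k: "k \<in> {..<m j}"
    have "F2 * norm (x i t - x j t) \<le> F2 * disagreement t"
      unfolding disagreement_def by (intro mult_left_mono F2_nonneg norm_diff_le_spread[of "\<lambda>i. x i t"])
    then show "viol j t (x i t) k \<le> viol j t (x j t) k + F2 * disagreement t"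
      using viol_lip[OF t _ x_in_X[OF t] x_in_X[OF t], of k j i j] k by auto
  qed
  finally show ?thesis by (simp add: sum.distrib M_def sum_distrib_right mult.assoc)
qed

text \<open>
  \<open>\<nu>\<close> and \<open>\<mu>\<close> are weights in the arithmetic-geometric mean inequality; being deterministic, they let
  the bound be integrated without Jensen's inequality.
\<close>

lemma ccv_run:
  assumes pos: "\<nu> > 0" "\<mu> > 0"
  shows "net_ccv m g T x \<le> M * \<nu> / 2 * (1 / \<gamma> (T + 1) + (\<Sum>t=1..T. \<beta> (t + 1)))
     + ccv_const * (1 + (\<Sum>t=1..T. \<tau> t)) + ccv_const * real CARD('n) * \<mu> * (\<Sum>t=1..T. \<alpha> (t + 1))
     + (1 / \<nu> + ccv_const / \<mu>) * energy T"
proof -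
  define S where "S = (\<Sum>t=1..T. \<Sum>j\<in>UNIV. \<Sum>k<m j. viol j t (x j t) k)"
  have dual_sum0: "dual_sum t \<ge> 0" if "t \<ge> 1" for t
    unfolding dual_sum_def using that by (auto intro!: sum_nonneg q_bounds)
  have dual_sum1: "dual_sum 1 = 0" by (simp add: dual_sum_def q_1[simplified])
  have dual_sumle: "dual_sum t \<le> M * \<nu> / 2 + dual_sq t / (2 * \<nu>)" for t
  proof -
    have "dual_sum t \<le> (\<Sum>i\<in>UNIV. \<Sum>k<m i. (q i t k)\<^sup>2 / (2 * \<nu>) + \<nu> / 2)"
      unfolding dual_sum_def
    proof (intro sum_mono)
      fix i k show "q i t k \<le> (q i t k)\<^sup>2 / (2 * \<nu>) + \<nu> / 2"
        using am_gm_weighted[of "\<nu> / 2" "q i t k" 1] pos by simp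
    qed
    then show ?thesis by (simp add: dual_sq_def M_def sum.distrib sum_divide_distrib sum_distrib_right)
  qed
  have "1 / \<gamma> t \<le> 1 / \<gamma> (t + 1)" if "t \<ge> 1" for t
    using \<gamma>_pos[of t] \<gamma>_pos[of "t + 1"] \<gamma>_mono[of t] that by (intro divide_left_mono) auto
  then have tele: "(\<Sum>t=1..T. (dual_sum (t + 1) - dual_sum t) / \<gamma> (t + 1)) \<le> dual_sum (T + 1) / \<gamma> (T + 1)"
    using sum_increments_weighted_le[of dual_sum, OF dual_sum0 dual_sum1] by blast
  have "S \<le> (\<Sum>t=1..T. (dual_sum (t + 1) - dual_sum t) / \<gamma> (t + 1) + \<beta> (t + 1) * dual_sum t + G * M * move t)"
    unfolding S_def by (intro sum_mono viol_sum_step) auto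
  also have "\<dots> \<le> dual_sum (T + 1) / \<gamma> (T + 1) + (\<Sum>t=1..T. \<beta> (t + 1) * dual_sum t) + G * M * (\<Sum>t=1..T. move t)"
    using tele by (simp add: sum.distrib sum_distrib_left)
  also have "dual_sum (T + 1) / \<gamma> (T + 1) \<le> (M * \<nu> / 2 + dual_sq (T + 1) / (2 * \<nu>)) / \<gamma> (T + 1)"
    using \<gamma>_pos[of "T + 1"] by (intro divide_right_mono dual_sumle) auto
  also have "(\<Sum>t=1..T. \<beta> (t + 1) * dual_sum t) \<le> (\<Sum>t=1..T. \<beta> (t + 1) * (M * \<nu> / 2 + dual_sq t / (2 * \<nu>)))"
    using \<beta>_pos by (intro sum_mono mult_left_mono dual_sumle) (auto intro: less_imp_le)
  also have "\<dots> = M * \<nu> / 2 * (\<Sum>t=1..T. \<beta> (t + 1)) + (\<Sum>t=1..T. \<beta> (t + 1) * dual_sq t) / 2 / \<nu>"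
    by (simp add: sum.distrib distrib_left sum_divide_distrib sum_distrib_left mult_ac)
  finally have S: "S \<le> (M * \<nu> / 2 + dual_sq (T + 1) / (2 * \<nu>)) / \<gamma> (T + 1) +
      (M * \<nu> / 2 * (\<Sum>t=1..T. \<beta> (t + 1)) + (\<Sum>t=1..T. \<beta> (t + 1) * dual_sq t) / 2 / \<nu>) + G * M * (\<Sum>t=1..T. move t)"
    by simp
  have "net_ccv m g T x \<le> (1 / real CARD('n)) * (\<Sum>i\<in>(UNIV :: 'n set). \<Sum>t=1..T. (\<Sum>j\<in>UNIV. \<Sum>k<m j. viol j t (x j t) k) + M * F2 * disagreement t)"
    unfolding net_ccv_def by (intro mult_left_mono sum_mono global_violation_le) auto
  also have "\<dots> = S + M * F2 * (\<Sum>t=1..T. disagreement t)"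
    by (simp add: S_def sum.distrib sum_distrib_left)
  also have "\<dots> \<le> (M * \<nu> / 2 + dual_sq (T + 1) / (2 * \<nu>)) / \<gamma> (T + 1) +
      (M * \<nu> / 2 * (\<Sum>t=1..T. \<beta> (t + 1)) + (\<Sum>t=1..T. \<beta> (t + 1) * dual_sq t) / 2 / \<nu>)
      + ccv_const * (1 + (\<Sum>t=1..T. \<tau> t) + (\<Sum>t=1..T. \<Sum>i\<in>UNIV. norm (residual i t)))"
    using S mult_left_mono[OF disagreement_move_sums(2)[of T], of "G * M"]
      mult_left_mono[OF disagreement_move_sums(1)[of T], of "M * F2"] G_nonneg F2_nonneg M_nonneg
    by (simp add: ccv_const_def algebra_simps)
  also have "ccv_const * (1 + (\<Sum>t=1..T. \<tau> t) + (\<Sum>t=1..T. \<Sum>i\<in>UNIV. norm (residual i t))) \<le>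
     ccv_const * (1 + (\<Sum>t=1..T. \<tau> t) + ((\<Sum>t=1..T. residual_sq t / (4 * \<alpha> (t + 1))) / \<mu> + \<mu> * real CARD('n) * (\<Sum>t=1..T. \<alpha> (t + 1))))"
  proof (intro mult_left_mono add_left_mono ccv_const_nonneg)
    have "(\<Sum>t=1..T. \<Sum>i\<in>UNIV. norm (residual i t)) \<le> (\<Sum>t=1..T. \<Sum>i\<in>UNIV. (norm (residual i t))\<^sup>2 / (4 * (\<mu> * \<alpha> (t + 1))) + \<mu> * \<alpha> (t + 1))"
    proof (intro sum_mono)
      fix t i show "norm (residual i t) \<le> (norm (residual i t))\<^sup>2 / (4 * (\<mu> * \<alpha> (t + 1))) + \<mu> * \<alpha> (t + 1)"
        using am_gm_weighted[of "\<mu> * \<alpha> (t + 1)" "norm (residual i t)" 1] pos \<alpha>_pos[of "t + 1"] by simp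
    qed
    then show "(\<Sum>t=1..T. \<Sum>i\<in>UNIV. norm (residual i t)) \<le> (\<Sum>t=1..T. residual_sq t / (4 * \<alpha> (t + 1))) / \<mu> + \<mu> * real CARD('n) * (\<Sum>t=1..T. \<alpha> (t + 1))"
      by (simp add: residual_sq_def sum.distrib sum_divide_distrib sum_distrib_left mult_ac)
  qed
  finally have main: "net_ccv m g T x \<le> M * \<nu> / 2 * (1 / \<gamma> (T + 1) + (\<Sum>t=1..T. \<beta> (t + 1)))
     + ccv_const * (1 + (\<Sum>t=1..T. \<tau> t)) + ccv_const * real CARD('n) * \<mu> * (\<Sum>t=1..T. \<alpha> (t + 1))
     + 1 / \<nu> * (dual_sq (T + 1) / (2 * \<gamma> (T + 1)) + (\<Sum>t=1..T. \<beta> (t + 1) * dual_sq t) / 2)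
     + ccv_const / \<mu> * (\<Sum>t=1..T. residual_sq t / (4 * \<alpha> (t + 1)))"
    by (simp add: algebra_simps add_divide_distrib)
  have a0: "0 \<le> dual_sq (T + 1) / (2 * \<gamma> (T + 1)) + (\<Sum>t=1..T. \<beta> (t + 1) * dual_sq t) / 2" (is "0 \<le> ?a")
    and b0: "0 \<le> (\<Sum>t=1..T. residual_sq t / (4 * \<alpha> (t + 1)))" (is "0 \<le> ?b")
    unfolding dual_sq_def residual_sq_def
    using \<alpha>_pos[THEN less_imp_le] \<beta>_pos[THEN less_imp_le] \<gamma>_pos[THEN less_imp_le]
    by (auto intro!: add_nonneg_nonneg divide_nonneg_nonneg sum_nonneg mult_nonneg_nonneg)
  \<comment> \<open>The dual part of the energy carries \<open>1 / \<nu>\<close> and the residual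
    part \<open>ccv_const / \<mu>\<close>; adding the two missing products gives a multiple of the
    whole energy.\<close>
  have "0 \<le> 1 / \<nu> * ?b" "0 \<le> ccv_const / \<mu> * ?a"
    using a0 b0 pos ccv_const_nonneg by simp_all
  then show ?thesis
    using main unfolding energy_def by (simp only: distrib_left distrib_right)
qed

text \<open>Lipschitz continuity moves each loss to the decision of its own agent, after which the
  average over the evaluating agents is trivial.\<close>

lemma net_reg_le:
  assumes y: "\<And>t. 1 \<le> t \<Longrightarrow> t \<le> T \<Longrightarrow> y t \<in> X"
  shows "real CARD('n) * net_reg f T x y \<le> (\<Sum>t=1..T. \<Sum>i\<in>UNIV. f i t (x i t) - f i t (y t))
    + real CARD('n) * F2 * (\<Sum>t=1..T. disagreement t)"
proof -
  let ?n = "real CARD('n)"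
  have "f j t (x i t) \<le> f j t (x j t) + F2 * disagreement t" if t: "t \<ge> 1" for i j t
  proof -
    have "F2 * norm (x i t - x j t) \<le> F2 * disagreement t"
      unfolding disagreement_def by (intro mult_left_mono F2_nonneg norm_diff_le_spread[of "\<lambda>i. x i t"])
    then show ?thesis using f_lip[OF t x_in_X[OF t] x_in_X[OF t], of j i j] by (simp add: abs_le_iff)
  qed
  then have gl: "?n * global_loss f t (x i t) \<le> (\<Sum>j\<in>UNIV. f j t (x j t)) + ?n * (F2 * disagreement t)" if "t \<ge> 1" for i t
    using that sum_mono[of UNIV "\<lambda>j. f j t (x i t)" "\<lambda>j. f j t (x j t) + F2 * disagreement t"]
    by (simp add: global_loss_def sum.distrib)
  have "?n * net_reg f T x y = (1 / ?n) * (\<Sum>i\<in>(UNIV :: 'n set). \<Sum>t=1..T. ?n * global_loss f t (x i t)) - (\<Sum>t=1..T. \<Sum>j\<in>UNIV. f j t (y t))"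
  proof -
    have "?n * (\<Sum>t=1..T. global_loss f t (y t)) = (\<Sum>t=1..T. \<Sum>j\<in>UNIV. f j t (y t))"
      by (simp add: sum_distrib_left global_loss_def)
    then show ?thesis
      unfolding net_reg_def right_diff_distrib by (simp add: sum_distrib_left[symmetric])
  qed
  also have "\<dots> \<le> (1 / ?n) * (\<Sum>i\<in>(UNIV :: 'n set). \<Sum>t=1..T. (\<Sum>j\<in>UNIV. f j t (x j t)) + ?n * (F2 * disagreement t)) - (\<Sum>t=1..T. \<Sum>j\<in>UNIV. f j t (y t))"
    by (intro diff_right_mono mult_left_mono sum_mono gl) auto
  also have "\<dots> = (\<Sum>t=1..T. \<Sum>i\<in>UNIV. f i t (x i t) - f i t (y t)) + ?n * F2 * (\<Sum>t=1..T. disagreement t)"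
    by (simp add: sum.distrib sum_subtractf sum_distrib_left mult.assoc)
  finally show ?thesis .
qed

text \<open>Supplies the lower bound on the regret from which the energy bound follows.\<close>

lemma net_reg_abs_le:
  assumes y: "\<And>t. 1 \<le> t \<Longrightarrow> t \<le> T \<Longrightarrow> y t \<in> X"
  shows "\<bar>net_reg f T x y\<bar> \<le> real T * F1"
proof -
  let ?n = "real CARD('n)"
  have "net_reg f T x y = (1 / ?n) * (\<Sum>i\<in>(UNIV :: 'n set). \<Sum>t=1..T. global_loss f t (x i t) - global_loss f t (y t))"
    by (simp add: net_reg_def sum_subtractf right_diff_distrib)
  moreover have "\<bar>global_loss f t (x i t) - global_loss f t (y t)\<bar> \<le> F1" if "t \<in> {1..T}" for i t
  proof -
    have "\<bar>\<Sum>j\<in>(UNIV :: 'n set). f j t (x i t) - f j t (y t)\<bar> \<le> (\<Sum>j\<in>(UNIV :: 'n set). F1)"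
      by (rule order_trans[OF sum_abs], rule sum_mono) (use that x_in_X y in \<open>auto intro!: f_diff\<close>)
    then have "(1 / ?n) * \<bar>\<Sum>j\<in>(UNIV :: 'n set). f j t (x i t) - f j t (y t)\<bar> \<le> (1 / ?n) * (?n * F1)"
      by (intro mult_left_mono) auto
    moreover have "global_loss f t (x i t) - global_loss f t (y t) = (1 / ?n) * (\<Sum>j\<in>(UNIV :: 'n set). f j t (x i t) - f j t (y t))"
      by (simp add: global_loss_def sum_subtractf right_diff_distrib)
    ultimately show ?thesis by (simp add: abs_mult)
  qed
  then have "\<bar>\<Sum>i\<in>(UNIV :: 'n set). \<Sum>t=1..T. global_loss f t (x i t) - global_loss f t (y t)\<bar> \<le> (\<Sum>i\<in>(UNIV :: 'n set). \<Sum>t=1..T. F1)"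
    by (intro order_trans[OF sum_abs] sum_mono) (use order_trans[OF sum_abs] in auto)
  ultimately show ?thesis by (simp add: abs_mult divide_le_eq mult.commute)
qed

lemma mix_norm: "t \<ge> 1 \<Longrightarrow> norm (mix i t) \<le> R"
  unfolding mix_def using norm_average_le[OF doubly_stochastic_row[OF mixing], of t "\<lambda>j. xh j t" R i] xh_in_X norm_X by blast

lemma residual_norm: "t \<ge> 1 \<Longrightarrow> norm (residual i t) \<le> 2 * R"
  unfolding residual_def using norm_triangle_ineq4[of "x i (t + 1)" "mix i t"] mix_norm[of t i] norm_X[OF x_in_X[of "t + 1" i]] by simp

end

section \<open>Expectation over the random directions\<close>

locale bandit_process = bandit_setting X f m g r R F1 F2 W K \<alpha> \<beta> \<gamma> \<tau> \<xi> \<delta> + prob_space \<Omega>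
  for X :: "(real^'p::finite) set"
    and f :: "'n::finite \<Rightarrow> nat \<Rightarrow> real^'p \<Rightarrow> real"
    and m g r R F1 F2 W K \<alpha> \<beta> \<gamma> \<tau> \<xi> \<delta> and \<Omega> :: "'w measure" +
  fixes x0 :: "'n \<Rightarrow> real^'p" and u x xh :: "'n \<Rightarrow> nat \<Rightarrow> 'w \<Rightarrow> real^'p" and q :: "'n \<Rightarrow> nat \<Rightarrow> 'w \<Rightarrow> nat \<Rightarrow> real"
  assumes x0: "\<And>i. x0 i \<in> Xs 1"
    and indep: "indep_vars (\<lambda>_. borel) (\<lambda>(i, t). u i t) (UNIV \<times> {1..})"
    and u_distr: "\<And>i t. t \<ge> 1 \<Longrightarrow> distr \<Omega> borel (u i t) = uniform_sphere"
    and u_sphere: "\<And>i t \<omega>. t \<ge> 1 \<Longrightarrow> \<omega> \<in> space \<Omega> \<Longrightarrow> norm (u i t \<omega>) = 1"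
    and run_at: "\<And>\<omega>. \<omega> \<in> space \<Omega> \<Longrightarrow> algorithm_run X f m g W \<alpha> \<beta> \<gamma> \<tau> \<xi> \<delta> x0 (\<lambda>i t. u i t \<omega>)
             (\<lambda>i t. x i t \<omega>) (\<lambda>i t. xh i t \<omega>) (\<lambda>i t. q i t \<omega>)"
begin

lemma bandit_run_at:
  assumes "\<omega> \<in> space \<Omega>"
  shows "bandit_run X f m g r R F1 F2 W K \<alpha> \<beta> \<gamma> \<tau> \<xi> \<delta> x0 (\<lambda>i t. u i t \<omega>) (\<lambda>i t. x i t \<omega>) (\<lambda>i t. xh i t \<omega>) (\<lambda>i t. q i t \<omega>)"
  by unfold_locales (use x0 run_at[OF assms] u_sphere[OF _ assms] in auto)

text \<open>The sigma-algebra generated by the directions of all agents before time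
  \<open>t\<close>, encoded as a measure with carrier \<open>space \<Omega>\<close> of which only
  the measurable sets matter.\<close>

definition past :: "nat \<Rightarrow> 'w measure" where
  "past t = vimage_algebra (space \<Omega>) (\<lambda>\<omega>. \<lambda>p\<in>UNIV \<times> {1..<t}. (case p of (i, s) \<Rightarrow> u i s) \<omega>) (Pi\<^sub>M (UNIV \<times> {1..<t}) (\<lambda>_. borel))"

lemma space_past [simp]: "space (past t) = space \<Omega>"
  by (simp add: past_def)

lemma u_measurable: "t \<ge> 1 \<Longrightarrow> u i t \<in> borel_measurable \<Omega>"
  using indep unfolding indep_vars_def by force

lemma u_past: "1 \<le> s \<Longrightarrow> s < t \<Longrightarrow> u i s \<in> borel_measurable (past t)"
proof -
  assume s: "1 \<le> s" "s < t"
  let ?F = "\<lambda>\<omega>. \<lambda>p\<in>UNIV \<times> {1..<t}. (case p of (i, s) \<Rightarrow> u i s) \<omega>"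
  have "?F \<in> measurable (past t) (Pi\<^sub>M (UNIV \<times> {1..<t}) (\<lambda>_. borel))"
    unfolding past_def by (rule measurable_vimage_algebra1) (auto simp: space_PiM)
  from measurable_compose[OF this measurable_component_singleton[of "(i, s)"]] s
  have "(\<lambda>\<omega>. ?F \<omega> (i, s)) \<in> borel_measurable (past t)" by auto
  moreover have "(\<lambda>\<omega>. ?F \<omega> (i, s)) = u i s" using s by (auto simp: fun_eq_iff)
  ultimately show ?thesis by simp
qed

lemma past_le: "(\<lambda>\<omega>. \<omega>) \<in> measurable \<Omega> (past t)"
  unfolding past_def
  by (rule measurable_vimage_algebra2) (auto intro!: measurable_restrict u_measurable)

lemma past_Suc: "(\<lambda>\<omega>. \<omega>) \<in> measurable (past (t + 1)) (past t)"
  unfolding past_def[of t]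
  by (rule measurable_vimage_algebra2) (auto intro!: measurable_restrict u_past)

text \<open>The direction is independent of all earlier ones. With the product law, the past can be
  frozen while the direction is integrated over the sphere.\<close>

lemma joint_distr:
  assumes t: "t \<ge> 1"
  shows "distr \<Omega> (past t) (\<lambda>\<omega>. \<omega>) \<Otimes>\<^sub>M uniform_sphere = distr \<Omega> (past t \<Otimes>\<^sub>M borel) (\<lambda>\<omega>. (\<omega>, u i t \<omega>))"
proof -
  let ?A = "UNIV \<times> {1..<t}" and ?B = "{(i, t)}"
  let ?F = "\<lambda>J \<omega>. \<lambda>p\<in>J. (case p of (i, s) \<Rightarrow> u i s) \<omega>"
  have ind: "indep_var (Pi\<^sub>M ?A (\<lambda>_. borel)) (?F ?A) (Pi\<^sub>M ?B (\<lambda>_. borel)) (?F ?B)"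
    by (rule indep_var_restrict[OF indep]) (use t in auto)
  have past_sets: "\<exists>A'\<in>sets (Pi\<^sub>M ?A (\<lambda>_. borel)). A = ?F ?A -` A' \<inter> space \<Omega>" if "A \<in> sets (past t)" for A
    using that unfolding past_def by (subst (asm) sets_vimage_algebra2) (auto simp: space_PiM)
  have u_borel: "u i t \<in> borel_measurable \<Omega>" by (rule u_measurable[OF t])
  have pair: "(\<lambda>\<omega>. (\<omega>, u i t \<omega>)) \<in> measurable \<Omega> (past t \<Otimes>\<^sub>M borel)"
    by (intro measurable_Pair past_le u_borel)
  interpret L: prob_space "distr \<Omega> (past t) (\<lambda>\<omega>. \<omega>)" by (rule prob_space_distr[OF past_le])
  interpret U: prob_space "distr \<Omega> borel (u i t)" by (rule prob_space_distr[OF u_borel])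
  show ?thesis
    unfolding u_distr[OF t, of i, symmetric]
  proof (rule pair_measure_eqI)
    show "sigma_finite_measure (distr \<Omega> (past t) (\<lambda>\<omega>. \<omega>))" ..
    show "sigma_finite_measure (distr \<Omega> borel (u i t))" ..
    show "sets (distr \<Omega> (past t) (\<lambda>\<omega>. \<omega>) \<Otimes>\<^sub>M distr \<Omega> borel (u i t)) = sets (distr \<Omega> (past t \<Otimes>\<^sub>M borel) (\<lambda>\<omega>. (\<omega>, u i t \<omega>)))"
      by (simp cong: sets_pair_measure_cong)
    fix A B assume "A \<in> sets (distr \<Omega> (past t) (\<lambda>\<omega>. \<omega>))" and "B \<in> sets (distr \<Omega> borel (u i t))"
    then have A: "A \<in> sets (past t)" and B: "B \<in> sets borel" by auto
    \<comment> \<open>Sets of \<open>past t\<close> are preimages under the tuple of earlier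
      directions, so a rectangle becomes an event of the independent pair.\<close>
    obtain A' where A': "A' \<in> sets (Pi\<^sub>M ?A (\<lambda>_. borel))" "A = ?F ?A -` A' \<inter> space \<Omega>" using past_sets[OF A] by blast
    let ?B' = "(\<lambda>z. z (i, t)) -` B \<inter> space (Pi\<^sub>M ?B (\<lambda>_. borel))"
    have B': "?B' \<in> sets (Pi\<^sub>M ?B (\<lambda>_. borel))"
      using measurable_sets[OF measurable_component_singleton[of "(i, t)" ?B "\<lambda>_. borel"] B] by simp
    have uB: "?F ?B -` ?B' \<inter> space \<Omega> = u i t -` B \<inter> space \<Omega>" by (auto simp: space_PiM)
    have "prob ((\<lambda>\<omega>. (?F ?A \<omega>, ?F ?B \<omega>)) -` (A' \<times> ?B') \<inter> space \<Omega>) = prob A * prob (u i t -` B \<inter> space \<Omega>)"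
      using indep_varD[OF ind A'(1) B'] unfolding uB A'(2) .
    moreover have "(\<lambda>\<omega>. (?F ?A \<omega>, ?F ?B \<omega>)) -` (A' \<times> ?B') \<inter> space \<Omega> = (\<lambda>\<omega>. (\<omega>, u i t \<omega>)) -` (A \<times> B) \<inter> space \<Omega>"
      using A'(2) by (auto simp: space_PiM)
    ultimately have "emeasure \<Omega> A * emeasure \<Omega> (u i t -` B \<inter> space \<Omega>) = emeasure \<Omega> ((\<lambda>\<omega>. (\<omega>, u i t \<omega>)) -` (A \<times> B) \<inter> space \<Omega>)"
      by (simp add: emeasure_eq_measure ennreal_mult)
    moreover have "A \<subseteq> space \<Omega>" using sets.sets_into_space[OF A] by simp
    ultimately show "emeasure (distr \<Omega> (past t) (\<lambda>\<omega>. \<omega>)) A * emeasure (distr \<Omega> borel (u i t)) B =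
        emeasure (distr \<Omega> (past t \<Otimes>\<^sub>M borel) (\<lambda>\<omega>. (\<omega>, u i t \<omega>))) (A \<times> B)"
      using A B by (simp add: emeasure_distr[OF past_le] emeasure_distr[OF u_borel] emeasure_distr[OF pair] Int_absorb2)
  qed
qed

text \<open>The losses are arbitrary outside \<open>X\<close>; cutting them off there makes them Borel functions.\<close>

definition cut :: "(real^'p \<Rightarrow> real) \<Rightarrow> real^'p \<Rightarrow> real" where
  "cut \<phi> z = (if z \<in> X then \<phi> z else 0)"

text \<open>What losses and positive parts of constraints have in common, so that one estimate
  serves both.\<close>

definition admissible :: "(real^'p \<Rightarrow> real) \<Rightarrow> bool" where
  "admissible \<phi> \<longleftrightarrow> convex_on X \<phi> \<and> (\<forall>z\<in>X. \<forall>z'\<in>X. \<bar>\<phi> z - \<phi> z'\<bar> \<le> F2 * norm (z - z'))"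

lemma admissible_f: "t \<ge> 1 \<Longrightarrow> admissible (f i t)"
  by (simp add: admissible_def convex_f f_lip)

lemma admissible_viol: "t \<ge> 1 \<Longrightarrow> k < m i \<Longrightarrow> admissible (\<lambda>z. viol i t z k)"
  by (simp add: admissible_def convex_viol viol_lip)

lemma cut_borel: assumes "admissible \<phi>" shows "cut \<phi> \<in> borel_measurable borel"
proof -
  have "F2-lipschitz_on X \<phi>"
    using assms F2_nonneg by (intro lipschitz_onI) (auto simp: admissible_def dist_norm)
  then have "continuous_on X \<phi>" by (rule lipschitz_on_continuous_on)
  then show ?thesis
    unfolding cut_def[abs_def] using X_facts(2) by (intro borel_measurable_continuous_on_if) auto
qed

lemma x_space: assumes "\<omega> \<in> space \<Omega>" "t \<ge> 1" shows "x i t \<omega> \<in> Xs t" "x i t \<omega> \<in> X" "xh i t \<omega> \<in> X"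
  using bandit_run.x_in[OF bandit_run_at[OF assms(1)] assms(2)] bandit_run.x_in_X[OF bandit_run_at[OF assms(1)] assms(2)]
    bandit_run.xh_in_X[OF bandit_run_at[OF assms(1)] assms(2)] by auto

lemma x_moved: assumes "\<omega> \<in> space \<Omega>" "t \<ge> 1" shows "x i t \<omega> + \<delta> t *\<^sub>R u i t \<omega> \<in> X"
  using cball_Xs[OF assms(2) x_space(1)[OF assms], of i] u_sphere[OF assms(2,1), of i] \<delta>_bounds[OF assms(2)]
  by (auto simp: subset_iff dist_norm)

lemma two_point_est_cut:
  "\<omega> \<in> space \<Omega> \<Longrightarrow> t \<ge> 1 \<Longrightarrow> two_point_est (\<delta> t) \<phi> (x i t \<omega>) (u i t \<omega>) = two_point_est (\<delta> t) (cut \<phi>) (x i t \<omega>) (u i t \<omega>)"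
  by (simp add: two_point_est_def cut_def x_space x_moved)

lemma loss_measurable:
  assumes "admissible \<phi>" "x i t \<in> borel_measurable N" "space N = space \<Omega>" "t \<ge> 1"
  shows "(\<lambda>\<omega>. \<phi> (x i t \<omega>)) \<in> borel_measurable N"
proof -
  have "(\<lambda>\<omega>. cut \<phi> (x i t \<omega>)) \<in> borel_measurable N"
    using assms cut_borel by measurable
  then show ?thesis
    by (rule measurable_cong[THEN iffD1, rotated]) (use assms in \<open>simp add: cut_def x_space\<close>)
qed

lemma two_point_est_measurable:
  assumes "admissible \<phi>" and [measurable]: "x i t \<in> borel_measurable N" "u i t \<in> borel_measurable N" and "space N = space \<Omega>" "t \<ge> 1"
  shows "(\<lambda>\<omega>. two_point_est (\<delta> t) \<phi> (x i t \<omega>) (u i t \<omega>)) \<in> borel_measurable N"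
proof -
  note [measurable] = cut_borel[OF assms(1)]
  have "(\<lambda>\<omega>. two_point_est (\<delta> t) (cut \<phi>) (x i t \<omega>) (u i t \<omega>)) \<in> borel_measurable N"
    unfolding two_point_est_def by measurable
  then show ?thesis
    by (rule measurable_cong[THEN iffD1, rotated]) (use assms in \<open>simp add: two_point_est_cut[symmetric]\<close>)
qed

lemma past_mono: "h \<in> measurable (past t) N \<Longrightarrow> h \<in> measurable (past (t + 1)) N"
  using measurable_compose[OF past_Suc] by simp

text \<open>The state at time \<open>t\<close> uses directions before \<open>t\<close> only; the
  step to \<open>t + 1\<close> reads the directions of time \<open>t\<close>, which belong to
  \<open>past (t + 1)\<close>.\<close>

lemma state_past:
  "t \<ge> 1 \<Longrightarrow> (\<forall>i. x i t \<in> borel_measurable (past t) \<and> xh i t \<in> borel_measurable (past t) \<and>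
     (\<forall>k<m i. (\<lambda>\<omega>. q i t \<omega> k) \<in> borel_measurable (past t)))"
proof (induction t rule: nat_induct_at_least)
  case base
  show ?case
  proof (intro allI conjI impI)
    fix i
    have eq: "x i 1 \<omega> = x0 i" "xh i 1 \<omega> = x0 i" if "\<omega> \<in> space (past 1)" for \<omega>
      using bandit_run.x_1[OF bandit_run_at, of \<omega> i] bandit_run.xh_1[OF bandit_run_at, of \<omega> i] that by simp_all
    show "x i 1 \<in> borel_measurable (past 1)" by (rule measurable_cong[THEN iffD2, OF eq(1)]) auto
    show "xh i 1 \<in> borel_measurable (past 1)" by (rule measurable_cong[THEN iffD2, OF eq(2)]) auto
    fix k assume "k < m i"
    then show "(\<lambda>\<omega>. q i 1 \<omega> k) \<in> borel_measurable (past 1)"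
      using bandit_run.q_1[OF bandit_run_at, of _ k i] by (subst measurable_cong[where g="\<lambda>_. 0"]) auto
  qed
next
  case (Suc t)
  have xt [measurable]: "x i t \<in> borel_measurable (past (t + 1))" and [measurable]: "xh i t \<in> borel_measurable (past (t + 1))" for i
    using Suc.IH past_mono by blast+
  have [measurable]: "(\<lambda>\<omega>. q i t \<omega> k) \<in> borel_measurable (past (t + 1))" if "k < m i" for i k
    using Suc.IH past_mono that by blast
  have ut [measurable]: "u i t \<in> borel_measurable (past (t + 1))" for i
    using Suc.hyps by (intro u_past) auto
  have [measurable]: "(\<lambda>\<omega>. two_point_est (\<delta> t) (f i t) (x i t \<omega>) (u i t \<omega>)) \<in> borel_measurable (past (t + 1))" for i
    by (rule two_point_est_measurable[OF admissible_f[OF Suc.hyps] xt ut space_past Suc.hyps])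
  have [measurable]: "(\<lambda>\<omega>. pos_part_est (\<delta> t) (g i t) (x i t \<omega>) (u i t \<omega>) k) \<in> borel_measurable (past (t + 1))" if "k < m i" for i k
    unfolding pos_part_est_def viol_def[symmetric]
    by (rule two_point_est_measurable[OF admissible_viol[OF Suc.hyps that] xt ut space_past Suc.hyps])
  have [measurable]: "(\<lambda>\<omega>. viol i t (x i t \<omega>) k) \<in> borel_measurable (past (t + 1))" if "k < m i" for i k
    by (rule loss_measurable[OF admissible_viol[OF Suc.hyps that] xt space_past Suc.hyps])
  have proj [measurable]: "closest_point (Xs (t + 1)) \<in> borel_measurable borel"
    by (intro borel_measurable_continuous_onI continuous_on_closest_point Xs)
  have xm [measurable]: "x i (t + 1) \<in> borel_measurable (past (t + 1))" for i
  proof (rule measurable_cong[THEN iffD2])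
    show "x i (t + 1) \<omega> = closest_point (Xs (t + 1)) ((\<Sum>j\<in>UNIV. W t $ i $ j *\<^sub>R xh j t \<omega>) - \<alpha> (t + 1) *\<^sub>R
        (two_point_est (\<delta> t) (f i t) (x i t \<omega>) (u i t \<omega>) + (\<Sum>k<m i. q i t \<omega> k *\<^sub>R pos_part_est (\<delta> t) (g i t) (x i t \<omega>) (u i t \<omega>) k)))"
      if "\<omega> \<in> space (past (t + 1))" for \<omega>
    proof -
      have \<omega>: "\<omega> \<in> space \<Omega>" using that by simp
      note run = bandit_run_at[OF \<omega>]
      show ?thesis
        unfolding bandit_run.x_step[OF run Suc.hyps] bandit_run.mix_def[OF run] bandit_run.direction_def[OF run]
          bandit_run.loss_est_def[OF run] bandit_run.viol_est_def[OF run] ..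
    qed
  qed measurable
  have qm: "(\<lambda>\<omega>. q i (t + 1) \<omega> k) \<in> borel_measurable (past (t + 1))" if k: "k < m i" for i k
  proof (rule measurable_cong[THEN iffD2])
    show "q i (t + 1) \<omega> k = max 0 ((1 - \<beta> (t + 1) * \<gamma> (t + 1)) * q i t \<omega> k +
                     \<gamma> (t + 1) * (viol i t (x i t \<omega>) k + pos_part_est (\<delta> t) (g i t) (x i t \<omega>) (u i t \<omega>) k \<bullet> (x i (t + 1) \<omega> - x i t \<omega>)))"
      if "\<omega> \<in> space (past (t + 1))" for \<omega>
    proof -
      have \<omega>: "\<omega> \<in> space \<Omega>" using that by simp
      note run = bandit_run_at[OF \<omega>]
      show ?thesis unfolding bandit_run.q_step[OF run Suc.hyps k] bandit_run.viol_est_def[OF run] ..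
    qed
  qed (use k in measurable)
  have xhm: "xh i (t + 1) \<in> borel_measurable (past (t + 1))" for i
  proof (rule measurable_cong[THEN iffD2])
    show "xh i (t + 1) \<omega> = (if norm (x i (t + 1) \<omega> - xh i t \<omega>) \<ge> \<tau> (t + 1) then x i (t + 1) \<omega> else xh i t \<omega>)"
      if "\<omega> \<in> space (past (t + 1))" for \<omega>
      using bandit_run.xh_step[OF bandit_run_at Suc.hyps, of \<omega> i] that by simp
  qed measurable
  show ?case using xm qm xhm by simp
qed

lemma integrable_bounded:
  fixes h :: "'w \<Rightarrow> real"
  assumes "h \<in> borel_measurable \<Omega>" "\<And>\<omega>. \<omega> \<in> space \<Omega> \<Longrightarrow> \<bar>h \<omega>\<bar> \<le> B"
  shows "integrable \<Omega> h"
  by (rule integrable_const_bound[OF AE_I2 assms(1), where B=B]) (simp add: assms(2))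

lemma past_measurable: "h \<in> measurable (past t) N \<Longrightarrow> h \<in> measurable \<Omega> N"
  by (rule measurable_compose[OF past_le])

text \<open>The weight will be 1 for a loss and the dual variable for a constraint. It depends on
  the past only, so it multiplies the sphere inequality for each fixed past; its sign preserves the
  inequality and its bound \<open>B\<close> multiplies the smoothing error.\<close>

proposition weighted_estimate:
  assumes t: "t \<ge> 1" and adm: "admissible \<phi>" and c: "c \<in> Xs t"
    and w[measurable]: "w \<in> borel_measurable (past t)" and wB: "\<And>\<omega>. \<omega> \<in> space \<Omega> \<Longrightarrow> 0 \<le> w \<omega>" "\<And>\<omega>. \<omega> \<in> space \<Omega> \<Longrightarrow> w \<omega> \<le> B"
  shows "integrable \<Omega> (\<lambda>\<omega>. w \<omega> * (two_point_est (\<delta> t) \<phi> (x i t \<omega>) (u i t \<omega>) \<bullet> (x i t \<omega> - c)))" (is "integrable \<Omega> ?est")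
    and "integrable \<Omega> (\<lambda>\<omega>. w \<omega> * (\<phi> (x i t \<omega>) - \<phi> c))" (is "integrable \<Omega> ?gap")
    and "(LINT \<omega>|\<Omega>. w \<omega> * (\<phi> (x i t \<omega>) - \<phi> c)) - 2 * F2 * \<delta> t * B
      \<le> (LINT \<omega>|\<Omega>. w \<omega> * (two_point_est (\<delta> t) \<phi> (x i t \<omega>) (u i t \<omega>) \<bullet> (x i t \<omega> - c)))"
proof -
  have xt [measurable]: "x i t \<in> borel_measurable (past t)" using state_past[OF t] by blast
  have cutm [measurable]: "cut \<phi> \<in> borel_measurable borel" by (rule cut_borel[OF adm])
  have lip: "\<bar>\<phi> z - \<phi> z'\<bar> \<le> F2 * norm (z - z')" if "z \<in> X" "z' \<in> X" for z z'
    using adm that by (simp add: admissible_def)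
  have \<delta>: "\<delta> t > 0" using \<delta>_bounds[OF t] by simp
  have cX: "c \<in> X" using c Xs_subset[OF t] by blast
  have B: "B \<ge> 0" using wB not_empty by (metis all_not_in_conv order_trans)
  have gap_eq: "?gap \<omega> = w \<omega> * (cut \<phi> (x i t \<omega>) - \<phi> c)" if "\<omega> \<in> space \<Omega>" for \<omega>
    using x_space[OF that t] by (simp add: cut_def)
  have gap_m: "(\<lambda>\<omega>. w \<omega> * (cut \<phi> (x i t \<omega>) - \<phi> c)) \<in> borel_measurable (past t)" by measurable
  have gap_meas: "?gap \<in> borel_measurable (past t)"
    by (rule measurable_cong[THEN iffD2, OF _ gap_m]) (simp add: gap_eq)
  have gap_bound: "\<bar>?gap \<omega>\<bar> \<le> B * (F2 * (2 * R))" if "\<omega> \<in> space \<Omega>" for \<omega>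
  proof -
    have "\<bar>\<phi> (x i t \<omega>) - \<phi> c\<bar> \<le> F2 * (2 * R)"
      using lip[OF x_space(2)[OF that t] cX] mult_left_mono[OF norm_X_diff[OF x_space(2)[OF that t] cX] F2_nonneg] by (rule order_trans)
    then show ?thesis unfolding abs_mult using wB[OF that] by (intro mult_mono) auto
  qed
  show gap_int: "integrable \<Omega> ?gap"
    by (rule integrable_bounded[OF past_measurable[OF gap_meas] gap_bound])
  \<comment> \<open>The estimate with a free direction \<open>v\<close>, using
    \<open>cut \<phi>\<close> for joint measurability. At \<open>v = u i t \<omega>\<close> it is
    the actual estimate, because the sampled point lies in \<open>X\<close>.\<close>
  define h where "h \<omega> v = w \<omega> * (two_point_est (\<delta> t) (cut \<phi>) (x i t \<omega>) v \<bullet> (x i t \<omega> - c))" for \<omega> v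
  have hm: "(\<lambda>(\<omega>, v). h \<omega> v) \<in> borel_measurable (past t \<Otimes>\<^sub>M borel)"
  proof -
    let ?P = "past t \<Otimes>\<^sub>M (borel :: (real^'p) measure)"
    have wm: "(\<lambda>z. w (fst z)) \<in> borel_measurable ?P"
      by (rule measurable_compose[OF measurable_fst w])
    have xm: "(\<lambda>z. x i t (fst z)) \<in> borel_measurable ?P"
      by (rule measurable_compose[OF measurable_fst xt])
    have um: "(\<lambda>z. snd z) \<in> borel_measurable ?P"
      by (rule measurable_snd)
    show ?thesis
      unfolding h_def two_point_est_def case_prod_beta
      by (intro borel_measurable_times borel_measurable_inner borel_measurable_scaleR borel_measurable_diff
          borel_measurable_add borel_measurable_const wm xm um measurable_compose[OF _ cutm])
  qed
  have est_eq: "?est \<omega> = h \<omega> (u i t \<omega>)" if "\<omega> \<in> space \<Omega>" for \<omega>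
    unfolding h_def by (subst two_point_est_cut[OF that t]) (rule refl)
  have pair: "(\<lambda>\<omega>. (\<omega>, u i t \<omega>)) \<in> measurable \<Omega> (past t \<Otimes>\<^sub>M borel)"
    by (intro measurable_Pair past_le u_measurable t)
  have "(\<lambda>\<omega>. h \<omega> (u i t \<omega>)) \<in> borel_measurable \<Omega>"
    using measurable_compose[OF pair hm] by simp
  then have est_meas: "?est \<in> borel_measurable \<Omega>"
    by (rule measurable_cong[THEN iffD2, rotated]) (simp add: est_eq)
  have est_bound: "\<bar>?est \<omega>\<bar> \<le> B * (G * (2 * R))" if "\<omega> \<in> space \<Omega>" for \<omega>
  proof -
    have "\<bar>two_point_est (\<delta> t) \<phi> (x i t \<omega>) (u i t \<omega>) \<bullet> (x i t \<omega> - c)\<bar> \<le> norm (two_point_est (\<delta> t) \<phi> (x i t \<omega>) (u i t \<omega>)) * norm (x i t \<omega> - c)"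
      by (rule Cauchy_Schwarz_ineq2)
    also have "\<dots> \<le> G * (2 * R)"
      by (intro mult_mono two_point_est_bound[OF t x_space(1)[OF that t] u_sphere[OF t that] lip] norm_X_diff x_space[OF that t] cX G_nonneg) auto
    finally show ?thesis unfolding abs_mult using wB[OF that] by (intro mult_mono) auto
  qed
  show est_int: "integrable \<Omega> ?est"
    by (rule integrable_bounded[OF est_meas est_bound])
  let ?P = "distr \<Omega> (past t) (\<lambda>\<omega>. \<omega>)"
  interpret L: prob_space ?P by (rule prob_space_distr[OF past_le])
  have sph: "prob_space (uniform_sphere :: (real^'p) measure)"
    unfolding u_distr[OF t, of i, symmetric] by (intro prob_space_distr u_measurable t)
  interpret U: prob_space "uniform_sphere :: (real^'p) measure" by (rule sph)
  interpret pair_sigma_finite ?P "uniform_sphere :: (real^'p) measure" ..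
  have h_int: "integrable (?P \<Otimes>\<^sub>M uniform_sphere) (\<lambda>(\<omega>, v). h \<omega> v)"
    unfolding joint_distr[OF t, of i] integrable_distr_eq[OF pair hm]
    using est_int by (subst Bochner_Integration.integrable_cong[OF refl, of _ _ ?est]) (auto simp: est_eq)
  have inner_int: "integrable ?P (\<lambda>\<omega>. LINT v|uniform_sphere. h \<omega> v)"
    using integrable_fst'[OF h_int] by simp
  \<comment> \<open>The sphere inequality with the comparator \<open>c\<close> as target: the
    decision and \<open>c\<close> both lie in \<open>Xs t\<close>, so their \<delta>-balls lie in
    \<open>X\<close>.\<close>
  have lower: "?gap \<omega> - 2 * F2 * \<delta> t * B \<le> (LINT v|uniform_sphere. h \<omega> v)" if "\<omega> \<in> space \<Omega>" for \<omega>
  proof -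
    let ?x = "x i t \<omega>"
    let ?J = "LINT v|uniform_sphere. (cut \<phi> (?x + \<delta> t *\<^sub>R v) - cut \<phi> ?x) * (v \<bullet> (c - ?x))"
    have "real DIM(real^'p) * ?J \<le> \<delta> t * (cut \<phi> c - cut \<phi> ?x + 2 * F2 * \<delta> t)"
    proof (rule sphere_two_point_le[where X=X])
      show "convex_on X (cut \<phi>)"
        using adm X_facts(1) unfolding admissible_def convex_on_def cut_def by (auto simp: convexD)
      show "\<bar>cut \<phi> a - cut \<phi> b\<bar> \<le> F2 * norm (a - b)" if "a \<in> X" "b \<in> X" for a b
        using lip[OF that] that by (simp add: cut_def)
    qed (use X_facts \<delta> cball_Xs[OF t] c x_space(1)[OF that t] in auto)
    then have "real CARD('p) / \<delta> t * ?J \<le> \<phi> c - \<phi> ?x + 2 * F2 * \<delta> t"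
      using \<delta> cX x_space(2)[OF that t] by (simp add: cut_def divide_le_eq mult.commute)
    then have "w \<omega> * (real CARD('p) / \<delta> t * ?J) \<le> w \<omega> * (\<phi> c - \<phi> ?x + 2 * F2 * \<delta> t)"
      using wB[OF that] by (intro mult_left_mono) auto
    moreover have "w \<omega> * (2 * F2 * \<delta> t) \<le> B * (2 * F2 * \<delta> t)"
      using wB[OF that] \<delta> F2_nonneg by (intro mult_right_mono) auto
    moreover have "(LINT v|uniform_sphere. h \<omega> v) = - (w \<omega> * (real CARD('p) / \<delta> t * ?J))"
    proof -
      have "h \<omega> v = (- (w \<omega> * (real CARD('p) / \<delta> t))) * ((cut \<phi> (?x + \<delta> t *\<^sub>R v) - cut \<phi> ?x) * (v \<bullet> (c - ?x)))" for v
        unfolding h_def two_point_est_def by (simp add: inner_diff_right algebra_simps)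
      then show ?thesis by simp
    qed
    ultimately show ?thesis by (simp add: algebra_simps)
  qed
  have "(LINT \<omega>|\<Omega>. ?gap \<omega>) - 2 * F2 * \<delta> t * B = (LINT \<omega>|\<Omega>. ?gap \<omega> - 2 * F2 * \<delta> t * B)"
    using gap_int by (simp add: prob_space)
  also have "\<dots> = (LINT \<omega>|?P. ?gap \<omega> - 2 * F2 * \<delta> t * B)"
    using gap_meas by (subst integral_distr[OF past_le]) auto
  also have "\<dots> \<le> (LINT \<omega>|?P. LINT v|uniform_sphere. h \<omega> v)"
  proof (rule integral_mono[OF _ inner_int])
    show "integrable ?P (\<lambda>\<omega>. ?gap \<omega> - 2 * F2 * \<delta> t * B)"
      using gap_meas gap_int by (subst integrable_distr_eq[OF past_le]) auto
  qed (use lower in simp)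
  also have "\<dots> = (LINT z|(?P \<Otimes>\<^sub>M uniform_sphere). (case z of (\<omega>, v) \<Rightarrow> h \<omega> v))"
    using integral_fst'[OF h_int] by simp
  also have "\<dots> = (LINT \<omega>|\<Omega>. h \<omega> (u i t \<omega>))"
    unfolding joint_distr[OF t, of i] using integral_distr[OF pair hm] by simp
  also have "\<dots> = (LINT \<omega>|\<Omega>. ?est \<omega>)"
    by (intro Bochner_Integration.integral_cong refl) (simp add: est_eq)
  finally show "(LINT \<omega>|\<Omega>. ?gap \<omega>) - 2 * F2 * \<delta> t * B \<le> (LINT \<omega>|\<Omega>. ?est \<omega>)" .
qed

section \<open>Integrability and expected regret\<close>

abbreviation gap_at :: "(nat \<Rightarrow> real^'p) \<Rightarrow> nat \<Rightarrow> 'w \<Rightarrow> real" where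
  "gap_at c t \<omega> \<equiv> bandit_run.gap f m g \<delta> (\<lambda>i t. u i t \<omega>) (\<lambda>i t. x i t \<omega>) (\<lambda>i t. q i t \<omega>) c t"

abbreviation energy_at :: "nat \<Rightarrow> 'w \<Rightarrow> real" where
  "energy_at T \<omega> \<equiv> bandit_run.energy m W \<alpha> \<beta> \<gamma> (\<lambda>i t. x i t \<omega>) (\<lambda>i t. xh i t \<omega>) (\<lambda>i t. q i t \<omega>) T"

lemma
  assumes t: "t \<ge> 1"
  shows x_measurable: "x i t \<in> borel_measurable \<Omega>" and xh_measurable: "xh i t \<in> borel_measurable \<Omega>"
    and q_measurable: "k < m i \<Longrightarrow> (\<lambda>\<omega>. q i t \<omega> k) \<in> borel_measurable \<Omega>"
  using state_past[OF t] past_measurable by blast+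

lemma q_at_bounds:
  assumes "\<omega> \<in> space \<Omega>" "t \<ge> 1" "k < m i" shows "0 \<le> q i t \<omega> k" "q i t \<omega> k \<le> dual_bound / \<beta> t"
  using bandit_run.q_bounds[OF bandit_run_at[OF assms(1)] assms(2,3)] by auto

lemma integrable_f:
  assumes t: "t \<ge> 1" shows "integrable \<Omega> (\<lambda>\<omega>. f j t (x i t \<omega>))"
proof (rule integrable_bounded)
  show "(\<lambda>\<omega>. f j t (x i t \<omega>)) \<in> borel_measurable \<Omega>"
    by (rule loss_measurable[OF admissible_f[OF t] x_measurable[OF t] refl t])
  fix \<omega> assume "\<omega> \<in> space \<Omega>"
  then show "\<bar>f j t (x i t \<omega>)\<bar> \<le> F1 + \<bar>f j t 0\<bar>"
    using f_diff[OF t x_space(2)[OF _ t] zero_X, of \<omega> j i] by linarith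
qed

lemma integrable_net_reg: "integrable \<Omega> (\<lambda>\<omega>. net_reg f T (\<lambda>i t. x i t \<omega>) y)"
  unfolding net_reg_def global_loss_def
  by (intro Bochner_Integration.integrable_diff integrable_mult_right Bochner_Integration.integrable_sum integrable_f) auto

lemma integrable_net_ccv: "integrable \<Omega> (\<lambda>\<omega>. net_ccv m g T (\<lambda>i t. x i t \<omega>))"
  unfolding net_ccv_def
proof (intro integrable_mult_right Bochner_Integration.integrable_sum)
  fix i t assume "t \<in> {1..T}"
  then have t: "t \<ge> 1" by simp
  show "integrable \<Omega> (\<lambda>\<omega>. global_violation m g t (x i t \<omega>))"
  proof (rule integrable_bounded)
    have vm: "(\<lambda>\<omega>. viol j t (x i t \<omega>) k) \<in> borel_measurable \<Omega>" if "k < m j" for j k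
      by (rule loss_measurable[OF admissible_viol[OF t that] x_measurable[OF t] refl t])
    have "global_violation m g t (x i t \<omega>) = sqrt (\<Sum>(j, k)\<in>(SIGMA j:UNIV. {..<m j}). (viol j t (x i t \<omega>) k)\<^sup>2)" for \<omega>
      by (auto simp: global_violation_def L2_set_def viol_def intro!: sum.cong)
    moreover have "(\<lambda>\<omega>. sqrt (\<Sum>(j, k)\<in>(SIGMA j:UNIV. {..<m j}). (viol j t (x i t \<omega>) k)\<^sup>2)) \<in> borel_measurable \<Omega>"
      by (intro borel_measurable_continuous_on[of sqrt] borel_measurable_sum continuous_intros)
         (auto intro!: borel_measurable_power vm)
    ultimately show "(\<lambda>\<omega>. global_violation m g t (x i t \<omega>)) \<in> borel_measurable \<Omega>" by simp
    fix \<omega> assume \<omega>: "\<omega> \<in> space \<Omega>"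
    have "global_violation m g t (x i t \<omega>) \<le> (\<Sum>(j, k)\<in>(SIGMA j:UNIV. {..<m j}). viol j t (x i t \<omega>) k)"
      unfolding global_violation_def viol_def by (rule order_trans[OF L2_set_le_sum]) auto
    also have "\<dots> \<le> (\<Sum>(j, k)\<in>(SIGMA j:UNIV. {..<m j}). F1)"
      using x_space(2)[OF \<omega> t] by (intro sum_mono) (auto intro!: viol_le t)
    finally show "\<bar>global_violation m g t (x i t \<omega>)\<bar> \<le> (\<Sum>(j, k)\<in>(SIGMA j:UNIV. {..<m j}). F1)"
      by (simp add: global_violation_def)
  qed
qed

lemma integrable_energy: "integrable \<Omega> (energy_at T)"
proof -
  have Q: "integrable \<Omega> (\<lambda>\<omega>. \<Sum>i\<in>UNIV. \<Sum>k<m i. (q i t \<omega> k)\<^sup>2)" if t: "t \<ge> 1" for t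
  proof (intro Bochner_Integration.integrable_sum, rule integrable_bounded)
    fix i k assume "k \<in> {..<m i}"
    then have k: "k < m i" by simp
    show "(\<lambda>\<omega>. (q i t \<omega> k)\<^sup>2) \<in> borel_measurable \<Omega>" by (intro borel_measurable_power q_measurable t k)
    fix \<omega> assume "\<omega> \<in> space \<Omega>"
    then show "\<bar>(q i t \<omega> k)\<^sup>2\<bar> \<le> (dual_bound / \<beta> t)\<^sup>2"
      using q_at_bounds[OF _ t k] by (simp add: power_mono)
  qed
  have E: "integrable \<Omega> (\<lambda>\<omega>. \<Sum>i\<in>UNIV. (norm (x i (t + 1) \<omega> - (\<Sum>j\<in>UNIV. W t $ i $ j *\<^sub>R xh j t \<omega>)))\<^sup>2)" if t: "t \<ge> 1" for t
  proof (intro Bochner_Integration.integrable_sum, rule integrable_bounded)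
    fix i
    have [measurable]: "x i (t + 1) \<in> borel_measurable \<Omega>" "xh j t \<in> borel_measurable \<Omega>" for j
      using t by (auto intro: x_measurable xh_measurable)
    show "(\<lambda>\<omega>. (norm (x i (t + 1) \<omega> - (\<Sum>j\<in>UNIV. W t $ i $ j *\<^sub>R xh j t \<omega>)))\<^sup>2) \<in> borel_measurable \<Omega>"
      by measurable
    fix \<omega> assume "\<omega> \<in> space \<Omega>"
    note run = bandit_run_at[OF this]
    show "\<bar>(norm (x i (t + 1) \<omega> - (\<Sum>j\<in>UNIV. W t $ i $ j *\<^sub>R xh j t \<omega>)))\<^sup>2\<bar> \<le> (2 * R)\<^sup>2"
      using power_mono[OF bandit_run.residual_norm[OF run t, of i] norm_ge_zero, of 2]
      unfolding bandit_run.residual_def[OF run] bandit_run.mix_def[OF run] by simp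
  qed
  have "integrable \<Omega> (\<lambda>\<omega>. (\<Sum>i\<in>UNIV. \<Sum>k<m i. (q i (T + 1) \<omega> k)\<^sup>2) / (2 * \<gamma> (T + 1)) +
      (\<Sum>t=1..T. \<beta> (t + 1) * (\<Sum>i\<in>UNIV. \<Sum>k<m i. (q i t \<omega> k)\<^sup>2)) / 2 +
      (\<Sum>t=1..T. (\<Sum>i\<in>UNIV. (norm (x i (t + 1) \<omega> - (\<Sum>j\<in>UNIV. W t $ i $ j *\<^sub>R xh j t \<omega>)))\<^sup>2) / (4 * \<alpha> (t + 1))))"
    by (intro Bochner_Integration.integrable_add integrable_divide_zero Bochner_Integration.integrable_sum integrable_mult_right Q E) auto
  then show ?thesis
  proof (rule Bochner_Integration.integrable_cong[OF refl, THEN iffD1, rotated])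
    fix \<omega> assume "\<omega> \<in> space \<Omega>"
    note run = bandit_run_at[OF this]
    show "(\<Sum>i\<in>UNIV. \<Sum>k<m i. (q i (T + 1) \<omega> k)\<^sup>2) / (2 * \<gamma> (T + 1)) +
      (\<Sum>t=1..T. \<beta> (t + 1) * (\<Sum>i\<in>UNIV. \<Sum>k<m i. (q i t \<omega> k)\<^sup>2)) / 2 +
      (\<Sum>t=1..T. (\<Sum>i\<in>UNIV. (norm (x i (t + 1) \<omega> - (\<Sum>j\<in>UNIV. W t $ i $ j *\<^sub>R xh j t \<omega>)))\<^sup>2) / (4 * \<alpha> (t + 1))) = energy_at T \<omega>"
      unfolding bandit_run.energy_def[OF run] bandit_run.dual_sq_def[OF run] bandit_run.residual_sq_def[OF run]
        bandit_run.residual_def[OF run] bandit_run.mix_def[OF run] ..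
  qed
qed

text \<open>\<open>2 * F2 * \<delta> t\<close> is the smoothing error and
  \<open>F2 * R * \<xi> t\<close> the cost of shrinking the comparator. They occur once per loss
  and, multiplied by the bound on \<open>q\<close>, once per scalar constraint.\<close>

definition bias :: "nat \<Rightarrow> real" where
  "bias t = F2 * (2 * \<delta> t + R * \<xi> t) * (real CARD('n) + M * (dual_bound / \<beta> t))"

text \<open>The comparator has to lie in \<open>Xs t\<close>, so \<open>y t\<close> is shrunk
  towards the origin. As \<open>y t\<close> violates nothing, the shrunken point violates a
  constraint by at most \<open>F2 * R * \<xi> t\<close>, and the rest of the constraint part cancels
  against \<open>q * viol\<close>.\<close>

lemma expected_gap:
  assumes t: "t \<ge> 1" and y: "y t \<in> X" "\<And>i k. k < m i \<Longrightarrow> viol i t (y t) k = 0" and c: "c t = (1 - \<xi> t) *\<^sub>R y t"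
  shows "integrable \<Omega> (gap_at c t)"
    and "(\<Sum>i\<in>UNIV. LINT \<omega>|\<Omega>. f i t (x i t \<omega>) - f i t (y t)) - bias t \<le> (LINT \<omega>|\<Omega>. gap_at c t \<omega>)"
proof -
  define B where "B = dual_bound / \<beta> t"
  have B: "B \<ge> 0" using dual_bound_nonneg \<beta>_pos[OF t] by (simp add: B_def)
  have \<xi>: "0 < \<xi> t" "\<xi> t < 1" using \<xi>_bounds[OF t] by auto
  have \<delta>: "\<delta> t > 0" using \<delta>_bounds[OF t] by simp
  have cXs: "c t \<in> Xs t" using y(1) c by (auto simp: Xs_def)
  then have cX: "c t \<in> X" using Xs_subset[OF t] by blast
  have "norm (c t - y t) = \<xi> t * norm (y t)"
  proof -
    have "c t - y t = - (\<xi> t *\<^sub>R y t)" by (simp add: c algebra_simps)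
    then show ?thesis using \<xi> by simp
  qed
  also have "\<dots> \<le> \<xi> t * R" using \<xi> norm_X[OF y(1)] by (intro mult_left_mono) auto
  finally have cy: "F2 * norm (c t - y t) \<le> F2 * (R * \<xi> t)"
    using F2_nonneg by (intro mult_left_mono) (auto simp: mult.commute)
  define ef where "ef i \<omega> = two_point_est (\<delta> t) (f i t) (x i t \<omega>) (u i t \<omega>) \<bullet> (x i t \<omega> - c t)" for i \<omega>
  define eg where "eg i k \<omega> = q i t \<omega> k * (two_point_est (\<delta> t) (\<lambda>z. viol i t z k) (x i t \<omega>) (u i t \<omega>) \<bullet> (x i t \<omega> - c t))" for i k \<omega>
  define v where "v i k \<omega> = q i t \<omega> k * viol i t (x i t \<omega>) k" for i k \<omega>
  note west_f = weighted_estimate[where w="\<lambda>_. 1" and B=1, OF t admissible_f[OF t] cXs, simplified]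
  have ef_int: "integrable \<Omega> (ef i)" for i
    using west_f(1)[of i i] by (simp add: ef_def[abs_def])
  have ef_le: "(LINT \<omega>|\<Omega>. f i t (x i t \<omega>) - f i t (y t)) - F2 * (2 * \<delta> t + R * \<xi> t) \<le> (LINT \<omega>|\<Omega>. ef i \<omega>)" for i
  proof -
    have "(LINT \<omega>|\<Omega>. f i t (x i t \<omega>) - f i t (c t)) - 2 * F2 * \<delta> t \<le> (LINT \<omega>|\<Omega>. ef i \<omega>)"
      using west_f(3)[of i i] by (simp add: ef_def[abs_def])
    moreover have "f i t (c t) \<le> f i t (y t) + F2 * (R * \<xi> t)"
      using f_lip[OF t cX y(1), of i] cy by linarith
    ultimately show ?thesis
      using integrable_f[OF t, of i i] by (simp add: prob_space algebra_simps)
  qed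
  have qm: "(\<lambda>\<omega>. q i t \<omega> k) \<in> borel_measurable (past t)" if "k < m i" for i k
    using state_past[OF t] that by blast
  have eg_int: "integrable \<Omega> (eg i k)" and v_int: "integrable \<Omega> (v i k)"
    and eg_le: "- (F2 * (2 * \<delta> t + R * \<xi> t) * B) \<le> (LINT \<omega>|\<Omega>. eg i k \<omega> - v i k \<omega>)" if k: "k < m i" for i k
  proof -
    \<comment> \<open>The dual variable is the weight: known from the past, non-negative and at most
      \<open>dual_bound / \<beta> t\<close>.\<close>
    note west = weighted_estimate[OF t admissible_viol[OF t k] cXs qm[OF k] q_at_bounds[OF _ t k], where i=i]
    show 1: "integrable \<Omega> (eg i k)" using west(1) by (simp add: eg_def[abs_def])
    have vm: "(\<lambda>\<omega>. viol i t (x i t \<omega>) k) \<in> borel_measurable \<Omega>"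
      by (rule loss_measurable[OF admissible_viol[OF t k] x_measurable[OF t] refl t])
    have q_int: "integrable \<Omega> (\<lambda>\<omega>. q i t \<omega> k)"
      by (rule integrable_bounded[where B=B]) (use q_at_bounds[OF _ t k] q_measurable[OF t k] in \<open>auto simp: B_def\<close>)
    show 2: "integrable \<Omega> (v i k)"
    proof (rule integrable_bounded[where B="B * F1"])
      show "v i k \<in> borel_measurable \<Omega>"
        unfolding v_def by (intro borel_measurable_times q_measurable[OF t k] vm)
      show "\<bar>v i k \<omega>\<bar> \<le> B * F1" if "\<omega> \<in> space \<Omega>" for \<omega>
        unfolding v_def abs_mult using q_at_bounds[OF that t k] viol_le[OF t k x_space(2)[OF that t, of i]] viol_nonneg[of i t "x i t \<omega>" k] B
        by (intro mult_mono) (auto simp: B_def)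
    qed
    have vc: "viol i t (c t) k \<le> F2 * (R * \<xi> t)"
      using viol_lip[OF t k cX y(1)] cy y(2)[OF k] by (simp add: abs_le_iff)
    have "(LINT \<omega>|\<Omega>. q i t \<omega> k * (viol i t (x i t \<omega>) k - viol i t (c t) k)) = (LINT \<omega>|\<Omega>. v i k \<omega>) - (LINT \<omega>|\<Omega>. q i t \<omega> k) * viol i t (c t) k"
    proof -
      have "(\<lambda>\<omega>. q i t \<omega> k * (viol i t (x i t \<omega>) k - viol i t (c t) k)) = (\<lambda>\<omega>. v i k \<omega> - q i t \<omega> k * viol i t (c t) k)"
        by (simp add: v_def right_diff_distrib)
      then show ?thesis using 2 q_int by simp
    qed
    moreover have "(LINT \<omega>|\<Omega>. q i t \<omega> k) * viol i t (c t) k \<le> B * (F2 * (R * \<xi> t))"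
    proof (rule mult_mono[OF _ vc B viol_nonneg])
      have "(LINT \<omega>|\<Omega>. q i t \<omega> k) \<le> (LINT \<omega>|\<Omega>. B)"
        by (rule integral_mono[OF q_int]) (use q_at_bounds[OF _ t k] in \<open>auto simp: B_def\<close>)
      then show "(LINT \<omega>|\<Omega>. q i t \<omega> k) \<le> B" by (simp add: prob_space)
    qed
    moreover have "(LINT \<omega>|\<Omega>. q i t \<omega> k * (viol i t (x i t \<omega>) k - viol i t (c t) k)) - 2 * F2 * \<delta> t * B \<le> (LINT \<omega>|\<Omega>. eg i k \<omega>)"
      using west(3) by (simp add: eg_def[abs_def] B_def)
    ultimately show "- (F2 * (2 * \<delta> t + R * \<xi> t) * B) \<le> (LINT \<omega>|\<Omega>. eg i k \<omega> - v i k \<omega>)"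
      using 1 2 by (simp add: algebra_simps)
  qed
  have gap_eq: "gap_at c t \<omega> = (\<Sum>i\<in>UNIV. ef i \<omega> + (\<Sum>k<m i. eg i k \<omega> - v i k \<omega>))" if "\<omega> \<in> space \<Omega>" for \<omega>
  proof -
    note run = bandit_run_at[OF that]
    show ?thesis
      unfolding bandit_run.gap_def[OF run] bandit_run.direction_def[OF run] bandit_run.loss_est_def[OF run] bandit_run.viol_est_def[OF run]
        pos_part_est_def viol_def[symmetric] ef_def eg_def v_def
      by (simp add: inner_add_left inner_sum_left sum_subtractf sum.distrib)
  qed
  have int: "integrable \<Omega> (\<lambda>\<omega>. \<Sum>i\<in>UNIV. ef i \<omega> + (\<Sum>k<m i. eg i k \<omega> - v i k \<omega>))"
    using ef_int eg_int v_int by (intro Bochner_Integration.integrable_sum Bochner_Integration.integrable_add Bochner_Integration.integrable_diff) auto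
  then show "integrable \<Omega> (gap_at c t)"
    by (rule Bochner_Integration.integrable_cong[OF refl, THEN iffD2, rotated]) (rule gap_eq)
  have "(LINT \<omega>|\<Omega>. gap_at c t \<omega>) = (LINT \<omega>|\<Omega>. (\<Sum>i\<in>UNIV. ef i \<omega> + (\<Sum>k<m i. eg i k \<omega> - v i k \<omega>)))"
    by (rule Bochner_Integration.integral_cong[OF refl gap_eq])
  also have "\<dots> = (\<Sum>i\<in>UNIV. (LINT \<omega>|\<Omega>. ef i \<omega>) + (\<Sum>k<m i. LINT \<omega>|\<Omega>. eg i k \<omega> - v i k \<omega>))"
  proof -
    have 1: "integrable \<Omega> (\<lambda>\<omega>. \<Sum>k<m i. eg i k \<omega> - v i k \<omega>)" for i
      using eg_int v_int by (intro Bochner_Integration.integrable_sum Bochner_Integration.integrable_diff) auto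
    have 2: "(LINT \<omega>|\<Omega>. (\<Sum>k<m i. eg i k \<omega> - v i k \<omega>)) = (\<Sum>k<m i. LINT \<omega>|\<Omega>. eg i k \<omega> - v i k \<omega>)" for i
      using eg_int v_int by (intro Bochner_Integration.integral_sum Bochner_Integration.integrable_diff) auto
    show ?thesis
      unfolding 2[symmetric] Bochner_Integration.integral_add[OF ef_int 1, symmetric]
      by (intro Bochner_Integration.integral_sum Bochner_Integration.integrable_add ef_int 1)
  qed
  also have "\<dots> \<ge> (\<Sum>i\<in>UNIV. ((LINT \<omega>|\<Omega>. f i t (x i t \<omega>) - f i t (y t)) - F2 * (2 * \<delta> t + R * \<xi> t)) + (\<Sum>k<m i. - (F2 * (2 * \<delta> t + R * \<xi> t) * B)))"
    by (intro sum_mono add_mono ef_le eg_le) auto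
  also have "(\<Sum>i\<in>UNIV. ((LINT \<omega>|\<Omega>. f i t (x i t \<omega>) - f i t (y t)) - F2 * (2 * \<delta> t + R * \<xi> t)) + (\<Sum>k<m i. - (F2 * (2 * \<delta> t + R * \<xi> t) * B)))
     = (\<Sum>i\<in>UNIV. LINT \<omega>|\<Omega>. f i t (x i t \<omega>) - f i t (y t)) - (real CARD('n) * (F2 * (2 * \<delta> t + R * \<xi> t)) + M * (F2 * (2 * \<delta> t + R * \<xi> t) * B))"
    by (simp add: sum.distrib sum_subtractf sum_negf M_def sum_distrib_right)
  also have "real CARD('n) * (F2 * (2 * \<delta> t + R * \<xi> t)) + M * (F2 * (2 * \<delta> t + R * \<xi> t) * B) = bias t"
    by (simp add: bias_def B_def algebra_simps)
  finally show "(\<Sum>i\<in>UNIV. LINT \<omega>|\<Omega>. f i t (x i t \<omega>) - f i t (y t)) - bias t \<le> (LINT \<omega>|\<Omega>. gap_at c t \<omega>)" .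
qed

text \<open>The choice \<open>H = CARD('n) * F2\<close> in the single-run bound makes the
  disagreement in \<open>net_reg_le\<close> cancel before expectations are taken.\<close>

theorem expected_regret:
  assumes T: "T \<ge> 1" and y: "y \<in> feasible_seqs X m g T"
  defines "c \<equiv> \<lambda>t. (1 - \<xi> t) *\<^sub>R y t"
  shows "real CARD('n) * (LINT \<omega>|\<Omega>. net_reg f T (\<lambda>i t. x i t \<omega>) y) + (LINT \<omega>|\<Omega>. energy_at T \<omega>)
    \<le> err ((G + real CARD('n) * F2) * move_const) c T + (\<Sum>t=1..T. bias t)"
proof -
  have yX: "y t \<in> X" and y0: "k < m i \<Longrightarrow> viol i t (y t) k = 0" if "1 \<le> t" "t \<le> T" for t i k
    using y that by (auto simp: feasible_seqs_def viol_def)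
  have cXs: "c t \<in> Xs t" if "1 \<le> t" "t \<le> T" for t using yX[OF that] by (auto simp: c_def Xs_def)
  note gap = expected_gap[where y=y and c=c, OF _ yX y0]
  have gap_int: "integrable \<Omega> (gap_at c t)" if "t \<in> {1..T}" for t
    using gap(1)[of t] that by (auto simp: c_def)
  let ?D = "\<lambda>\<omega>. \<Sum>t=1..T. \<Sum>i\<in>UNIV. f i t (x i t \<omega>) - f i t (y t)"
  let ?N = "\<lambda>\<omega>. net_reg f T (\<lambda>i t. x i t \<omega>) y"
  have D_int: "integrable \<Omega> ?D"
    using integrable_f by (intro Bochner_Integration.integrable_sum Bochner_Integration.integrable_diff) auto
  have D_eq: "(LINT \<omega>|\<Omega>. ?D \<omega>) = (\<Sum>t=1..T. \<Sum>i\<in>UNIV. LINT \<omega>|\<Omega>. f i t (x i t \<omega>) - f i t (y t))"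
    using integrable_f by (subst Bochner_Integration.integral_sum; (intro sum.cong refl Bochner_Integration.integral_sum Bochner_Integration.integrable_sum)?) auto
  have pointwise: "real CARD('n) * ?N \<omega> + energy_at T \<omega> + (\<Sum>t=1..T. gap_at c t \<omega>) - ?D \<omega> \<le> err ((G + real CARD('n) * F2) * move_const) c T"
    if "\<omega> \<in> space \<Omega>" for \<omega>
    using bandit_run.net_reg_le[where y=y and T=T, OF bandit_run_at[OF that] yX]
      bandit_run.regret_run[OF bandit_run_at[OF that] T cXs, of "real CARD('n) * F2"] F2_nonneg by simp
  have int: "integrable \<Omega> (\<lambda>\<omega>. \<Sum>t=1..T. gap_at c t \<omega>)"
    by (intro Bochner_Integration.integrable_sum gap_int)
  have "(LINT \<omega>|\<Omega>. real CARD('n) * ?N \<omega> + energy_at T \<omega> + (\<Sum>t=1..T. gap_at c t \<omega>) - ?D \<omega>) \<le> (LINT \<omega>|\<Omega>. err ((G + real CARD('n) * F2) * move_const) c T)"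
    by (rule integral_mono) (use integrable_net_reg integrable_energy int D_int pointwise in auto)
  then have "real CARD('n) * (LINT \<omega>|\<Omega>. ?N \<omega>) + (LINT \<omega>|\<Omega>. energy_at T \<omega>) + (LINT \<omega>|\<Omega>. (\<Sum>t=1..T. gap_at c t \<omega>)) - (LINT \<omega>|\<Omega>. ?D \<omega>) \<le> err ((G + real CARD('n) * F2) * move_const) c T"
    using integrable_net_reg integrable_energy int D_int by (simp add: prob_space)
  moreover have "(LINT \<omega>|\<Omega>. (\<Sum>t=1..T. gap_at c t \<omega>)) = (\<Sum>t=1..T. LINT \<omega>|\<Omega>. gap_at c t \<omega>)"
    by (rule Bochner_Integration.integral_sum[OF gap_int])
  moreover have "(LINT \<omega>|\<Omega>. ?D \<omega>) - (\<Sum>t=1..T. bias t) \<le> (\<Sum>t=1..T. LINT \<omega>|\<Omega>. gap_at c t \<omega>)"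
    unfolding D_eq sum_subtractf[symmetric] by (intro sum_mono gap(2)) (auto simp: c_def)
  ultimately show ?thesis by linarith
qed

lemma expected_regret_le:
  assumes T: "T \<ge> 1" and y: "y \<in> feasible_seqs X m g T"
  shows "(LINT \<omega>|\<Omega>. net_reg f T (\<lambda>i t. x i t \<omega>) y)
    \<le> err ((G + real CARD('n) * F2) * move_const) (\<lambda>t. (1 - \<xi> t) *\<^sub>R y t) T + (\<Sum>t=1..T. bias t)"
    (is "?E \<le> ?b")
proof (cases "?E \<le> 0")
  case False
  have "(LINT \<omega>|\<Omega>. energy_at T \<omega>) \<ge> 0"
    by (intro integral_nonneg_AE AE_I2) (rule bandit_run.energy_nonneg[OF bandit_run_at])
  moreover have "?E \<le> real CARD('n) * ?E" using False by (simp add: Suc_leI)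
  ultimately show ?thesis using expected_regret[OF T y] by linarith
next
  case True
  have "0 \<le> ?b"
    unfolding err_def bias_def
    using \<alpha>_pos[THEN less_imp_le] \<beta>_pos[THEN less_imp_le] \<gamma>_pos[THEN less_imp_le] \<tau>_nonneg \<xi>_bounds(1)[THEN less_imp_le] \<delta>_bounds(1)[THEN less_imp_le]
      G_nonneg F2_nonneg move_const_nonneg M_nonneg dual_bound_nonneg X_facts(4)
    by (intro add_nonneg_nonneg mult_nonneg_nonneg sum_nonneg divide_nonneg_nonneg) auto
  then show ?thesis using True by linarith
qed

text \<open>The same inequality solved for the energy, with the regret replaced by its lower bound
  \<open>- (T * F1)\<close>.\<close>

theorem expected_energy:
  assumes T: "T \<ge> 1" and y: "y \<in> feasible_seqs X m g T"
  shows "(LINT \<omega>|\<Omega>. energy_at T \<omega>)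
    \<le> err ((G + real CARD('n) * F2) * move_const) (\<lambda>t. (1 - \<xi> t) *\<^sub>R y t) T + (\<Sum>t=1..T. bias t) + real CARD('n) * (real T * F1)"
proof -
  have yX: "y t \<in> X" if "1 \<le> t" "t \<le> T" for t using y that by (auto simp: feasible_seqs_def)
  have "(LINT \<omega>|\<Omega>. - (real T * F1)) \<le> (LINT \<omega>|\<Omega>. net_reg f T (\<lambda>i t. x i t \<omega>) y)"
  proof (rule integral_mono[OF _ integrable_net_reg])
    fix \<omega> assume \<omega>: "\<omega> \<in> space \<Omega>"
    show "- (real T * F1) \<le> net_reg f T (\<lambda>i t. x i t \<omega>) y"
      using bandit_run.net_reg_abs_le[where y=y and T=T, OF bandit_run_at[OF \<omega>] yX] by linarith
  qed simp
  then have "- (real T * F1) \<le> (LINT \<omega>|\<Omega>. net_reg f T (\<lambda>i t. x i t \<omega>) y)" by (simp add: prob_space)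
  then have "real CARD('n) * - (real T * F1) \<le> real CARD('n) * (LINT \<omega>|\<Omega>. net_reg f T (\<lambda>i t. x i t \<omega>) y)"
    by (rule mult_left_mono) simp
  then show ?thesis using expected_regret[OF T y] by simp
qed

theorem expected_ccv:
  assumes pos: "\<nu> > 0" "\<mu> > 0"
  shows "(LINT \<omega>|\<Omega>. net_ccv m g T (\<lambda>i t. x i t \<omega>)) \<le> M * \<nu> / 2 * (1 / \<gamma> (T + 1) + (\<Sum>t=1..T. \<beta> (t + 1)))
     + ccv_const * (1 + (\<Sum>t=1..T. \<tau> t)) + ccv_const * real CARD('n) * \<mu> * (\<Sum>t=1..T. \<alpha> (t + 1))
     + (1 / \<nu> + ccv_const / \<mu>) * (LINT \<omega>|\<Omega>. energy_at T \<omega>)" (is "?L \<le> ?a + ?c * _")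
proof -
  have "?L \<le> (LINT \<omega>|\<Omega>. ?a + ?c * energy_at T \<omega>)"
    by (rule integral_mono[OF integrable_net_ccv])
       (use integrable_energy[of T] bandit_run.ccv_run[OF bandit_run_at pos] in auto)
  then show ?thesis using integrable_energy[of T] by (simp add: prob_space)
qed

end

section \<open>Rates for the prescribed step sizes\<close>

lemma powr_increment_ge:
  assumes a: "0 < a" "a < 1"
  shows "a * (real t + 1) powr (a - 1) \<le> (real t + 1) powr a - real t powr a"
proof (cases "t = 0")
  case True then show ?thesis using a by simp
next
  case False
  have "\<exists>z. real t < z \<and> z < real t + 1 \<and> (real t + 1) powr a - real t powr a = (real t + 1 - real t) * (a * z powr (a - 1))"
    using False by (intro MVT2) (auto intro!: derivative_eq_intros)
  then obtain z where z: "real t < z" "z < real t + 1" "(real t + 1) powr a - real t powr a = a * z powr (a - 1)" by auto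
  have "(real t + 1) powr (a - 1) \<le> z powr (a - 1)"
    using z a by (intro powr_mono2') auto
  then show ?thesis using a z(3) by simp
qed

lemma sum_powr_le:
  assumes a: "0 < a" "a < 1"
  shows "(\<Sum>t=1..T. real t powr (a - 1)) \<le> real T powr a / a"
proof (induction T)
  case (Suc T)
  have "real (Suc T) powr (a - 1) \<le> (real (Suc T) powr a - real T powr a) / a"
    using powr_increment_ge[OF a, of T] a by (simp add: pos_le_divide_eq mult.commute add.commute)
  then show ?case using Suc by (simp add: diff_divide_distrib)
qed simp

text \<open>Write the power as \<open>t * t powr (- a)\<close>, where the second factor decreases.
  This is the condition \<open>\<gamma>_step\<close> for the prescribed \<beta> and
  \<gamma>.\<close>

lemma powr_Suc_diff_le:
  assumes "t \<ge> 1" "0 < a" "a < 1"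
  shows "real (t + 1) powr (1 - a) - real t powr (1 - a) \<le> real (t + 1) powr (- a)"
proof -
  have 1: "real s powr (1 - a) = real s * real s powr (- a)" if "s \<ge> 1" for s
    using that by (simp add: powr_mult_base)
  have "real t * real (t + 1) powr (- a) \<le> real t * real t powr (- a)"
    using assms by (intro mult_left_mono powr_mono2') auto
  then show ?thesis using 1[of t] 1[of "t + 1"] assms by (simp add: algebra_simps)
qed

lemma sum_inverse_sqrt_le: "(\<Sum>t=1..T. 1 / sqrt (real t)) \<le> 2 * sqrt (real T)"
proof -
  have eq: "1 / sqrt (real t) = real t powr (1 / 2 - 1)" if "t \<ge> 1" for t
    using that by (simp add: powr_minus_divide powr_half_sqrt)
  have "(\<Sum>t=1..T. 1 / sqrt (real t)) = (\<Sum>t=1..T. real t powr (1 / 2 - 1))"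
    using eq by (intro sum.cong) auto
  also have "\<dots> \<le> real T powr (1 / 2) / (1 / 2)" by (rule sum_powr_le) auto
  also have "\<dots> = 2 * sqrt (real T)" by (simp add: powr_half_sqrt)
  finally show ?thesis .
qed

text \<open>\<open>\<alpha> t\<close> is the square root of the running average of the thresholds,
  and the average of a non-increasing sequence is non-increasing. The initial value 1 gives
  \<open>1 \<le> \<Psi> t\<close> and \<open>\<Psi> t \<le> t\<close>.\<close>

locale trigger_schedule =
  fixes \<tau> \<Psi> \<alpha> :: "nat \<Rightarrow> real"
  assumes \<tau>_1: "\<tau> 1 = 1" and \<tau>_pos: "\<And>t. t \<ge> 1 \<Longrightarrow> \<tau> t > 0" and \<tau>_dec: "\<And>s t. 1 \<le> s \<Longrightarrow> s \<le> t \<Longrightarrow> \<tau> t \<le> \<tau> s"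
    and \<Psi>: "\<And>t. t \<ge> 1 \<Longrightarrow> \<Psi> t = (\<Sum>k=1..t. \<tau> k)"
    and \<alpha>: "\<And>t. t \<ge> 1 \<Longrightarrow> \<alpha> t = sqrt (\<Psi> t / real t)"
begin

lemma \<Psi>_ge: "t \<ge> 1 \<Longrightarrow> real t * \<tau> t \<le> \<Psi> t"
  unfolding \<Psi> using sum_mono[of "{1..t}" "\<lambda>_. \<tau> t" \<tau>] \<tau>_dec by simp

lemma \<Psi>_le: "t \<ge> 1 \<Longrightarrow> \<Psi> t \<le> real t"
  unfolding \<Psi> using sum_mono[of "{1..t}" \<tau> "\<lambda>_. 1"] \<tau>_dec[of 1] \<tau>_1 by simp

lemma \<Psi>_Suc: "t \<ge> 1 \<Longrightarrow> \<Psi> (t + 1) = \<Psi> t + \<tau> (t + 1)"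
  by (simp add: \<Psi>)

lemma \<Psi>_mono: "1 \<le> s \<Longrightarrow> s \<le> t \<Longrightarrow> \<Psi> s \<le> \<Psi> t"
  using \<tau>_pos[THEN less_imp_le] by (subst (1 2) \<Psi>) (auto intro!: sum_mono2)

lemma \<Psi>_ge_1: "t \<ge> 1 \<Longrightarrow> \<Psi> t \<ge> 1"
  using \<Psi>_mono[of 1 t] \<Psi>[of 1] \<tau>_1 by simp

lemma \<alpha>_pos: "t \<ge> 1 \<Longrightarrow> \<alpha> t > 0"
  using \<Psi>_ge_1[of t] by (simp add: \<alpha>)

lemma \<alpha>_dec: assumes "t \<ge> 1" shows "\<alpha> (t + 1) \<le> \<alpha> t"
proof -
  have "real t * \<tau> (t + 1) \<le> \<Psi> t"
    by (rule order_trans[OF mult_left_mono[OF \<tau>_dec[of t "t + 1"]] \<Psi>_ge[OF assms]]) (use assms in auto)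
  then have "\<Psi> (t + 1) / real (t + 1) \<le> \<Psi> t / real t"
    using assms \<Psi>_Suc[OF assms] by (simp add: divide_simps algebra_simps)
  then show ?thesis using assms by (simp add: \<alpha>)
qed

text \<open>For a constant \<alpha> the costs \<open>T * \<alpha>\<close> and
  \<open>\<Psi> T / \<alpha>\<close> balance at \<open>sqrt (\<Psi> T / T)\<close>, and this is
  their common value.\<close>

definition rate :: "nat \<Rightarrow> real" where "rate T = sqrt (real T * \<Psi> T)"

lemma rate_bounds:
  assumes "T \<ge> 1"
  shows "1 \<le> rate T" "\<Psi> T \<le> rate T" "rate T \<le> real T" "sqrt (real T / \<Psi> T) \<le> rate T"
proof -
  have P: "1 \<le> \<Psi> T" "\<Psi> T \<le> real T" "1 \<le> real T" using assms \<Psi>_ge_1 \<Psi>_le by auto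
  have "1 * 1 \<le> real T * \<Psi> T" using P by (intro mult_mono) auto
  then show "1 \<le> rate T" by (simp add: rate_def)
  show "\<Psi> T \<le> rate T"
    unfolding rate_def using P by (intro real_le_rsqrt) (auto simp: power2_eq_square)
  show "rate T \<le> real T"
    unfolding rate_def using P by (intro real_le_lsqrt) (auto simp: power2_eq_square)
  have "real T / \<Psi> T \<le> real T / 1" using P by (intro divide_left_mono) auto
  also have "\<dots> \<le> real T * \<Psi> T" using P by simp
  finally show "sqrt (real T / \<Psi> T) \<le> rate T" by (simp add: rate_def)
qed

lemma sum_\<alpha>_le: "(\<Sum>t=1..T. \<alpha> (t + 1)) \<le> 2 * rate T"
proof -
  have "(\<Sum>t=1..T. \<alpha> (t + 1)) \<le> (\<Sum>t=1..T. sqrt (\<Psi> T) * (1 / sqrt (real t)))"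
  proof (rule sum_mono)
    fix t assume t: "t \<in> {1..T}"
    then have "\<alpha> (t + 1) \<le> \<alpha> t" by (intro \<alpha>_dec) auto
    also have "\<dots> \<le> sqrt (\<Psi> T / real t)"
      using t \<Psi>_mono[of t T] by (auto simp: \<alpha> intro!: divide_right_mono)
    finally show "\<alpha> (t + 1) \<le> sqrt (\<Psi> T) * (1 / sqrt (real t))" by (simp add: real_sqrt_divide)
  qed
  also have "\<dots> \<le> sqrt (\<Psi> T) * (2 * sqrt (real T))"
    unfolding sum_distrib_left[symmetric]
  proof (cases "T = 0")
    case False
    then show "sqrt (\<Psi> T) * (\<Sum>t=1..T. 1 / sqrt (real t)) \<le> sqrt (\<Psi> T) * (2 * sqrt (real T))"
      using \<Psi>_ge_1[of T] by (intro mult_left_mono sum_inverse_sqrt_le) auto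
  qed simp
  finally show ?thesis by (simp add: rate_def real_sqrt_mult mult_ac)
qed

text \<open>A discrete form of integrating \<open>1 / sqrt \<Psi>\<close> with respect to \<Psi>:
  \<tau> is the increment of \<Psi>, and consecutive roots satisfy
  \<open>b\<^sup>2 - a\<^sup>2 \<le> 2 * b * (b - a)\<close>.\<close>

lemma sum_\<tau>_over_sqrt_\<Psi>_le: "T \<ge> 1 \<Longrightarrow> (\<Sum>t=1..T. \<tau> t / sqrt (\<Psi> t)) \<le> 2 * sqrt (\<Psi> T)"
proof (induction T rule: nat_induct_at_least)
  case base
  then show ?case using \<Psi>[of 1] \<tau>_1 by simp
next
  case (Suc T)
  define a b where "a = sqrt (\<Psi> T)" and "b = sqrt (\<Psi> (T + 1))"
  have P: "\<Psi> T \<ge> 1" "\<Psi> (T + 1) \<ge> 1" using \<Psi>_ge_1 Suc.hyps by auto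
  have ab: "0 < a" "0 < b" "a \<le> b" "b\<^sup>2 - a\<^sup>2 = \<tau> (T + 1)"
    using P \<Psi>_Suc[OF Suc.hyps] \<Psi>_mono[of T "T + 1"] Suc.hyps by (auto simp: a_def b_def)
  have "\<tau> (T + 1) = (b - a) * (b + a)" using ab(4) by (simp add: power2_eq_square algebra_simps)
  also have "\<dots> \<le> (b - a) * (2 * b)" using ab by (intro mult_left_mono) auto
  finally have "\<tau> (T + 1) / b \<le> 2 * (b - a)" using ab by (simp add: pos_divide_le_eq mult_ac)
  then show ?case using Suc by (simp add: a_def b_def)
qed

lemma inverse_\<alpha>_Suc_le:
  assumes t: "t \<ge> 1" shows "1 / \<alpha> (t + 1) \<le> 2 * sqrt (real t / \<Psi> t)"
proof -
  have P: "\<Psi> t \<ge> 1" "\<Psi> t \<le> \<Psi> (t + 1)" using \<Psi>_ge_1 \<Psi>_mono t by auto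
  have "1 / \<alpha> (t + 1) = sqrt (real (t + 1) / \<Psi> (t + 1))"
    using t by (simp add: \<alpha> real_sqrt_divide)
  also have "\<dots> \<le> sqrt (4 * (real t / \<Psi> t))"
  proof (rule real_sqrt_le_mono)
    have "real (t + 1) / \<Psi> (t + 1) \<le> real (t + 1) / \<Psi> t"
      using P by (intro divide_left_mono) auto
    also have "\<dots> \<le> 4 * real t / \<Psi> t" using t P by (intro divide_right_mono) auto
    finally show "real (t + 1) / \<Psi> (t + 1) \<le> 4 * (real t / \<Psi> t)" by simp
  qed
  also have "\<dots> = 2 * sqrt (real t / \<Psi> t)" unfolding real_sqrt_mult by simp
  finally show ?thesis .
qed

lemma sum_\<tau>_over_\<alpha>_le:
  assumes "T \<ge> 1" shows "(\<Sum>t=1..T. \<tau> t / \<alpha> (t + 1)) \<le> 4 * rate T"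
proof -
  have "(\<Sum>t=1..T. \<tau> t / \<alpha> (t + 1)) \<le> (\<Sum>t=1..T. 2 * sqrt (real T) * (\<tau> t / sqrt (\<Psi> t)))"
  proof (rule sum_mono)
    fix t assume t: "t \<in> {1..T}"
    have "\<tau> t / \<alpha> (t + 1) \<le> \<tau> t * (2 * sqrt (real t / \<Psi> t))"
      using mult_left_mono[OF inverse_\<alpha>_Suc_le[of t], of "\<tau> t"] \<tau>_pos[of t] t by simp
    also have "\<dots> = 2 * sqrt (real t) * (\<tau> t / sqrt (\<Psi> t))" by (simp add: real_sqrt_divide)
    also have "\<dots> \<le> 2 * sqrt (real T) * (\<tau> t / sqrt (\<Psi> t))"
      using t \<tau>_pos[of t] \<Psi>_ge_1[of t] by (intro mult_right_mono) auto
    finally show "\<tau> t / \<alpha> (t + 1) \<le> 2 * sqrt (real T) * (\<tau> t / sqrt (\<Psi> t))" .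
  qed
  also have "\<dots> \<le> 2 * sqrt (real T) * (2 * sqrt (\<Psi> T))"
    unfolding sum_distrib_left[symmetric] by (intro mult_left_mono sum_\<tau>_over_sqrt_\<Psi>_le assms) auto
  finally show ?thesis by (simp add: rate_def real_sqrt_mult mult_ac)
qed

end

section \<open>Growth of the summed thresholds in the three regimes\<close>

lemma trigger_sum_sub:
  assumes "0 < \<theta>" "\<theta> < 1" "\<And>t. t \<ge> 1 \<Longrightarrow> \<tau> t = 1 / real t powr \<theta>"
  shows "(\<Sum>t=1..T. \<tau> t) \<le> real T powr (1 - \<theta>) / (1 - \<theta>)"
proof -
  have "(\<Sum>t=1..T. \<tau> t) = (\<Sum>t=1..T. real t powr ((1 - \<theta>) - 1))"
    using assms by (intro sum.cong) (auto simp: powr_minus_divide)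
  also have "\<dots> \<le> real T powr (1 - \<theta>) / (1 - \<theta>)" by (rule sum_powr_le) (use assms in auto)
  finally show ?thesis .
qed

text \<open>The upper bound serves the rate, the lower bound the coefficient of the path length,
  which contains \<open>1 / \<Psi> T\<close>.\<close>

lemma trigger_sum_harmonic:
  assumes "T \<ge> 1" "\<And>t. t \<ge> 1 \<Longrightarrow> \<tau> t = 1 / real t"
  shows "ln (real T) \<le> (\<Sum>t=1..T. \<tau> t)" "(\<Sum>t=1..T. \<tau> t) \<le> 1 + ln (real T)"
proof -
  have h: "(\<Sum>t=1..T. \<tau> t) = harm T"
    unfolding harm_def using assms(2) by (intro sum.cong) (auto simp: inverse_eq_divide)
  have "ln (real T) \<le> ln (real T + 1)" using assms(1) by simp
  then show "ln (real T) \<le> (\<Sum>t=1..T. \<tau> t)"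
    unfolding h using harm_ge_ln[of T] by linarith
  have "harm (Suc (T - 1)) - ln (real (Suc (T - 1))) \<le> harm (Suc 0) - ln (real (Suc 0))"
    using decseqD[OF decseq_harm_diff_ln, of 0 "T - 1"] by simp
  then show "(\<Sum>t=1..T. \<tau> t) \<le> 1 + ln (real T)"
    unfolding h using assms(1) by (simp add: harm_def)
qed

lemma trigger_sum_super:
  assumes "\<theta> > 1" "\<And>t. t \<ge> 1 \<Longrightarrow> \<tau> t = 1 / real t powr \<theta>"
  shows "(\<Sum>t=1..T. \<tau> t) \<le> (\<Sum>t. real t powr (- \<theta>))"
proof -
  have "(\<Sum>t=1..T. \<tau> t) = (\<Sum>t=1..T. real t powr (- \<theta>))"
    using assms by (intro sum.cong) (auto simp: powr_minus_divide)
  also have "\<dots> \<le> (\<Sum>t. real t powr (- \<theta>))"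
    using assms summable_real_powr_iff[of "- \<theta>"] by (intro sum_le_suminf) auto
  finally show ?thesis .
qed

locale bandit_schedule = bandit_process X f m g r R F1 F2 W K \<alpha> \<beta> \<gamma> \<tau> \<xi> \<delta> \<Omega> x0 u x xh q
    + sched: trigger_schedule \<tau> \<Psi> \<alpha>
  for X :: "(real^'p::finite) set"
    and f :: "'n::finite \<Rightarrow> nat \<Rightarrow> real^'p \<Rightarrow> real"
    and m g r R F1 F2 W K \<alpha> \<beta> \<gamma> \<tau> \<xi> \<delta> and \<Omega> :: "'w measure" and x0 u x xh q and \<Psi> +
  fixes \<kappa> :: real
  assumes \<kappa>: "0 < \<kappa>" "\<kappa> < 1"
    and \<beta>_eq: "\<And>t. t \<ge> 1 \<Longrightarrow> \<beta> t = 1 / real t powr \<kappa>"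
    and \<gamma>_eq: "\<And>t. t \<ge> 1 \<Longrightarrow> \<gamma> t = 1 / real t powr (1 - \<kappa>)"
    and \<xi>_eq: "\<And>t. t \<ge> 1 \<Longrightarrow> \<xi> t = 1 / (real t + 1)"
begin

abbreviation rate :: "nat \<Rightarrow> real" where "rate \<equiv> sched.rate"

lemma sum_\<gamma>_le: "(\<Sum>t=1..T. \<gamma> (t + 1)) \<le> real T powr \<kappa> / \<kappa>"
proof -
  have "(\<Sum>t=1..T. \<gamma> (t + 1)) \<le> (\<Sum>t=1..T. real t powr (\<kappa> - 1))"
  proof (rule sum_mono)
    fix t assume t: "t \<in> {1..T}"
    then have "\<gamma> (t + 1) \<le> \<gamma> t" by (intro \<gamma>_mono) auto
    also have "\<gamma> t = real t powr (\<kappa> - 1)"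
      using t by (simp add: \<gamma>_eq powr_minus_divide[symmetric])
    finally show "\<gamma> (t + 1) \<le> real t powr (\<kappa> - 1)" .
  qed
  also have "\<dots> \<le> real T powr \<kappa> / \<kappa>" by (rule sum_powr_le[OF \<kappa>])
  finally show ?thesis .
qed

lemma sum_\<beta>_le: "(\<Sum>t=1..T. \<beta> (t + 1)) \<le> real T powr (1 - \<kappa>) / (1 - \<kappa>)"
proof -
  have "(\<Sum>t=1..T. \<beta> (t + 1)) \<le> (\<Sum>t=1..T. real t powr ((1 - \<kappa>) - 1))"
  proof (rule sum_mono)
    fix t assume t: "t \<in> {1..T}"
    then have "\<beta> (t + 1) \<le> \<beta> t" by (intro \<beta>_mono) auto
    also have "\<beta> t = real t powr ((1 - \<kappa>) - 1)"
      using t by (simp add: \<beta>_eq powr_minus_divide[symmetric])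
    finally show "\<beta> (t + 1) \<le> real t powr ((1 - \<kappa>) - 1)" .
  qed
  also have "\<dots> \<le> real T powr (1 - \<kappa>) / (1 - \<kappa>)" by (rule sum_powr_le) (use \<kappa> in auto)
  finally show ?thesis .
qed

definition bias_const :: real where "bias_const = F2 * (2 * r + R) * (real CARD('n) + M * dual_bound)"

lemma bias_const_nonneg: "bias_const \<ge> 0"
  using F2_nonneg X_facts(3,4) M_nonneg dual_bound_nonneg by (simp add: bias_const_def)

text \<open>\<delta> and \<xi> contribute \<open>1 / t\<close> and the bound on \<open>q\<close>
  contributes \<open>t powr \<kappa>\<close>, so the summands are of order
  \<open>t powr (\<kappa> - 1)\<close>.\<close>

lemma sum_bias_le: "(\<Sum>t=1..T. bias t) \<le> bias_const / \<kappa> * real T powr \<kappa>"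
proof -
  have "(\<Sum>t=1..T. bias t) \<le> (\<Sum>t=1..T. bias_const * real t powr (\<kappa> - 1))"
  proof (rule sum_mono)
    fix t assume t: "t \<in> {1..T}"
    then have t1: "t \<ge> 1" by simp
    have tk: "1 \<le> real t powr \<kappa>" using t1 \<kappa> by (simp add: ge_one_powr_ge_zero)
    have x: "\<xi> t \<le> 1 / real t" "0 \<le> \<xi> t" using t1 by (auto simp: \<xi>_eq frac_le)
    have "2 * \<delta> t + R * \<xi> t \<le> (2 * r + R) * \<xi> t"
      using \<delta>_bounds(2)[OF t1] by (simp add: algebra_simps)
    also have "\<dots> \<le> (2 * r + R) * (1 / real t)"
      using x X_facts(3,4) by (intro mult_left_mono) auto
    finally have 1: "2 * \<delta> t + R * \<xi> t \<le> (2 * r + R) * (1 / real t)" .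
    have "real CARD('n) + M * (dual_bound / \<beta> t) \<le> real CARD('n) * real t powr \<kappa> + M * dual_bound * real t powr \<kappa>"
      using tk t1 by (simp add: \<beta>_eq mult_le_cancel_left1)
    then have 2: "real CARD('n) + M * (dual_bound / \<beta> t) \<le> (real CARD('n) + M * dual_bound) * real t powr \<kappa>"
      by (simp add: algebra_simps)
    have "bias t \<le> F2 * ((2 * r + R) * (1 / real t)) * ((real CARD('n) + M * dual_bound) * real t powr \<kappa>)"
      unfolding bias_def
      using 1 2 F2_nonneg X_facts(3,4) M_nonneg dual_bound_nonneg \<beta>_pos[OF t1] by (intro mult_mono mult_left_mono) auto
    also have "\<dots> = bias_const * (real t powr \<kappa> / real t)" by (simp add: bias_const_def)
    also have "real t powr \<kappa> / real t = real t powr (\<kappa> - 1)"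
      using t1 by (simp add: powr_diff)
    finally show "bias t \<le> bias_const * real t powr (\<kappa> - 1)" .
  qed
  also have "\<dots> = bias_const * (\<Sum>t=1..T. real t powr (\<kappa> - 1))" by (simp add: sum_distrib_left)
  also have "\<dots> \<le> bias_const * (real T powr \<kappa> / \<kappa>)"
    by (intro mult_left_mono sum_powr_le \<kappa> bias_const_nonneg)
  finally show ?thesis by simp
qed

text \<open>Consecutive shrinking factors differ by \<open>\<xi> t - \<xi> (t + 1)\<close>. These
  differences telescope to less than 1, so shrinking costs a single extra \<open>R\<close>.\<close>

lemma path_shrunk_le:
  assumes y: "\<And>t. 1 \<le> t \<Longrightarrow> t \<le> T \<Longrightarrow> y t \<in> X"
  shows "(\<Sum>t=1..T-1. norm ((1 - \<xi> (t + 1)) *\<^sub>R y (t + 1) - (1 - \<xi> t) *\<^sub>R y t)) \<le> path_length T y + R"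
proof -
  have "norm ((1 - \<xi> (t + 1)) *\<^sub>R y (t + 1) - (1 - \<xi> t) *\<^sub>R y t) \<le> norm (y (t + 1) - y t) + (\<xi> t - \<xi> (t + 1)) * R"
    if t: "t \<in> {1..T-1}" for t
  proof -
    have x: "0 < \<xi> (t + 1)" "\<xi> (t + 1) < 1" "\<xi> (t + 1) \<le> \<xi> t"
      using t \<xi>_bounds[of "t + 1"] \<xi>_mono[of t] by auto
    have "(1 - \<xi> (t + 1)) *\<^sub>R y (t + 1) - (1 - \<xi> t) *\<^sub>R y t =
        (1 - \<xi> (t + 1)) *\<^sub>R (y (t + 1) - y t) + (\<xi> t - \<xi> (t + 1)) *\<^sub>R y t" by (simp add: algebra_simps)
    also have "norm \<dots> \<le> (1 - \<xi> (t + 1)) * norm (y (t + 1) - y t) + (\<xi> t - \<xi> (t + 1)) * norm (y t)"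
      using x by (intro norm_triangle_mono) auto
    also have "\<dots> \<le> 1 * norm (y (t + 1) - y t) + (\<xi> t - \<xi> (t + 1)) * R"
      using x t norm_X[OF y, of t] by (intro add_mono mult_right_mono mult_left_mono) auto
    finally show ?thesis by simp
  qed
  then have "(\<Sum>t=1..T-1. norm ((1 - \<xi> (t + 1)) *\<^sub>R y (t + 1) - (1 - \<xi> t) *\<^sub>R y t)) \<le>
      (\<Sum>t=1..T-1. norm (y (t + 1) - y t) + (\<xi> t - \<xi> (t + 1)) * R)"
    by (rule sum_mono)
  also have "\<dots> = path_length T y + (\<Sum>t=1..T-1. \<xi> t - \<xi> (t + 1)) * R"
    by (simp add: path_length_def sum.distrib sum_distrib_right)
  also have "(\<Sum>t=1..N. \<xi> t - \<xi> (t + 1)) = \<xi> 1 - \<xi> (N + 1)" for N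
    by (induction N) auto
  also have "(\<xi> 1 - \<xi> (T - 1 + 1)) * R \<le> 1 * R"
    using \<xi>_bounds[of 1] \<xi>_bounds[of "T - 1 + 1"] X_facts(4) by (intro mult_right_mono) auto
  finally show ?thesis by simp
qed

lemma path_length_nonneg: "path_length T y \<ge> 0"
  by (simp add: path_length_def sum_nonneg)

proposition err_rate:
  assumes N: "N \<ge> 0"
  shows "\<exists>C\<ge>0. \<forall>T\<ge>1. \<forall>y\<in>feasible_seqs X m g T.
    err N (\<lambda>t. (1 - \<xi> t) *\<^sub>R y t) T + (\<Sum>t=1..T. bias t) \<le> C * (rate T + real T powr \<kappa> + sqrt (real T / \<Psi> T) * path_length T y)"
proof -
  let ?n = "real CARD('n)"
  \<comment> \<open>Of the two equal last summands, one comes from the initial distance and the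
    other from the extra \<open>R\<close> in the length of the shrunken path.\<close>
  define A where "A = 2 * N + 2 * N\<^sup>2 * ?n + 12 * R * ?n + 4 * R\<^sup>2 * ?n + 4 * R\<^sup>2 * ?n"
  define B where "B = 2 * dual_bound\<^sup>2 * M / \<kappa> + bias_const / \<kappa>"
  define D where "D = 4 * R * ?n"
  have R: "R \<ge> 0" using X_facts(4) by simp
  have A: "A \<ge> 0" using N R by (simp add: A_def)
  have B: "B \<ge> 0" using M_nonneg bias_const_nonneg \<kappa> by (simp add: B_def)
  have D: "D \<ge> 0" using R by (simp add: D_def)
  show ?thesis
  proof (intro exI[of _ "A + B + D"] conjI allI impI ballI)
    fix T :: nat and y assume T: "T \<ge> 1" and y: "y \<in> feasible_seqs X m g T"
    define P where "P = path_length T y"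
    define z where "z = sqrt (real T / \<Psi> T)"
    have P0: "P \<ge> 0" unfolding P_def by (rule path_length_nonneg)
    have z0: "0 \<le> z" using sched.\<Psi>_ge_1[OF T] by (simp add: z_def)
    note rb = sched.rate_bounds[OF T]
    have yX: "y t \<in> X" if "1 \<le> t" "t \<le> T" for t using y that by (auto simp: feasible_seqs_def)
    have ia: "1 / \<alpha> (T + 1) \<le> 2 * z" unfolding z_def by (rule sched.inverse_\<alpha>_Suc_le[OF T])
    have ia0: "0 \<le> 1 / \<alpha> (T + 1)" using \<alpha>_pos[of "T + 1"] by simp
    have 1: "N * (1 + (\<Sum>t=1..T. \<tau> t)) \<le> N * (2 * rate T)"
      using rb N sched.\<Psi>[OF T] by (intro mult_left_mono) auto
    have 2: "N\<^sup>2 * ?n * (\<Sum>t=1..T. \<alpha> (t + 1)) \<le> N\<^sup>2 * ?n * (2 * rate T)"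
      by (intro mult_left_mono sched.sum_\<alpha>_le) auto
    have 3: "3 * R * ?n * (\<Sum>t=1..T. \<tau> t / \<alpha> (t + 1)) \<le> 3 * R * ?n * (4 * rate T)"
      using R by (intro mult_left_mono sched.sum_\<tau>_over_\<alpha>_le T) auto
    have 4: "2 * dual_bound\<^sup>2 * M * (\<Sum>t=1..T. \<gamma> (t + 1)) \<le> 2 * dual_bound\<^sup>2 * M * (real T powr \<kappa> / \<kappa>)"
      using M_nonneg by (intro mult_left_mono sum_\<gamma>_le) auto
    have "2 * R\<^sup>2 * ?n * (1 / \<alpha> (T + 1)) \<le> 2 * R\<^sup>2 * ?n * (2 * rate T)"
      using ia rb(4) by (intro mult_left_mono) (auto simp: z_def)
    then have 5: "2 * R\<^sup>2 * ?n / \<alpha> (T + 1) \<le> 2 * R\<^sup>2 * ?n * (2 * rate T)" by simp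
    have "2 * R * ?n * (1 / \<alpha> (T + 1)) * (\<Sum>t=1..T-1. norm ((1 - \<xi> (t + 1)) *\<^sub>R y (t + 1) - (1 - \<xi> t) *\<^sub>R y t)) \<le> 2 * R * ?n * (2 * z) * (P + R)"
      unfolding P_def using R ia ia0 z0 by (intro mult_mono path_shrunk_le yX mult_left_mono) (auto intro!: sum_nonneg mult_nonneg_nonneg)
    also have "\<dots> = D * (z * P) + 4 * R\<^sup>2 * ?n * z" by (simp add: D_def power2_eq_square algebra_simps)
    also have "4 * R\<^sup>2 * ?n * z \<le> 4 * R\<^sup>2 * ?n * rate T"
      using rb(4) by (intro mult_left_mono) (auto simp: z_def)
    finally have 6: "2 * R * ?n / \<alpha> (T + 1) * (\<Sum>t=1..T-1. norm ((1 - \<xi> (t + 1)) *\<^sub>R y (t + 1) - (1 - \<xi> t) *\<^sub>R y t))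
      \<le> D * (z * P) + 4 * R\<^sup>2 * ?n * rate T" by simp
    have "err N (\<lambda>t. (1 - \<xi> t) *\<^sub>R y t) T + (\<Sum>t=1..T. bias t) \<le> A * rate T + B * real T powr \<kappa> + D * (z * P)"
    proof -
      have "A * rate T + B * real T powr \<kappa> + D * (z * P) = N * (2 * rate T) + N\<^sup>2 * ?n * (2 * rate T) + 3 * R * ?n * (4 * rate T)
          + 2 * dual_bound\<^sup>2 * M * (real T powr \<kappa> / \<kappa>) + 2 * R\<^sup>2 * ?n * (2 * rate T) + (D * (z * P) + 4 * R\<^sup>2 * ?n * rate T) + bias_const / \<kappa> * real T powr \<kappa>"
        unfolding A_def B_def by (simp add: algebra_simps)
      then show ?thesis using 1 2 3 4 5 6 sum_bias_le[of T] unfolding err_def by linarith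
    qed
    also have "\<dots> \<le> (A + B + D) * rate T + (A + B + D) * real T powr \<kappa> + (A + B + D) * (z * P)"
      using A B D rb P0 z0 by (intro add_mono mult_right_mono) auto
    finally show "err N (\<lambda>t. (1 - \<xi> t) *\<^sub>R y t) T + (\<Sum>t=1..T. bias t) \<le> (A + B + D) * (rate T + real T powr \<kappa> + sqrt (real T / \<Psi> T) * path_length T y)"
      by (simp add: algebra_simps P_def z_def)
  qed (use A B D in simp)
qed

lemma N_nonneg: "(G + real CARD('n) * F2) * move_const \<ge> 0"
  using G_nonneg F2_nonneg move_const_nonneg by simp

theorem regret_rate:
  "\<exists>C\<ge>0. \<forall>T\<ge>1. \<forall>y\<in>feasible_seqs X m g T.
    (LINT \<omega>|\<Omega>. net_reg f T (\<lambda>i t. x i t \<omega>) y) \<le> C * (rate T + real T powr \<kappa> + sqrt (real T / \<Psi> T) * path_length T y)"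
  using err_rate[OF N_nonneg] expected_regret_le by (meson order_trans)

text \<open>No comparator occurs in the violation, so the energy is bounded with a static feasible
  sequence. Its path length is 0, which leaves an energy of order \<open>T\<close>.\<close>

theorem ccv_rate:
  assumes feas: "feasibility_assm X m g"
  shows "\<exists>C\<ge>0. \<forall>T\<ge>1. (LINT \<omega>|\<Omega>. net_ccv m g T (\<lambda>i t. x i t \<omega>)) \<le> C * (real T powr (1 - \<kappa> / 2) + sqrt (real T * rate T))"
proof -
  let ?n = "real CARD('n)"
  obtain C where C: "C \<ge> 0" and err: "\<And>T y. T \<ge> 1 \<Longrightarrow> y \<in> feasible_seqs X m g T \<Longrightarrow>
    err ((G + ?n * F2) * move_const) (\<lambda>t. (1 - \<xi> t) *\<^sub>R y t) T + (\<Sum>t=1..T. bias t) \<le> C * (rate T + real T powr \<kappa> + sqrt (real T / \<Psi> T) * path_length T y)"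
    using err_rate[OF N_nonneg] by blast
  define CE where "CE = 2 * C + ?n * F1"
  have CE: "CE \<ge> 0" using C F1_nonneg by (simp add: CE_def)
  have energy: "(LINT \<omega>|\<Omega>. energy_at T \<omega>) \<le> CE * real T" if T: "T \<ge> 1" for T
  proof -
    obtain y v where y: "y \<in> feasible_seqs X m g T" and v: "\<And>t. y t = v"
      using feas T unfolding feasibility_assm_def feasible_static_seqs_def by blast
    have P: "path_length T y = 0" by (simp add: path_length_def v)
    have "real T powr \<kappa> \<le> real T powr 1" using T \<kappa> by (intro powr_mono) auto
    then have "C * (rate T + real T powr \<kappa>) \<le> C * (2 * real T)"
      using sched.rate_bounds(3)[OF T] C T by (intro mult_left_mono) auto
    then show ?thesis
      using expected_energy[OF T y] err[OF T y] unfolding P by (simp add: CE_def algebra_simps)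
  qed
  define A where "A = M / 2 * (2 + 1 / (1 - \<kappa>)) + CE"
  define B where "B = 2 * ccv_const + 2 * ccv_const * ?n + ccv_const * CE"
  have A: "A \<ge> 0" using M_nonneg CE \<kappa> by (simp add: A_def)
  have B: "B \<ge> 0" using ccv_const_nonneg CE by (simp add: B_def)
  show ?thesis
  proof (intro exI[of _ "A + B"] conjI allI impI)
    fix T :: nat assume T: "T \<ge> 1"
    note rb = sched.rate_bounds[OF T]
    \<comment> \<open>Balances \<open>\<nu> * T powr (1 - \<kappa>)\<close> against the energy share
      \<open>T / \<nu>\<close>; both equal \<open>T powr (1 - \<kappa> / 2)\<close>.\<close>
    define \<nu> where "\<nu> = real T powr (\<kappa> / 2)"
    \<comment> \<open>Balances \<open>\<mu> * rate T\<close> against \<open>T / \<mu>\<close>; both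
      equal \<open>sqrt (T * rate T)\<close>.\<close>
    define \<mu> where "\<mu> = sqrt (real T / rate T)"
    define s where "s = sqrt (real T * rate T)"
    have T0: "real T > 0" using T by simp
    have r0: "rate T > 0" using rb(1) by simp
    have \<nu>: "\<nu> > 0" using T by (simp add: \<nu>_def)
    have \<mu>: "\<mu> > 0" using T0 r0 by (simp add: \<mu>_def)
    have s: "rate T \<le> s"
      unfolding s_def using rb(3) r0 by (intro real_le_rsqrt) (auto simp: power2_eq_square)
    have \<mu>s: "\<mu> * rate T = s" "real T / \<mu> = s"
      using T0 r0 unfolding \<mu>_def s_def by (auto simp: real_sqrt_divide real_sqrt_mult field_simps)
    have \<nu>T: "\<nu> * real T powr (1 - \<kappa>) = real T powr (1 - \<kappa> / 2)" "real T / \<nu> = real T powr (1 - \<kappa> / 2)"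
    proof -
      show "\<nu> * real T powr (1 - \<kappa>) = real T powr (1 - \<kappa> / 2)"
        unfolding \<nu>_def powr_add[symmetric] by (simp add: field_simps)
      show "real T / \<nu> = real T powr (1 - \<kappa> / 2)"
        unfolding \<nu>_def powr_diff using T by simp
    qed
    have "1 / \<gamma> (T + 1) \<le> 2 * real T powr (1 - \<kappa>)"
    proof -
      have "1 / \<gamma> (T + 1) = real (T + 1) powr (1 - \<kappa>)" by (simp add: \<gamma>_eq)
      also have "\<dots> \<le> (2 * real T) powr (1 - \<kappa>)" using T \<kappa> by (intro powr_mono2) auto
      also have "\<dots> = 2 powr (1 - \<kappa>) * real T powr (1 - \<kappa>)" by (simp add: powr_mult)
      also have "\<dots> \<le> 2 powr 1 * real T powr (1 - \<kappa>)"
        using \<kappa> by (intro mult_right_mono powr_mono) auto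
      finally show ?thesis by simp
    qed
    then have "1 / \<gamma> (T + 1) + (\<Sum>t=1..T. \<beta> (t + 1)) \<le> (2 + 1 / (1 - \<kappa>)) * real T powr (1 - \<kappa>)"
      using sum_\<beta>_le[of T] by (simp add: algebra_simps)
    then have "M * \<nu> / 2 * (1 / \<gamma> (T + 1) + (\<Sum>t=1..T. \<beta> (t + 1))) \<le> M * \<nu> / 2 * ((2 + 1 / (1 - \<kappa>)) * real T powr (1 - \<kappa>))"
      using M_nonneg \<nu> by (intro mult_left_mono) auto
    also have "\<dots> = M / 2 * (2 + 1 / (1 - \<kappa>)) * (\<nu> * real T powr (1 - \<kappa>))" by simp
    finally have 1: "M * \<nu> / 2 * (1 / \<gamma> (T + 1) + (\<Sum>t=1..T. \<beta> (t + 1))) \<le> M / 2 * (2 + 1 / (1 - \<kappa>)) * real T powr (1 - \<kappa> / 2)"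
      unfolding \<nu>T .
    have 2: "ccv_const * (1 + (\<Sum>t=1..T. \<tau> t)) \<le> ccv_const * (2 * s)"
      using rb s ccv_const_nonneg sched.\<Psi>[OF T] by (intro mult_left_mono) auto
    have "ccv_const * ?n * \<mu> * (\<Sum>t=1..T. \<alpha> (t + 1)) \<le> ccv_const * ?n * \<mu> * (2 * rate T)"
      using ccv_const_nonneg \<mu> by (intro mult_left_mono sched.sum_\<alpha>_le) auto
    also have "\<dots> = 2 * ccv_const * ?n * (\<mu> * rate T)" by simp
    finally have 3: "ccv_const * ?n * \<mu> * (\<Sum>t=1..T. \<alpha> (t + 1)) \<le> 2 * ccv_const * ?n * s" unfolding \<mu>s .
    have "(1 / \<nu> + ccv_const / \<mu>) * (LINT \<omega>|\<Omega>. energy_at T \<omega>) \<le> (1 / \<nu> + ccv_const / \<mu>) * (CE * real T)"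
      using energy[OF T] \<nu> \<mu> ccv_const_nonneg by (intro mult_left_mono) auto
    also have "\<dots> = CE * (real T / \<nu>) + ccv_const * CE * (real T / \<mu>)" by (simp add: algebra_simps)
    finally have 4: "(1 / \<nu> + ccv_const / \<mu>) * (LINT \<omega>|\<Omega>. energy_at T \<omega>) \<le> CE * real T powr (1 - \<kappa> / 2) + ccv_const * CE * s"
      unfolding \<mu>s \<nu>T .
    have "(LINT \<omega>|\<Omega>. net_ccv m g T (\<lambda>i t. x i t \<omega>)) \<le> A * real T powr (1 - \<kappa> / 2) + B * s"
    proof -
      have "A * real T powr (1 - \<kappa> / 2) + B * s = M / 2 * (2 + 1 / (1 - \<kappa>)) * real T powr (1 - \<kappa> / 2) + ccv_const * (2 * s)
          + 2 * ccv_const * ?n * s + (CE * real T powr (1 - \<kappa> / 2) + ccv_const * CE * s)"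
        unfolding A_def B_def by (simp add: algebra_simps)
      then show ?thesis using expected_ccv[OF \<nu> \<mu>, of T] 1 2 3 4 by linarith
    qed
    also have "\<dots> \<le> (A + B) * real T powr (1 - \<kappa> / 2) + (A + B) * s"
      using A B s r0 by (intro add_mono mult_right_mono) auto
    finally show "(LINT \<omega>|\<Omega>. net_ccv m g T (\<lambda>i t. x i t \<omega>)) \<le> (A + B) * (real T powr (1 - \<kappa> / 2) + sqrt (real T * rate T))"
      by (simp add: algebra_simps s_def)
  qed (use A B in simp)
qed

end

text \<open>The lower bounds on \<open>\<Psi> T\<close> behind the second inequality are
  \<open>T * \<tau> T\<close>, \<open>ln T\<close> and 1 in the three regimes.\<close>

lemma trigger_rates:
  fixes \<tau> \<Psi> \<alpha> :: "nat \<Rightarrow> real" and \<theta> :: real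
  assumes \<theta>: "\<theta> > 0" and \<tau>: "\<And>t. t \<ge> 1 \<Longrightarrow> \<tau> t = 1 / real t powr \<theta>"
    and \<Psi>: "\<And>t. t \<ge> 1 \<Longrightarrow> \<Psi> t = (\<Sum>k=1..t. \<tau> k)"
    and \<alpha>: "\<And>t. t \<ge> 1 \<Longrightarrow> \<alpha> t = sqrt (\<Psi> t / real t)"
  shows "trigger_schedule \<tau> \<Psi> \<alpha>"
    and "\<exists>c\<ge>1. \<forall>T\<ge>1. (\<theta> = 1 \<longrightarrow> T \<ge> 2) \<longrightarrow>
      sqrt (real T * \<Psi> T) \<le> c * (if \<theta> < 1 then real T powr (1 - \<theta> / 2) else if \<theta> = 1 then sqrt (real T * ln (real T)) else sqrt (real T)) \<and>
      sqrt (real T / \<Psi> T) \<le> (if \<theta> < 1 then real T powr (\<theta> / 2) else if \<theta> = 1 then sqrt (real T / ln (real T)) else sqrt (real T))" (is ?rates)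
proof -
  show sch: "trigger_schedule \<tau> \<Psi> \<alpha>"
  proof
    show "\<tau> 1 = 1" using \<tau>[of 1] by simp
    show "\<tau> t > 0" if "t \<ge> 1" for t using that by (simp add: \<tau>)
    show "\<tau> t \<le> \<tau> s" if "1 \<le> s" "s \<le> t" for s t
      using that \<theta> by (simp add: \<tau>) (intro divide_left_mono powr_mono2 mult_pos_pos; simp)
  qed (use \<Psi> \<alpha> in auto)
  interpret trigger_schedule \<tau> \<Psi> \<alpha> by (rule sch)
  have sqrt_powr: "sqrt (real T powr a) = real T powr (a / 2)" for T a
    by (simp add: powr_half_sqrt[symmetric] powr_powr)
  consider "\<theta> < 1" | "\<theta> = 1" | "\<theta> > 1" by linarith
  then show "?rates"
  proof cases
    case 1
    have "sqrt (real T * \<Psi> T) \<le> sqrt (1 / (1 - \<theta>)) * real T powr (1 - \<theta> / 2) \<and> sqrt (real T / \<Psi> T) \<le> real T powr (\<theta> / 2)"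
      if T: "T \<ge> 1" for T
    proof
      have "real T * \<Psi> T \<le> real T * (real T powr (1 - \<theta>) / (1 - \<theta>))"
        unfolding \<Psi>[OF T] by (intro mult_left_mono trigger_sum_sub \<theta> 1 \<tau>) auto
      also have "\<dots> = 1 / (1 - \<theta>) * (real T powr (2 - \<theta>))"
        using T powr_add[of "real T" 1 "1 - \<theta>"] by simp
      finally have "sqrt (real T * \<Psi> T) \<le> sqrt (1 / (1 - \<theta>)) * sqrt (real T powr (2 - \<theta>))"
        unfolding real_sqrt_mult[symmetric] by (rule real_sqrt_le_mono)
      then show "sqrt (real T * \<Psi> T) \<le> sqrt (1 / (1 - \<theta>)) * real T powr (1 - \<theta> / 2)"
        by (simp add: sqrt_powr diff_divide_distrib)
      have "real T / \<Psi> T \<le> real T / (real T * \<tau> T)"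
        using \<Psi>_ge[OF T] T \<tau>_pos[OF T] \<Psi>_ge_1[OF T] by (intro divide_left_mono mult_pos_pos) auto
      also have "\<dots> = real T powr \<theta>" using T by (simp add: \<tau>)
      finally show "sqrt (real T / \<Psi> T) \<le> real T powr (\<theta> / 2)"
        unfolding sqrt_powr[symmetric] by (rule real_sqrt_le_mono)
    qed
    moreover have "1 \<le> sqrt (1 / (1 - \<theta>))" using 1 \<theta> by (intro real_le_rsqrt) (simp add: pos_le_divide_eq)
    ultimately show ?thesis using 1 by (intro exI[of _ "sqrt (1 / (1 - \<theta>))"]) auto
  next
    case 2
    \<comment> \<open>For \<open>T \<ge> 2\<close> the summand 1 in \<open>1 + ln T\<close> is at
      most \<open>ln T / ln 2\<close>.\<close>
    define c where "c = sqrt (1 + 1 / ln 2)"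
    have t1: "\<tau> t = 1 / real t" if "t \<ge> 1" for t using \<tau>[OF that] 2 that by simp
    have "sqrt (real T * \<Psi> T) \<le> c * sqrt (real T * ln (real T)) \<and> sqrt (real T / \<Psi> T) \<le> sqrt (real T / ln (real T))"
      if T: "T \<ge> 1" "T \<ge> 2" for T
    proof
      have l: "ln 2 \<le> ln (real T)" "0 < ln (2 :: real)" "0 < ln (real T)" using T by auto
      have "\<Psi> T \<le> 1 + ln (real T)" using trigger_sum_harmonic(2)[OF T(1) t1] by (simp add: \<Psi>[OF T(1)])
      also have "\<dots> \<le> (1 + 1 / ln 2) * ln (real T)" using l by (simp add: distrib_right)
      finally have "real T * \<Psi> T \<le> real T * ((1 + 1 / ln 2) * ln (real T))" by (intro mult_left_mono) auto
      then have "real T * \<Psi> T \<le> (1 + 1 / ln 2) * (real T * ln (real T))" by (simp add: mult_ac)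
      then show "sqrt (real T * \<Psi> T) \<le> c * sqrt (real T * ln (real T))"
        unfolding c_def real_sqrt_mult[symmetric] by (rule real_sqrt_le_mono)
      have "real T / \<Psi> T \<le> real T / ln (real T)"
        using trigger_sum_harmonic(1)[OF T(1) t1] \<Psi>_ge_1[OF T(1)] l \<Psi>[OF T(1)] by (intro divide_left_mono mult_pos_pos) auto
      then show "sqrt (real T / \<Psi> T) \<le> sqrt (real T / ln (real T))" by (rule real_sqrt_le_mono)
    qed
    moreover have "1 \<le> c" unfolding c_def by (intro real_le_rsqrt) simp
    ultimately show ?thesis using 2 by (intro exI[of _ c]) auto
  next
    case 3
    define Z where "Z = (\<Sum>t. real t powr (- \<theta>))"
    have ZT: "\<Psi> T \<le> Z" if "T \<ge> 1" for T
      unfolding Z_def \<Psi>[OF that] by (rule trigger_sum_super[OF 3 \<tau>])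
    have "sqrt (real T * \<Psi> T) \<le> sqrt Z * sqrt (real T) \<and> sqrt (real T / \<Psi> T) \<le> sqrt (real T)"
      if T: "T \<ge> 1" for T
    proof
      have "real T * \<Psi> T \<le> real T * Z" by (intro mult_left_mono ZT T) simp
      then have "real T * \<Psi> T \<le> Z * real T" by (simp only: mult.commute)
      then show "sqrt (real T * \<Psi> T) \<le> sqrt Z * sqrt (real T)"
        unfolding real_sqrt_mult[symmetric] by (rule real_sqrt_le_mono)
      have "real T / \<Psi> T \<le> real T / 1" using \<Psi>_ge_1[OF T] by (intro divide_left_mono) auto
      then show "sqrt (real T / \<Psi> T) \<le> sqrt (real T)" by simp
    qed
    moreover have "1 \<le> sqrt Z" using ZT[of 1] \<Psi>_ge_1[of 1] by simp
    ultimately show ?thesis using 3 by (intro exI[of _ "sqrt Z"]) auto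
  qed
qed

theorem corollary1:
  fixes X :: "(real^'p::finite) set"
    and f :: "'n::finite \<Rightarrow> nat \<Rightarrow> real^'p \<Rightarrow> real"
    and m :: "'n \<Rightarrow> nat"
    and g :: "'n \<Rightarrow> nat \<Rightarrow> real^'p \<Rightarrow> nat \<Rightarrow> real"
    and E :: "nat \<Rightarrow> ('n \<times> 'n) set"
    and W :: "nat \<Rightarrow> real^'n^'n"
    and r R F1 F2 \<theta> \<kappa> :: real
    and \<Psi> \<alpha> \<beta> \<gamma> \<tau> \<xi> \<delta> :: "nat \<Rightarrow> real"
    and M :: "'w measure"
    and u :: "'n \<Rightarrow> nat \<Rightarrow> 'w \<Rightarrow> real^'p"
    and x0 :: "'n \<Rightarrow> real^'p"
    and x xh :: "'n \<Rightarrow> nat \<Rightarrow> 'w \<Rightarrow> real^'p"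
    and q :: "'n \<Rightarrow> nat \<Rightarrow> 'w \<Rightarrow> nat \<Rightarrow> real"
  assumes "problem_assms X f m g r R F1 F2"
    and "graph_assms E W"
    and "feasibility_assm X m g"
    and "\<theta> > 0" and "0 < \<kappa>" and "\<kappa> < 1"
    and "\<And>t. t \<ge> 1 \<Longrightarrow> \<tau> t = 1 / real t powr \<theta>"
    and "\<And>t. t \<ge> 1 \<Longrightarrow> \<Psi> t = (\<Sum>k=1..t. \<tau> k)"
    and "\<And>t. t \<ge> 1 \<Longrightarrow> \<alpha> t = sqrt (\<Psi> t / real t)"
    and "\<And>t. t \<ge> 1 \<Longrightarrow> \<beta> t = 1 / real t powr \<kappa>"
    and "\<And>t. t \<ge> 1 \<Longrightarrow> \<gamma> t = 1 / real t powr (1 - \<kappa>)"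
    and "\<And>t. t \<ge> 1 \<Longrightarrow> \<xi> t = 1 / (real t + 1)"
    and "\<And>t. t \<ge> 1 \<Longrightarrow> \<delta> t = r / (real t + 1)"
    and "prob_space M"
    and "prob_space.indep_vars M (\<lambda>_. borel) (\<lambda>(i, t). u i t) (UNIV \<times> {1..})"
    and "\<And>i t. t \<ge> 1 \<Longrightarrow> distr M borel (u i t) = uniform_sphere"
    and "\<And>i t \<omega>. t \<ge> 1 \<Longrightarrow> \<omega> \<in> space M \<Longrightarrow> u i t \<omega> \<in> sphere 0 1"
    and "\<And>i. x0 i \<in> (*\<^sub>R) (1 - \<xi> 1) ` X"
    and "\<And>\<omega>. \<omega> \<in> space M \<Longrightarrow>
           algorithm_run X f m g W \<alpha> \<beta> \<gamma> \<tau> \<xi> \<delta> x0 (\<lambda>i t. u i t \<omega>)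
             (\<lambda>i t. x i t \<omega>) (\<lambda>i t. xh i t \<omega>) (\<lambda>i t. q i t \<omega>)"
  shows "(\<exists>C. \<forall>T y. T \<ge> 1 \<longrightarrow> (\<theta> = 1 \<longrightarrow> T \<ge> 2) \<longrightarrow> y \<in> feasible_seqs X m g T \<longrightarrow>
           integrable M (\<lambda>\<omega>. net_reg f T (\<lambda>i t. x i t \<omega>) y) \<and>
           (LINT \<omega>|M. net_reg f T (\<lambda>i t. x i t \<omega>) y) \<le> C *
             (if \<theta> < 1 then real T powr max \<kappa> (1 - \<theta> / 2) + real T powr (\<theta> / 2) * path_length T y
              else if \<theta> = 1 then real T powr \<kappa> + sqrt (real T * ln (real T))
                                   + sqrt (real T / ln (real T)) * path_length T y
              else real T powr max \<kappa> (1 / 2) + sqrt (real T) * path_length T y)) \<and>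
         (\<exists>C. \<forall>T. T \<ge> 1 \<longrightarrow> (\<theta> = 1 \<longrightarrow> T \<ge> 2) \<longrightarrow>
           integrable M (\<lambda>\<omega>. net_ccv m g T (\<lambda>i t. x i t \<omega>)) \<and>
           (LINT \<omega>|M. net_ccv m g T (\<lambda>i t. x i t \<omega>)) \<le> C *
             (if \<theta> < 1 then real T powr max (1 - \<kappa> / 2) (1 - \<theta> / 4)
              else if \<theta> = 1 then real T powr (1 - \<kappa> / 2) + real T powr (3 / 4) * ln (real T) powr (1 / 4)
              else real T powr max (1 - \<kappa> / 2) (3 / 4)))"
proof -
  note \<tau> = assms(7) and \<Psi> = assms(8) and \<alpha> = assms(9) and \<beta> = assms(10) and \<gamma> = assms(11) and \<xi> = assms(12) and \<delta> = assms(13)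
  interpret prob_space M by (rule assms(14))
  have rX: "r > 0" using assms(1) by (simp add: problem_assms_def)
  obtain K where K: "K \<ge> 0" "\<And>z e T. perturbed_consensus W z (e :: nat \<Rightarrow> 'n \<Rightarrow> real^'p) \<Longrightarrow>
       (\<Sum>t=1..T. spread (z t)) \<le> K * (spread (z 1) + (\<Sum>t=1..T. \<Sum>i\<in>UNIV. norm (e t i)))"
    by (rule perturbed_consensus_sum[OF assms(2)]) (rule that)
  note sch = trigger_rates(1)[OF assms(4) \<tau> \<Psi> \<alpha>]
  have setting: "bandit_setting X f m g r R F1 F2 W K \<alpha> \<beta> \<gamma> \<tau> \<xi> \<delta>"
  proof
    fix t :: nat assume t: "t \<ge> 1"
    show "doubly_stochastic (W t)" using assms(2) t by (simp add: graph_assms_def)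
    show "\<alpha> t > 0" by (rule trigger_schedule.\<alpha>_pos[OF sch t])
    show "\<alpha> (t + 1) \<le> \<alpha> t" by (rule trigger_schedule.\<alpha>_dec[OF sch t])
    show "\<beta> t > 0" "\<gamma> t > 0" using t by (simp_all add: \<beta> \<gamma>)
    show "\<beta> (t + 1) \<le> \<beta> t" "\<gamma> (t + 1) \<le> \<gamma> t"
      using t assms(5,6) by (auto simp: \<beta> \<gamma> intro!: divide_left_mono powr_mono2 mult_pos_pos)
    have "real t powr \<kappa> * real t powr (1 - \<kappa>) = real t" using t by (simp add: powr_add[symmetric])
    then show "\<beta> t * \<gamma> t \<le> 1" using t by (simp add: \<beta> \<gamma>)
    show "1 / \<gamma> (t + 1) - 1 / \<gamma> t \<le> \<beta> (t + 1)"
      using powr_Suc_diff_le[OF t assms(5,6)] t by (simp add: \<beta> \<gamma> powr_minus_divide)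
    show "\<tau> t \<ge> 0" using t by (simp add: \<tau>)
    show "0 < \<xi> t" "\<xi> t < 1" "\<xi> (t + 1) \<le> \<xi> t" using t by (simp_all add: \<xi> frac_le)
    show "0 < \<delta> t" "\<delta> t \<le> r * \<xi> t" using t rX by (simp_all add: \<xi> \<delta>)
  qed (use assms(1) K in auto)
  have proc: "bandit_process X f m g r R F1 F2 W K \<alpha> \<beta> \<gamma> \<tau> \<xi> \<delta> M x0 u x xh q"
  proof (intro bandit_process.intro bandit_process_axioms.intro setting)
    show "prob_space M" by (rule assms(14))
    show "x0 i \<in> bandit_setting.Xs X \<xi> 1" for i
      unfolding bandit_setting.Xs_def[OF setting] by (rule assms(18))
    show "norm (u i t \<omega>) = 1" if "t \<ge> 1" "\<omega> \<in> space M" for i t \<omega>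
      using assms(17)[OF that, of i] by simp
  qed (use assms(15,16,19) in auto)
  interpret bs: bandit_schedule X f m g r R F1 F2 W K \<alpha> \<beta> \<gamma> \<tau> \<xi> \<delta> M x0 u x xh q \<Psi> \<kappa>
    by (intro bandit_schedule.intro bandit_schedule_axioms.intro proc sch) (use assms(5,6) \<beta> \<gamma> \<xi> in auto)
  define s where "s T = (if \<theta> < 1 then real T powr (1 - \<theta> / 2) else if \<theta> = 1 then sqrt (real T * ln (real T)) else sqrt (real T))" for T :: nat
  define p where "p T = (if \<theta> < 1 then real T powr (\<theta> / 2) else if \<theta> = 1 then sqrt (real T / ln (real T)) else sqrt (real T))" for T :: nat
  obtain c where c: "c \<ge> 1" and rate: "\<And>T. T \<ge> 1 \<Longrightarrow> (\<theta> = 1 \<longrightarrow> T \<ge> 2) \<Longrightarrow> sqrt (real T * \<Psi> T) \<le> c * s T \<and> sqrt (real T / \<Psi> T) \<le> p T"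
    using trigger_rates(2)[OF assms(4) \<tau> \<Psi> \<alpha>] unfolding s_def p_def by blast
  have s0: "s T \<ge> 0" and p0: "p T \<ge> 0" if "T \<ge> 1" for T using that by (auto simp: s_def p_def)
  have powr_max1: "real T powr a \<le> real T powr max a b" and powr_max2: "real T powr b \<le> real T powr max a b" if "T \<ge> 1" for T a b
    using that by (auto intro!: powr_mono)
  have half: "sqrt z = z powr (1 / 2)" if "z \<ge> 0" for z :: real using that by (simp add: powr_half_sqrt)
  obtain C1 where C1: "C1 \<ge> 0" and reg: "\<And>T y. T \<ge> 1 \<Longrightarrow> y \<in> feasible_seqs X m g T \<Longrightarrow>
      (LINT \<omega>|M. net_reg f T (\<lambda>i t. x i t \<omega>) y) \<le> C1 * (sqrt (real T * \<Psi> T) + real T powr \<kappa> + sqrt (real T / \<Psi> T) * path_length T y)"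
    using bs.regret_rate unfolding bs.sched.rate_def by blast
  obtain C2 where C2: "C2 \<ge> 0" and ccv: "\<And>T. T \<ge> 1 \<Longrightarrow>
      (LINT \<omega>|M. net_ccv m g T (\<lambda>i t. x i t \<omega>)) \<le> C2 * (real T powr (1 - \<kappa> / 2) + sqrt (real T * sqrt (real T * \<Psi> T)))"
    using bs.ccv_rate[OF assms(3)] unfolding bs.sched.rate_def by blast
  \<comment> \<open>As \<open>c \<ge> 1\<close>, it can be pulled out as a common factor of all
    three summands.\<close>
  have reg': "(LINT \<omega>|M. net_reg f T (\<lambda>i t. x i t \<omega>) y) \<le> C1 * c * (s T + real T powr \<kappa> + p T * path_length T y)"
    if T: "T \<ge> 1" "\<theta> = 1 \<longrightarrow> T \<ge> 2" and y: "y \<in> feasible_seqs X m g T" for T y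
  proof -
    have "sqrt (real T / \<Psi> T) * path_length T y \<le> p T * path_length T y"
      using rate[OF T] bs.path_length_nonneg by (intro mult_right_mono) auto
    also have "\<dots> \<le> c * (p T * path_length T y)"
      using mult_right_mono[OF c mult_nonneg_nonneg[OF p0[OF T(1)] bs.path_length_nonneg]] by simp
    finally have "sqrt (real T * \<Psi> T) + real T powr \<kappa> + sqrt (real T / \<Psi> T) * path_length T y \<le> c * (s T + real T powr \<kappa> + p T * path_length T y)"
      using rate[OF T] mult_right_mono[OF c, of "real T powr \<kappa>"] by (simp add: distrib_left)
    from order_trans[OF reg[OF T(1) y] mult_left_mono[OF this C1]] show ?thesis by (simp add: mult.assoc)
  qed
  have ccv': "(LINT \<omega>|M. net_ccv m g T (\<lambda>i t. x i t \<omega>)) \<le> C2 * c * (real T powr (1 - \<kappa> / 2) + sqrt (real T * s T))"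
    if T: "T \<ge> 1" "\<theta> = 1 \<longrightarrow> T \<ge> 2" for T
  proof -
    have "c * 1 \<le> c * c" using c by (intro mult_left_mono) auto
    then have "sqrt c \<le> c" using c by (intro real_le_lsqrt) (auto simp: power2_eq_square)
    have "real T * sqrt (real T * \<Psi> T) \<le> c * (real T * s T)"
      using mult_left_mono[OF conjunct1[OF rate[OF T]], of "real T"] by (simp add: mult_ac)
    then have "sqrt (real T * sqrt (real T * \<Psi> T)) \<le> sqrt c * sqrt (real T * s T)"
      unfolding real_sqrt_mult[of c, symmetric] by (rule real_sqrt_le_mono)
    also have "\<dots> \<le> c * sqrt (real T * s T)"
      using \<open>sqrt c \<le> c\<close> s0[OF T(1)] by (intro mult_right_mono) auto
    finally have "real T powr (1 - \<kappa> / 2) + sqrt (real T * sqrt (real T * \<Psi> T)) \<le> c * (real T powr (1 - \<kappa> / 2) + sqrt (real T * s T))"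
      using mult_right_mono[OF c, of "real T powr (1 - \<kappa> / 2)"] by (simp add: distrib_left)
    from order_trans[OF ccv[OF T(1)] mult_left_mono[OF this C2]] show ?thesis by (simp add: mult.assoc)
  qed
  \<comment> \<open>Both powers of \<open>T\<close> are at most the one with the larger exponent,
    whence the factor 2.\<close>
  have cases_reg: "s T + real T powr \<kappa> + p T * path_length T y \<le> 2 * (if \<theta> < 1 then real T powr max \<kappa> (1 - \<theta> / 2) + real T powr (\<theta> / 2) * path_length T y
              else if \<theta> = 1 then real T powr \<kappa> + sqrt (real T * ln (real T))
                                   + sqrt (real T / ln (real T)) * path_length T y
              else real T powr max \<kappa> (1 / 2) + sqrt (real T) * path_length T y)" (is "_ \<le> 2 * ?r")
    if T: "T \<ge> 1" for T and y :: "nat \<Rightarrow> real^'p"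
  proof -
    have P: "0 \<le> p T * path_length T y" by (rule mult_nonneg_nonneg[OF p0[OF T] bs.path_length_nonneg])
    consider "\<theta> < 1" | "\<theta> = 1" | "\<theta> > 1" by linarith
    then show ?thesis
    proof cases
      case 1
      then show ?thesis using P powr_max1[OF T, of "\<kappa>" "1 - \<theta> / 2"] powr_max2[OF T, of "1 - \<theta> / 2" "\<kappa>"] by (simp add: s_def p_def mult.commute)
    next
      case 2
      then show ?thesis using P s0[OF T] by (simp add: s_def p_def mult.commute)
    next
      case 3
      then show ?thesis using P powr_max1[OF T, of "\<kappa>" "1 / 2"] powr_max2[OF T, of "1 / 2" "\<kappa>"] half[of "real T"] by (simp add: s_def p_def mult.commute)
    qed
  qed
  have cases_ccv: "real T powr (1 - \<kappa> / 2) + sqrt (real T * s T) \<le> 2 * (if \<theta> < 1 then real T powr max (1 - \<kappa> / 2) (1 - \<theta> / 4)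
              else if \<theta> = 1 then real T powr (1 - \<kappa> / 2) + real T powr (3 / 4) * ln (real T) powr (1 / 4)
              else real T powr max (1 - \<kappa> / 2) (3 / 4))"
    if T: "T \<ge> 1" for T
  proof -
    \<comment> \<open>Applied with \<open>a = 1 - \<theta> / 2\<close> and \<open>a = 1 / 2\<close>,
      this gives the exponents \<open>1 - \<theta> / 4\<close> and \<open>3 / 4\<close>.\<close>
    have q: "sqrt (real T * real T powr a) = real T powr ((1 + a) / 2)" for a
    proof -
      have "real T * real T powr a = real T powr (1 + a)" using T by (simp add: powr_add)
      then show ?thesis by (simp add: half powr_powr)
    qed
    consider "\<theta> < 1" | "\<theta> = 1" | "\<theta> > 1" by linarith
    then show ?thesis
    proof cases
      case 1
      have e: "(1 + (1 - \<theta> / 2)) / 2 = 1 - \<theta> / 4" by (simp add: field_simps)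
      then show ?thesis
        using 1 powr_max1[OF T, of "1 - \<kappa> / 2" "1 - \<theta> / 4"] powr_max2[OF T, of "1 - \<theta> / 4" "1 - \<kappa> / 2"] q[of "1 - \<theta> / 2", unfolded e] by (simp add: s_def)
    next
      case 2
      have "sqrt (real T * ln (real T)) = real T powr (1 / 2) * ln (real T) powr (1 / 2)"
        using T by (simp add: real_sqrt_mult half)
      then have "sqrt (real T * s T) = sqrt (real T * real T powr (1 / 2)) * sqrt (ln (real T) powr (1 / 2))"
        using 2 by (simp add: s_def real_sqrt_mult)
      also have "\<dots> = real T powr (3 / 4) * ln (real T) powr (1 / 4)"
        using T by (simp add: q half powr_powr)
      finally show ?thesis using 2 by simp
    next
      case 3
      then show ?thesis
        using powr_max1[OF T, of "1 - \<kappa> / 2" "3 / 4"] powr_max2[OF T, of "3 / 4" "1 - \<kappa> / 2"] q[of "1 / 2"] half[of "real T"] by (simp add: s_def)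
    qed
  qed
  show ?thesis
  proof (rule conjI[OF exI[of _ "2 * (C1 * c)"] exI[of _ "2 * (C2 * c)"]]; intro conjI allI impI)
    fix T :: nat and y assume T: "1 \<le> T" "\<theta> = 1 \<longrightarrow> 2 \<le> T" and y: "y \<in> feasible_seqs X m g T"
    show "integrable M (\<lambda>\<omega>. net_reg f T (\<lambda>i t. x i t \<omega>) y)" by (rule bs.integrable_net_reg)
    have "C1 * c \<ge> 0" using C1 c by simp
    from order_trans[OF reg'[OF T y] mult_left_mono[OF cases_reg[OF T(1)] this]]
    show "(LINT \<omega>|M. net_reg f T (\<lambda>i t. x i t \<omega>) y) \<le> 2 * (C1 * c) *
             (if \<theta> < 1 then real T powr max \<kappa> (1 - \<theta> / 2) + real T powr (\<theta> / 2) * path_length T y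
              else if \<theta> = 1 then real T powr \<kappa> + sqrt (real T * ln (real T))
                                   + sqrt (real T / ln (real T)) * path_length T y
              else real T powr max \<kappa> (1 / 2) + sqrt (real T) * path_length T y)"
      by (simp only: mult_ac)
  next
    fix T :: nat assume T: "1 \<le> T" "\<theta> = 1 \<longrightarrow> 2 \<le> T"
    show "integrable M (\<lambda>\<omega>. net_ccv m g T (\<lambda>i t. x i t \<omega>))" by (rule bs.integrable_net_ccv)
    have "C2 * c \<ge> 0" using C2 c by simp
    from order_trans[OF ccv'[OF T] mult_left_mono[OF cases_ccv[OF T(1)] this]]
    show "(LINT \<omega>|M. net_ccv m g T (\<lambda>i t. x i t \<omega>)) \<le> 2 * (C2 * c) *
             (if \<theta> < 1 then real T powr max (1 - \<kappa> / 2) (1 - \<theta> / 4)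
              else if \<theta> = 1 then real T powr (1 - \<kappa> / 2) + real T powr (3 / 4) * ln (real T) powr (1 / 4)
              else real T powr max (1 - \<kappa> / 2) (3 / 4))"
      by (simp only: mult_ac)
  qed
qed

end
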